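(* Let $E$ be a Banach space and let $A\colon\mathbb{R}\to\mathcal{L}(E)$ be an asymptotically hyperbolic path, with $A(t)$ essentially hyperbolic for every $t$, such that the projectors $\{P^+(A(t)):t\in\mathbb{R}\}$ are compact perturbation of each other (i.e. all the differences $P^+(A(t))-P^+(A(s))$ are compact). Then $$\operatorname{sf}(A)=-\dim\bigl(E^-(A(+\infty)),E^-(A(-\infty))\bigr).$$
   Context: A path $A\colon\mathbb{R}\to\mathcal{L}(E)$ is asymptotically hyperbolic if it is norm-continuous and has norm limits $A(\pm\infty)$ as $t\to\pm\infty$, both hyperbolic, i.e. with spectrum disjoint from $i\mathbb{R}$ (for real $E$, spectra are those of the complexification). $E^-(A(\pm\infty))$ is the range of the spectral projector of $A(\pm\infty)$ associated with the part of the spectrum with negative real part. $T\in\mathcal{L}(E)$ is essentially hyperbolic ($T\in e\mathcal{H}(E)$) if $T-\lambda I$ is Fredholm for all $\lambda\in i\mathbb{R}$. For such $T$, $\sigma(T)\cap i\mathbb{R}$ is a finite set of isolated points of $\sigma(T)$, and $P^+(T)$ denotes the spectral projector of $T$ associated with $\sigma(T)\cap\{\operatorname{Re}z>0\}$. Relative dimension: closed complemented subspaces $X,Y\subset E$ are compact perturbation of each other if, for projectors $P,Q$ with ranges $X,Y$, $(I-P)Q$ and $(I-Q)P$ are compact; then $\dim(X,Y):=\operatorname{ind}(Q|_X\colon X\to Y)$, independent of choices. For projectors $Q,R$ with $Q-R$ compact, $[Q-R]:=\dim(\operatorname{Range}Q,\operatorname{Range}R)$. Spectral flow: for a continuous path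 $B\colon[a,b]\to e\mathcal{H}(E)$ there is a continuous path of projectors $Q\colon[a,b]\to\mathcal{L}(E)$ with $Q(t)-P^+(B(t))$ compact for every $t$; set $\operatorname{sf}(B,[a,b])=[Q(a)-P^+(B(a))]-[Q(b)-P^+(B(b))]$, which does not depend on $Q$. For an asymptotically hyperbolic path $A$ in $e\mathcal{H}(E)$ on $\mathbb{R}$, choose $\delta>0$ such that $A(t)$ is hyperbolic for $|t|\ge\delta$ and set $\operatorname{sf}(A)=\operatorname{sf}(A,[-\delta,\delta])$, independent of $\delta$. *)

theory Defs
  imports "HOL-Analysis.Analysis"
begin

section \<open>Real and complex Banach spaces\<close>

text \<open>
  A Banach space over \<open>\<real>\<close> or \<open>\<complex>\<close> is a type of class \<^class>\<open>banach\<close> (a real Banach space)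
  together with a value of the following type: either no further structure, or a
  multiplication by complex scalars.
\<close>

datatype 'op scalar_structure = Real_Scalars | Complex_Scalars "complex \<Rightarrow> 'op"

type_synonym 'a scalars = "('a \<Rightarrow>\<^sub>L 'a) scalar_structure"

fun banach_over :: "'a::banach scalars \<Rightarrow> bool" where
  "banach_over Real_Scalars \<longleftrightarrow> True"
| "banach_over (Complex_Scalars m) \<longleftrightarrow>
     (\<forall>c d x. m (c + d) x = m c x + m d x) \<and>
     (\<forall>c d x. m (c * d) x = m c (m d x)) \<and>
     (\<forall>r x. m (complex_of_real r) x = r *\<^sub>R x) \<and>
     (\<forall>c x. norm (m c x) = cmod c * norm x)"

fun operators :: "'a::real_normed_vector scalars \<Rightarrow> ('a \<Rightarrow>\<^sub>L 'a) set" where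
  "operators Real_Scalars = UNIV"
| "operators (Complex_Scalars m) = {T. \<forall>c. T o\<^sub>L m c = m c o\<^sub>L T}"

fun subspace_over :: "'a::real_normed_vector scalars \<Rightarrow> 'a set \<Rightarrow> bool" where
  "subspace_over Real_Scalars S = subspace S"
| "subspace_over (Complex_Scalars m) S = module.subspace (\<lambda>c. blinfun_apply (m c)) S"

fun span_over :: "'a::real_normed_vector scalars \<Rightarrow> 'a set \<Rightarrow> 'a set" where
  "span_over Real_Scalars S = span S"
| "span_over (Complex_Scalars m) S = module.span (\<lambda>c. blinfun_apply (m c)) S"

fun dim_over :: "'a::real_normed_vector scalars \<Rightarrow> 'a set \<Rightarrow> nat" where
  "dim_over Real_Scalars S = dim S"
| "dim_over (Complex_Scalars m) S = vector_space.dim (\<lambda>c. blinfun_apply (m c)) S"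

text \<open>
  The complexification of a real Banach space \<open>E\<close> is \<open>E \<times> E\<close>, where \<open>(x, y)\<close> stands for
  \<open>x + \<i>y\<close>. The product norm is only equivalent to a complex norm, but the notions used
  below (invertibility, the Fredholm property, integrals of operators) depend on the norm
  only up to equivalence.
\<close>

lift_definition complexified_scale :: "complex \<Rightarrow> ('a::real_normed_vector \<times> 'a) \<Rightarrow>\<^sub>L ('a \<times> 'a)"
  is "\<lambda>c (x, y). (Re c *\<^sub>R x - Im c *\<^sub>R y, Im c *\<^sub>R x + Re c *\<^sub>R y)"
  unfolding case_prod_unfold
  by (intro bounded_linear_Pair bounded_linear_add bounded_linear_sub
      bounded_linear_const_scaleR bounded_linear_fst bounded_linear_snd)

lift_definition complexify :: "('a::real_normed_vector \<Rightarrow>\<^sub>L 'a) \<Rightarrow> ('a \<times> 'a) \<Rightarrow>\<^sub>L ('a \<times> 'a)"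
  is "\<lambda>T (x, y). (T x, T y)"
  unfolding case_prod_unfold
  by (rule bounded_linear_Pair; erule bounded_linear_compose)
    (rule bounded_linear_fst bounded_linear_snd)+

text \<open>The left inverse of \<^const>\<open>complexify\<close>: the operator \<open>x \<mapsto> Re (S x)\<close> on \<open>E\<close>.\<close>

lift_definition real_part_operator ::
  "(('a::real_normed_vector \<times> 'a) \<Rightarrow>\<^sub>L ('a \<times> 'a)) \<Rightarrow> 'a \<Rightarrow>\<^sub>L 'a"
  is "\<lambda>S x. fst (S (x, 0))"
  by (rule bounded_linear_compose[OF bounded_linear_fst], erule bounded_linear_compose)
    (rule bounded_linear_Pair[OF bounded_linear_ident bounded_linear_zero])


section \<open>Fredholm operators, compact operators, projectors\<close>

definition fredholm :: "'a::real_normed_vector scalars \<Rightarrow> ('a \<Rightarrow>\<^sub>L 'a) \<Rightarrow> bool" where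
  "fredholm K T \<longleftrightarrow>
     (\<exists>B. finite B \<and> {x. T x = 0} \<subseteq> span_over K B) \<and>
     closed (range T) \<and>
     (\<exists>B. finite B \<and> span_over K (range T \<union> B) = UNIV)"

definition compact_operator :: "('a::real_normed_vector \<Rightarrow>\<^sub>L 'b::real_normed_vector) \<Rightarrow> bool" where
  "compact_operator T \<longleftrightarrow> (\<forall>S. bounded S \<longrightarrow> compact (closure (T ` S)))"

definition projector :: "'a::real_normed_vector scalars \<Rightarrow> ('a \<Rightarrow>\<^sub>L 'a) \<Rightarrow> bool" where
  "projector K P \<longleftrightarrow> P \<in> operators K \<and> P o\<^sub>L P = P"

text \<open>
  The dimension of the quotient \<open>Y / W\<close>, taken as the dimension of an algebraic complement
  of \<open>W\<close> in \<open>Y\<close>.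
\<close>

definition codim_in :: "'a::real_normed_vector scalars \<Rightarrow> 'a set \<Rightarrow> 'a set \<Rightarrow> nat" where
  "codim_in K W Y = dim_over K
     (SOME C. subspace_over K C \<and> W \<inter> C = {0} \<and> {w + c | w c. w \<in> W \<and> c \<in> C} = Y)"

definition index_between ::
  "'a::real_normed_vector scalars \<Rightarrow> ('a \<Rightarrow>\<^sub>L 'a) \<Rightarrow> 'a set \<Rightarrow> 'a set \<Rightarrow> int" where
  "index_between K T X Y = int (dim_over K {x \<in> X. T x = 0}) - int (codim_in K (T ` X) Y)"


section \<open>Relative dimension\<close>

definition compact_perturbation :: "'a::banach scalars \<Rightarrow> 'a set \<Rightarrow> 'a set \<Rightarrow> bool" where
  "compact_perturbation K X Y \<longleftrightarrow>
     (\<exists>P Q. projector K P \<and> projector K Q \<and> range P = X \<and> range Q = Y \<and>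
        compact_operator ((id_blinfun - P) o\<^sub>L Q) \<and> compact_operator ((id_blinfun - Q) o\<^sub>L P))"

text \<open>Meaningful if \<open>compact_perturbation K X Y\<close>; the projector onto \<open>Y\<close> is immaterial.\<close>

definition relative_dim :: "'a::banach scalars \<Rightarrow> 'a set \<Rightarrow> 'a set \<Rightarrow> int" where
  "relative_dim K X Y = index_between K (SOME Q. projector K Q \<and> range Q = Y) X Y"

definition projector_dim :: "'a::banach scalars \<Rightarrow> ('a \<Rightarrow>\<^sub>L 'a) \<Rightarrow> ('a \<Rightarrow>\<^sub>L 'a) \<Rightarrow> int" where
  "projector_dim K Q R = relative_dim K (range Q) (range R)"


section \<open>Spectrum and spectral projectors\<close>

text \<open>Spectral theory over \<open>\<complex>\<close>; the parameter \<open>m\<close> is the multiplication by complex scalars.\<close>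

definition complex_spectrum ::
  "(complex \<Rightarrow> 'a::banach \<Rightarrow>\<^sub>L 'a) \<Rightarrow> ('a \<Rightarrow>\<^sub>L 'a) \<Rightarrow> complex set" where
  "complex_spectrum m T =
     {z. \<not> (\<exists>R. R o\<^sub>L (m z - T) = id_blinfun \<and> (m z - T) o\<^sub>L R = id_blinfun)}"

definition resolvent ::
  "(complex \<Rightarrow> 'a::banach \<Rightarrow>\<^sub>L 'a) \<Rightarrow> ('a \<Rightarrow>\<^sub>L 'a) \<Rightarrow> complex \<Rightarrow> 'a \<Rightarrow>\<^sub>L 'a" where
  "resolvent m T z = (THE R. R o\<^sub>L (m z - T) = id_blinfun \<and> (m z - T) o\<^sub>L R = id_blinfun)"

text \<open>
  The Riesz projector, that is, the integral of the resolvent divided by \<open>2\<pi>\<i>\<close>, along a positively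
  oriented contour that encloses \<open>\<Sigma>\<close> and no other point of the spectrum. The integral does not
  depend on the contour. Below, \<open>\<Sigma>\<close> is the part of the spectrum in an open half plane bounded
  by the imaginary axis; if the imaginary axis carries only isolated points of the spectrum, then
  the contour can be chosen to be the boundary of a rectangle.
\<close>

definition complex_spectral_projector ::
  "(complex \<Rightarrow> 'a::banach \<Rightarrow>\<^sub>L 'a) \<Rightarrow> ('a \<Rightarrow>\<^sub>L 'a) \<Rightarrow> complex set \<Rightarrow> 'a \<Rightarrow>\<^sub>L 'a" where
  "complex_spectral_projector m T \<Sigma> =
     (let (a, b) = (SOME (a, b). Re a < Re b \<and> Im a < Im b \<and>
            \<Sigma> \<subseteq> box a b \<and> (complex_spectrum m T - \<Sigma>) \<inter> cbox a b = {});
          \<gamma> = rectpath a b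
      in integral {0..1} (\<lambda>t. m (vector_derivative \<gamma> (at t within {0..1}) / (2 * pi * \<i>))
           o\<^sub>L resolvent m T (\<gamma> t)))"

fun spectrum :: "'a::banach scalars \<Rightarrow> ('a \<Rightarrow>\<^sub>L 'a) \<Rightarrow> complex set" where
  "spectrum Real_Scalars T = complex_spectrum complexified_scale (complexify T)"
| "spectrum (Complex_Scalars m) T = complex_spectrum m T"

text \<open>
  For real scalars, \<open>\<Sigma>\<close> is meant to be invariant under conjugation. The spectral projector of the
  complexification then commutes with conjugation, so it is the complexification of its
  restriction to \<open>E\<close>.
\<close>

fun spectral_projector :: "'a::banach scalars \<Rightarrow> ('a \<Rightarrow>\<^sub>L 'a) \<Rightarrow> complex set \<Rightarrow> 'a \<Rightarrow>\<^sub>L 'a" where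
  "spectral_projector Real_Scalars T \<Sigma> =
     real_part_operator (complex_spectral_projector complexified_scale (complexify T) \<Sigma>)"
| "spectral_projector (Complex_Scalars m) T \<Sigma> = complex_spectral_projector m T \<Sigma>"

definition positive_projector :: "'a::banach scalars \<Rightarrow> ('a \<Rightarrow>\<^sub>L 'a) \<Rightarrow> 'a \<Rightarrow>\<^sub>L 'a" where
  "positive_projector K T = spectral_projector K T {z \<in> spectrum K T. Re z > 0}"

definition negative_space :: "'a::banach scalars \<Rightarrow> ('a \<Rightarrow>\<^sub>L 'a) \<Rightarrow> 'a set" where
  "negative_space K T = range (spectral_projector K T {z \<in> spectrum K T. Re z < 0})"


section \<open>Hyperbolicity\<close>

definition hyperbolic :: "'a::banach scalars \<Rightarrow> ('a \<Rightarrow>\<^sub>L 'a) \<Rightarrow> bool" where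
  "hyperbolic K T \<longleftrightarrow> spectrum K T \<inter> {z. Re z = 0} = {}"

fun essentially_hyperbolic :: "'a::banach scalars \<Rightarrow> ('a \<Rightarrow>\<^sub>L 'a) \<Rightarrow> bool" where
  "essentially_hyperbolic Real_Scalars T \<longleftrightarrow>
     (\<forall>z. Re z = 0 \<longrightarrow>
        fredholm (Complex_Scalars complexified_scale) (complexify T - complexified_scale z))"
| "essentially_hyperbolic (Complex_Scalars m) T \<longleftrightarrow>
     (\<forall>z. Re z = 0 \<longrightarrow> fredholm (Complex_Scalars m) (T - m z))"

definition asymptotically_hyperbolic ::
  "'a::banach scalars \<Rightarrow> (real \<Rightarrow> 'a \<Rightarrow>\<^sub>L 'a) \<Rightarrow> bool" where
  "asymptotically_hyperbolic K A \<longleftrightarrow>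
     continuous_on UNIV A \<and>
     (\<exists>L. (A \<longlongrightarrow> L) at_top \<and> hyperbolic K L) \<and>
     (\<exists>L. (A \<longlongrightarrow> L) at_bot \<and> hyperbolic K L)"


section \<open>Spectral flow\<close>

definition spectral_flow_on ::
  "'a::banach scalars \<Rightarrow> (real \<Rightarrow> 'a \<Rightarrow>\<^sub>L 'a) \<Rightarrow> real \<Rightarrow> real \<Rightarrow> int" where
  "spectral_flow_on K B a b =
     (let Q = (SOME Q. continuous_on {a..b} Q \<and>
            (\<forall>t\<in>{a..b}. projector K (Q t) \<and>
               compact_operator (Q t - positive_projector K (B t))))
      in projector_dim K (Q a) (positive_projector K (B a))
         - projector_dim K (Q b) (positive_projector K (B b)))"

definition spectral_flow :: "'a::banach scalars \<Rightarrow> (real \<Rightarrow> 'a \<Rightarrow>\<^sub>L 'a) \<Rightarrow> int" where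
  "spectral_flow K A =
     (let \<delta> = (SOME \<delta>. \<delta> > 0 \<and> (\<forall>t. \<bar>t\<bar> \<ge> \<delta> \<longrightarrow> hyperbolic K (A t)))
      in spectral_flow_on K A (- \<delta>) \<delta>)"

end

theory Submission
  imports Defs "HOL-Complex_Analysis.Complex_Analysis"
begin

text \<open>
  Write \<open>[Q - R]\<close> for the index of \<open>R\<close> as a map from the range of \<open>Q\<close> to the range of \<open>R\<close>.
  Since \<open>P R Q\<close> restricted to the range of \<open>P\<close> is the identity plus a compact operator, it has
  index \<open>0\<close> by Riesz theory, whence \<open>[P - Q] + [Q - R] + [R - P] = 0\<close>. Moreover \<open>[P - Q] = 0\<close>
  if \<open>P\<close> and \<open>Q\<close> are close, so that \<open>[Q(s) - Q(t)] = 0\<close> along continuous paths of projectors,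
  and \<open>[(I - P) - (I - Q)] = -[P - Q]\<close>. If the projectors \<open>P\<^sup>+(A(t))\<close> are compact perturbations of each
  other, then any path \<open>Q\<close> defining the spectral flow has compact differences, and the flow
  telescopes to \<open>[P\<^sup>+(A(\<delta>)) - P\<^sup>+(A(-\<delta>))]\<close>. The projectors \<open>P\<^sup>+(A(t))\<close> depend continuously on \<open>t\<close>
  for \<open>\<bar>t\<bar> \<ge> \<delta>\<close> up to \<open>\<plusminus>\<infinity>\<close>, so the endpoints may be replaced by the limits.
\<close>

section \<open>Index of linear maps\<close>

text \<open>Contours, projectors onto a given range, complements measuring a codimension, the number
  \<delta> and the path \<open>Q\<close> all enter the definitions through a choice operator. Each
  choice calls for a witness and for a proof that the value does not depend on it; for
  \<open>Q\<close> the constant path with value \<open>P \<delta>\<close> is a witness, because all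
  positive projectors differ by compact operators. Scalars: the linear algebra is done over any
  field, Riesz theory over the reals, and spectral theory over the complex numbers. For a real space
  the Riesz projector lives on the complexification, and its real part is a projector only because
  it commutes with conjugation. Idempotence of the Riesz projectors is obtained without nested
  contours: integrals over large squares give that the positive and negative projectors add up to
  the identity, and integrals over disjoint rectangles give that their product is zero. The first
  fact also identifies \<open>E^-\<close> with the range of \<open>I - P^+\<close>, so that the
  formula for complementary projectors produces the minus sign of the theorem.\<close>

locale linear_space = vector_space scale
  for scale :: "'a::field \<Rightarrow> 'b::ab_group_add \<Rightarrow> 'b"
begin

text \<open>\<open>extends W Y n\<close> means that \<open>Y / W\<close> has dimension \<open>n\<close>; the spaces themselves may have infinite
  dimension. Adding one dimension at a time makes quotients unnecessary.\<close>

inductive extends :: "'b set \<Rightarrow> 'b set \<Rightarrow> nat \<Rightarrow> bool" where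
  refl: "subspace W \<Longrightarrow> extends W W 0"
| step: "extends W Y n \<Longrightarrow> x \<notin> Y \<Longrightarrow> extends W (span (insert x Y)) (Suc n)"

section \<open>Codimension of nested subspaces\<close>

lemma extends_subspace:
  assumes "extends W Y n"
  shows "subspace W" "subspace Y" "W \<subseteq> Y"
  using assms
proof (induction)
  case (step W Y n x)
  { case 1 then show ?case using step by blast
  next case 2 then show ?case by simp
  next case 3 then show ?case using step by (meson dual_order.trans span_superset subset_insertI)
  }
qed auto

lemma mem_span_insert:
  assumes "subspace Y"
  shows "z \<in> span (insert x Y) \<longleftrightarrow> (\<exists>k. z - scale k x \<in> Y)"
proof -
  have "span Y = Y" using assms by (simp add: span_eq_iff)
  then show ?thesis by (simp only: span_insert mem_Collect_eq)
qed

lemma extends_trans: "extends Y Z k \<Longrightarrow> extends W Y n \<Longrightarrow> extends W Z (n + k)"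
  by (induction rule: extends.induct) (auto intro: extends.intros)

text \<open>Steinitz exchange for one vector: the last vector of a chain may be replaced by any
  other new vector of the same span.\<close>

lemma span_insert_cancel:
  assumes "subspace Y" "y \<in> span (insert x Y)" "y \<notin> Y"
  shows "span (insert y Y) = span (insert x Y)"
proof -
  obtain k where k: "y - scale k x \<in> Y"
    using assms mem_span_insert by blast
  have "k \<noteq> 0" using k assms(3) by auto
  have "x - scale (1 / k) y = scale (- 1 / k) (y - scale k x)"
    using \<open>k \<noteq> 0\<close> by (simp add: scale_right_diff_distrib)
  then have "x - scale (1 / k) y \<in> Y"
    using subspace_scale[OF assms(1) k] by metis
  then have "x \<in> span (insert y Y)" using mem_span_insert[OF assms(1)] by blast
  then have "insert x Y \<subseteq> span (insert y Y)" by (meson insert_subset order_trans span_superset subset_insertI)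
  moreover have "insert y Y \<subseteq> span (insert x Y)"
    using assms(2) by (meson insert_subset order_trans span_superset subset_insertI)
  ultimately show ?thesis by (metis span_minimal subspace_span subset_antisym)
qed

lemma subspace_sum:
  assumes "subspace A" "subspace B"
  shows "subspace {x + y | x y. x \<in> A \<and> y \<in> B}"
  using subspace_sums[OF assms] by simp

lemma span_insert_sum:
  assumes A: "subspace A" and B: "subspace B"
  shows "{a + b | a b. a \<in> span (insert x A) \<and> b \<in> B}
    = span (insert x {a + b | a b. a \<in> A \<and> b \<in> B})"
proof (intro set_eqI iffI)
  fix z assume "z \<in> {a + b | a b. a \<in> span (insert x A) \<and> b \<in> B}"
  then obtain a b k where "z = a + b" "a - scale k x \<in> A" "b \<in> B"
    using mem_span_insert[OF A] by blast
  then show "z \<in> span (insert x {a + b | a b. a \<in> A \<and> b \<in> B})"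
    unfolding mem_span_insert[OF subspace_sum[OF A B]]
    by (intro exI[of _ k] CollectI exI[of _ "a - scale k x"] exI[of _ b]) simp
next
  fix z assume "z \<in> span (insert x {a + b | a b. a \<in> A \<and> b \<in> B})"
  then obtain k a b where "z - scale k x = a + b" "a \<in> A" "b \<in> B"
    unfolding mem_span_insert[OF subspace_sum[OF A B]] by auto
  then have "z = (a + scale k x) + b" "a + scale k x \<in> span (insert x A)" "b \<in> B"
    using mem_span_insert[OF A] by (auto simp: algebra_simps intro!: exI[of _ k])
  then show "z \<in> {a + b | a b. a \<in> span (insert x A) \<and> b \<in> B}" by blast
qed

text \<open>The second isomorphism theorem. Since \<open>W\<close> lies in \<open>B\<close>, and in
  \<open>A\<close> by the first hypothesis, \<open>W\<close> is the intersection of \<open>A\<close>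
  and \<open>B\<close>; hence \<open>(A + B) / B\<close> is isomorphic to
  \<open>A / W\<close>.\<close>

lemma extends_sum:
  assumes "extends W A n" "subspace B" "W \<subseteq> B" "A \<inter> B \<subseteq> W"
  shows "extends B {a + b | a b. a \<in> A \<and> b \<in> B} n"
  using assms
proof (induction)
  case (refl W)
  have "{a + b |a b. a \<in> W \<and> b \<in> B} = B"
    using refl by (auto intro: subspace_add) (metis add.left_neutral subspace_0)
  then show ?case using refl extends.refl by simp
next
  case (step W Y n x)
  have Y: "subspace Y" "subspace W" "W \<subseteq> Y" using extends_subspace[OF step.hyps(1)] by auto
  have sub: "Y \<subseteq> span (insert x Y)" by (meson span_superset subset_insertI order_trans)
  have IH: "extends B {a + b | a b. a \<in> Y \<and> b \<in> B} n"
    using step sub by blast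
  have "x \<notin> {a + b | a b. a \<in> Y \<and> b \<in> B}"
  proof
    assume "x \<in> {a + b | a b. a \<in> Y \<and> b \<in> B}"
    then obtain a b where ab: "x = a + b" "a \<in> Y" "b \<in> B" by blast
    have "x \<in> span (insert x Y)" "a \<in> span (insert x Y)" using sub ab by (auto intro: span_base)
    then have "x - a \<in> span (insert x Y)" by (rule span_diff)
    then have "b \<in> W" using ab step.prems by auto
    then show False using ab Y step.hyps(2) by (auto intro: subspace_add)
  qed
  from extends.step[OF IH this] show ?case
    using span_insert_sum[OF Y(1) step.prems(1)] by simp
qed

text \<open>Induction along the chain from \<open>W\<close> to \<open>Z\<close>, intersecting
  \<open>Y\<close> with the last space \<open>U\<close> before \<open>Z\<close>. If \<open>Y\<close>
  lies in \<open>U\<close>, the last step counts above \<open>Y\<close>. Otherwise exchange lets the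
  last vector be taken from \<open>Y\<close>, and the step counts below \<open>Y\<close>.\<close>

lemma extends_mid:
  assumes "extends W Z n" "subspace Y" "W \<subseteq> Y" "Y \<subseteq> Z"
  shows "\<exists>k l. extends W Y k \<and> extends Y Z l \<and> k + l = n"
  using assms
proof (induction arbitrary: Y)
  case (refl W)
  then have "Y = W" by auto
  then show ?case using refl extends.refl by force
next
  case (step W U n x)
  have U: "subspace U" "subspace W" "W \<subseteq> U" using extends_subspace[OF step.hyps(1)] by auto
  have "subspace (Y \<inter> U)" using U step.prems by (simp add: subspace_inter)
  then obtain k l where kl: "extends W (Y \<inter> U) k" "extends (Y \<inter> U) U l" "k + l = n"
    using step.IH[of "Y \<inter> U"] step.prems U by auto
  show ?case
  proof (cases "Y \<subseteq> U")
    case True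
    then have "Y \<inter> U = Y" by auto
    then have "extends W Y k" "extends Y (span (insert x U)) (Suc l)"
      using kl step.hyps(2) by (auto intro: extends.step)
    then show ?thesis using kl by (intro exI[of _ k] exI[of _ "Suc l"]) simp
  next
    case False
    then obtain y where y: "y \<in> Y" "y \<notin> U" by auto
    have eq: "span (insert x U) = span (insert y U)"
      using span_insert_cancel[OF U(1)] y step.prems by blast
    have Yeq: "Y = span (insert y (Y \<inter> U))"
    proof (rule subset_antisym)
      show "Y \<subseteq> span (insert y (Y \<inter> U))"
      proof
        fix z assume z: "z \<in> Y"
        then obtain c where "z - scale c y \<in> U"
          using step.prems eq mem_span_insert[OF U(1)] by blast
        moreover have "z - scale c y \<in> Y"
          using z y step.prems by (auto intro: subspace_diff subspace_scale)
        ultimately show "z \<in> span (insert y (Y \<inter> U))"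
          using mem_span_insert[OF \<open>subspace (Y \<inter> U)\<close>] by blast
      qed
      show "span (insert y (Y \<inter> U)) \<subseteq> Y"
        using y step.prems by (intro span_minimal) auto
    qed
    have "extends W (span (insert y (Y \<inter> U))) (Suc k)" using y by (intro extends.step[OF kl(1)]) blast
    then have "extends W Y (Suc k)" unfolding Yeq[symmetric] .
    moreover have "extends Y {a + b | a b. a \<in> U \<and> b \<in> Y} l"
      using extends_sum[OF kl(2) step.prems(1)] by auto
    moreover have "{a + b | a b. a \<in> U \<and> b \<in> Y} = span (insert y U)"
    proof
      show "{a + b | a b. a \<in> U \<and> b \<in> Y} \<subseteq> span (insert y U)"
        using eq step.prems by (auto intro!: span_add intro: span_base)
      show "span (insert y U) \<subseteq> {a + b | a b. a \<in> U \<and> b \<in> Y}"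
      proof
        fix z assume "z \<in> span (insert y U)"
        then obtain c where "z - scale c y \<in> U" using mem_span_insert[OF U(1)] by blast
        moreover have "scale c y \<in> Y" using y step.prems by (auto intro: subspace_scale)
        moreover have "z = (z - scale c y) + scale c y" by simp
        ultimately show "z \<in> {a + b | a b. a \<in> U \<and> b \<in> Y}" by blast
      qed
    qed
    ultimately show ?thesis using eq kl
      by (intro exI[of _ "Suc k"] exI[of _ l]) simp
  qed
qed

lemma extends_0_iff: "extends W Y 0 \<longleftrightarrow> subspace W \<and> W = Y"
  by (auto elim: extends.cases intro: extends.refl)

lemma extends_same:
  assumes "extends W W n"
  shows "n = 0"
  using assms
proof (cases rule: extends.cases)
  case (step Y k x)
  then show ?thesis using extends_subspace(3)[of W Y k] span_base[of x "insert x Y"] by auto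
qed simp

lemma extends_one:
  assumes "extends V (span (insert x V)) n" "x \<notin> V"
  shows "n = 1"
proof -
  have V: "subspace V" using extends_subspace assms by blast
  show ?thesis using assms(1)
  proof (cases rule: extends.cases)
    case refl
    then show ?thesis using assms(2) span_base[of x "insert x V"] by auto
  next
    case (step Y k y)
    have Y: "subspace Y" "V \<subseteq> Y" using extends_subspace step by auto
    have "Y = V"
    proof (rule ccontr)
      assume "Y \<noteq> V"
      then obtain u where u: "u \<in> Y" "u \<notin> V" using Y by auto
      have "Y \<subseteq> span (insert x V)" using step by (metis order_trans span_superset subset_insertI)
      then have "span (insert u V) = span (insert x V)" using u V by (intro span_insert_cancel) auto
      moreover have "span (insert u V) \<subseteq> Y" using u Y by (intro span_minimal) auto
      moreover have "y \<in> span (insert x V)" using step span_base by auto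
      ultimately show False using step by auto
    qed
    then show ?thesis using step extends_same by auto
  qed
qed

text \<open>The second chain is cut at the last but one space of the first chain; the upper piece
  then has length one, and the induction hypothesis handles the lower piece.\<close>

lemma extends_unique: "extends W Z n \<Longrightarrow> extends W Z m \<Longrightarrow> n = m"
proof (induction arbitrary: m rule: extends.induct)
  case (refl W)
  then show ?case using extends_same by simp
next
  case (step W Y n x)
  have Y: "subspace Y" "subspace W" "W \<subseteq> Y" using extends_subspace[OF step.hyps(1)] by auto
  obtain k l where kl: "extends W Y k" "extends Y (span (insert x Y)) l" "k + l = m"
    using extends_mid[OF step.prems Y(1,3)] by (meson order_trans span_superset subset_insertI)
  then show ?case using step.IH[OF kl(1)] extends_one[OF kl(2) step.hyps(2)] by simp
qed

lemma extends_basis: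
  "extends W Y n \<Longrightarrow> W = {0} \<Longrightarrow> \<exists>B. finite B \<and> independent B \<and> span B = Y \<and> card B = n"
proof (induction rule: extends.induct)
  case (refl W)
  then show ?case by (intro exI[of _ "{}"]) (auto simp: independent_empty)
next
  case (step W Y n x)
  then obtain B where B: "finite B" "independent B" "span B = Y" "card B = n" by blast
  have "x \<notin> B" using step B span_base by auto
  have "independent (insert x B)" using B step by (simp add: independent_insertI)
  moreover have "span (insert x B) = span (insert x Y)"
    unfolding B(3)[symmetric] by (simp only: span_insert span_span)
  ultimately show ?case using B \<open>x \<notin> B\<close>
    by (intro exI[of _ "insert x B"]) auto
qed

lemma extends_dim: "extends {0} Y n \<Longrightarrow> dim Y = n"
  using extends_basis[of "{0}" Y n] by (metis dim_eq_card span_span)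

lemma extends_span_finite:
  assumes "finite B" "subspace W"
  shows "\<exists>n. extends W (span (W \<union> B)) n"
  using assms
proof (induction B)
  case empty
  then show ?case by (metis extends.refl span_eq_iff sup_bot.right_neutral)
next
  case (insert x B)
  then obtain n where n: "extends W (span (W \<union> B)) n" by blast
  have eq: "span (W \<union> insert x B) = span (insert x (span (W \<union> B)))"
    by (simp only: Un_insert_right span_insert span_span)
  show ?case
  proof (cases "x \<in> span (W \<union> B)")
    case True
    then show ?thesis using n eq by (metis insert_absorb span_span)
  next
    case False
    then show ?thesis using extends.step[OF n False] eq by auto
  qed
qed

lemma extends_between:
  assumes "finite B" "subspace W" "subspace Y" "W \<subseteq> Y" "Y \<subseteq> span (W \<union> B)"
  shows "\<exists>n. extends W Y n"
  using extends_span_finite[OF assms(1,2)] extends_mid[OF _ assms(3-5)] by blast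

lemma set_sum_commute: "{x + y | x y. x \<in> A \<and> y \<in> B} = {y + x | y x. y \<in> B \<and> x \<in> (A :: 'b set)}"
  using add.commute by blast

text \<open>Supplies the witness for the choice of a complement in \<open>codim_in\<close>.\<close>

lemma extends_complement_ex:
  assumes "extends W Y n"
  shows "\<exists>C. subspace C \<and> W \<inter> C = {0} \<and> {w + c | w c. w \<in> W \<and> c \<in> C} = Y"
  using assms
proof (induction)
  case (refl W)
  then show ?case by (intro exI[of _ "{0}"]) (auto simp: subspace_0)
next
  case (step W Y n x)
  have Y: "subspace Y" "subspace W" "W \<subseteq> Y" using extends_subspace[OF step.hyps(1)] by auto
  obtain C where C: "subspace C" "W \<inter> C = {0}" "{w + c | w c. w \<in> W \<and> c \<in> C} = Y"
    using step by blast
  have CY: "C \<subseteq> Y" using C(3) Y(2) subspace_0[OF Y(2)] by force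
  have "{w + c | w c. w \<in> W \<and> c \<in> span (insert x C)} = span (insert x Y)"
    using span_insert_sum[OF C(1) Y(2), of x] C(3) set_sum_commute[of W] by metis
  moreover have "W \<inter> span (insert x C) = {0}"
  proof -
    have "w = 0" if w: "w \<in> W" "w \<in> span (insert x C)" for w
    proof -
      obtain k where k: "w - scale k x \<in> C" using w mem_span_insert[OF C(1)] by blast
      have "scale k x = w - (w - scale k x)" by simp
      then have "scale k x \<in> Y" using k w CY Y by (metis subsetD subspace_diff)
      then have "k = 0"
        using subspace_scale[OF Y(1), of "scale k x" "1 / k"] step.hyps(2) by (cases "k = 0") auto
      then show "w = 0" using k w C by auto
    qed
    then show ?thesis using subspace_0[OF Y(2)] by (auto simp: span_zero)
  qed
  ultimately show ?case by (intro exI[of _ "span (insert x C)"]) simp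
qed

text \<open>The exchange argument of \<open>extends_mid\<close>, for a subspace that need not
  contain \<open>W\<close>: at each step of the chain the intersection with \<open>C\<close> gains
  at most one dimension.\<close>

lemma extends_finite_dim:
  assumes "extends W Z n" "subspace C" "W \<inter> C = {0}" "C \<subseteq> Z"
  shows "\<exists>k. extends {0} C k"
  using assms
proof (induction arbitrary: C)
  case (refl W)
  then have "C = {0}" by auto
  then show ?case using extends.refl refl by blast
next
  case (step W U n x)
  have U: "subspace U" "subspace W" "W \<subseteq> U" using extends_subspace[OF step.hyps(1)] by auto
  have CU: "subspace (C \<inter> U)" using U step.prems by (simp add: subspace_inter)
  have "W \<inter> (C \<inter> U) = {0}" using step.prems U by auto
  then obtain k where k: "extends {0} (C \<inter> U) k" using step.IH[OF CU] by auto
  show ?case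
  proof (cases "C \<subseteq> U")
    case True
    then show ?thesis using k by (metis inf.absorb1)
  next
    case False
    then obtain c where c: "c \<in> C" "c \<notin> U" by blast
    from step.prems(3) c(1) have "c \<in> span (insert x U)" by (rule subsetD)
    then have eq: "span (insert c U) = span (insert x U)"
      using c(2) by (rule span_insert_cancel[OF U(1)])
    have Ceq: "C = span (insert c (C \<inter> U))"
    proof (rule subset_antisym)
      show "C \<subseteq> span (insert c (C \<inter> U))"
      proof
        fix z assume z: "z \<in> C"
        then have "z \<in> span (insert c U)" unfolding eq by (rule subsetD[OF step.prems(3)])
        then obtain d where "z - scale d c \<in> U"
          unfolding mem_span_insert[OF U(1)] by blast
        moreover have "z - scale d c \<in> C"
          using subspace_diff[OF step.prems(1) z subspace_scale[OF step.prems(1) c(1)]] .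
        ultimately show "z \<in> span (insert c (C \<inter> U))"
          using mem_span_insert[OF CU] by blast
      qed
      show "span (insert c (C \<inter> U)) \<subseteq> C"
        using c(1) by (intro span_minimal[OF _ step.prems(1)]) blast
    qed
    have "extends {0} (span (insert c (C \<inter> U))) (Suc k)" using c by (intro extends.step[OF k]) blast
    then show ?thesis unfolding Ceq[symmetric] by blast
  qed
qed

text \<open>This makes the complement chosen in \<open>codim_in\<close> immaterial. \<open>C\<close>
  has some finite dimension \<open>k\<close>, the second isomorphism theorem turns \<open>k\<close>
  into the codimension of \<open>W\<close> in \<open>Y\<close>, and codimensions are unique.\<close>

lemma extends_complement:
  assumes "extends W Y n" "subspace C" "W \<inter> C = {0}" "{w + c | w c. w \<in> W \<and> c \<in> C} = Y"
  shows "extends {0} C n"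
proof -
  have W: "subspace W" using assms extends_subspace by blast
  have "C \<subseteq> Y" using assms(4) subspace_0[OF W] by force
  then obtain k where k: "extends {0} C k" using extends_finite_dim[OF assms(1-3)] by blast
  have "extends W {c + w | c w. c \<in> C \<and> w \<in> W} k"
    using extends_sum[OF k W] assms(3) subspace_0[OF W] by auto
  moreover have "{c + w | c w. c \<in> C \<and> w \<in> W} = Y"
    unfolding assms(4)[symmetric] by (rule set_sum_commute)
  ultimately show ?thesis using k assms(1) extends_unique by metis
qed

section \<open>Linear maps and their Fredholm index\<close>

definition lin :: "('b \<Rightarrow> 'b) \<Rightarrow> bool" where
  "lin T \<longleftrightarrow> (\<forall>x y. T (x + y) = T x + T y) \<and> (\<forall>c x. T (scale c x) = scale c (T x))"

lemma lin_props:
  assumes "lin T"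
  shows "T (x + y) = T x + T y" "T (scale c x) = scale c (T x)" "T 0 = 0" "T (x - y) = T x - T y"
proof -
  show add: "T (x + y) = T x + T y" for x y using assms lin_def by auto
  show sc: "T (scale c x) = scale c (T x)" for c x using assms lin_def by auto
  show "T 0 = 0" using sc[of 0 0] by simp
  show "T (x - y) = T x - T y" using add[of "x - y" y] by simp
qed

lemma lin_comp: "lin S \<Longrightarrow> lin T \<Longrightarrow> lin (\<lambda>x. S (T x))"
  by (simp add: lin_def)

lemma subspace_image:
  assumes "lin T" "subspace X"
  shows "subspace (T ` X)"
  unfolding subspace_def
proof (intro conjI allI ballI)
  show "0 \<in> T ` X" using lin_props(3)[OF assms(1)] subspace_0[OF assms(2)] by (metis imageI)
  fix a b assume "a \<in> T ` X" "b \<in> T ` X"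
  then obtain x y where "a = T x" "b = T y" "x \<in> X" "y \<in> X" by auto
  then show "a + b \<in> T ` X"
    using lin_props(1)[OF assms(1), of x y] subspace_add[OF assms(2), of x y] by (metis imageI)
next
  fix c a assume "a \<in> T ` X"
  then obtain x where "a = T x" "x \<in> X" by auto
  then show "scale c a \<in> T ` X"
    using lin_props(2)[OF assms(1), of c x] subspace_scale[OF assms(2), of x c] by (metis imageI)
qed

lemma subspace_preimage:
  assumes "lin T" "subspace X" "subspace Y"
  shows "subspace {x \<in> X. T x \<in> Y}"
  using assms lin_props[OF assms(1)] by (auto simp: subspace_def)

lemma subspace_kernel:
  assumes "lin T" "subspace X"
  shows "subspace {x \<in> X. T x = 0}"
  using assms lin_props[OF assms(1)] by (auto simp: subspace_def)

lemma image_span_insert: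
  assumes "lin T" "subspace Y"
  shows "T ` span (insert x Y) = span (insert (T x) (T ` Y))"
proof (intro set_eqI iffI)
  note S = subspace_image[OF assms]
  fix z
  {
    assume "z \<in> T ` span (insert x Y)"
    then obtain y k where "z = T y" "y - scale k x \<in> Y" using mem_span_insert[OF assms(2)] by auto
    then have "z - scale k (T x) \<in> T ` Y" using lin_props[OF assms(1)] by (metis imageI)
    then show "z \<in> span (insert (T x) (T ` Y))" using mem_span_insert[OF S] by auto
  }
  assume "z \<in> span (insert (T x) (T ` Y))"
  then obtain k y where y: "z - scale k (T x) = T y" "y \<in> Y" using mem_span_insert[OF S] by auto
  then have "z = T (y + scale k x)" using lin_props[OF assms(1)] by (metis diff_eq_eq)
  moreover have "y + scale k x \<in> span (insert x Y)"
    using y mem_span_insert[OF assms(2)] by (metis add_diff_cancel)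
  ultimately show "z \<in> T ` span (insert x Y)" by auto
qed

text \<open>A kernel contained in \<open>W\<close> means that \<open>S\<close> induces an
  isomorphism from \<open>Y / W\<close> onto the quotient of the images.\<close>

lemma extends_image:
  assumes "extends W Y n" "lin S" "{y \<in> Y. S y = 0} \<subseteq> W"
  shows "extends (S ` W) (S ` Y) n"
  using assms
proof (induction)
  case (refl W)
  then show ?case by (intro extends.refl subspace_image)
next
  case (step W Y n x)
  have Y: "subspace Y" "subspace W" "W \<subseteq> Y" using extends_subspace[OF step.hyps(1)] by auto
  have sub: "Y \<subseteq> span (insert x Y)" by (meson span_superset subset_insertI order_trans)
  have IH: "extends (S ` W) (S ` Y) n" using step sub by blast
  have "S x \<notin> S ` Y"
  proof
    assume "S x \<in> S ` Y"
    then obtain y where y: "y \<in> Y" "S x = S y" by auto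
    then have "S (x - y) = 0" using lin_props[OF step.prems(1)] by simp
    moreover have "x - y \<in> span (insert x Y)"
      using y sub by (intro span_diff) (auto intro: span_base)
    ultimately have "x - y \<in> Y" using step.prems Y by auto
    then show False using y step.hyps(2) subspace_add[OF Y(1)] by (metis diff_add_cancel)
  qed
  then show ?case using extends.step[OF IH] image_span_insert[OF step.prems(1) Y(1)] by metis
qed

text \<open>Dual to \<open>extends_image\<close>: surjectivity onto \<open>Y\<close> makes the
  quotient of the preimages isomorphic to \<open>Y / W\<close>. With \<open>W\<close> trivial this
  computes kernels of compositions.\<close>

lemma extends_preimage:
  assumes "extends W Y n" "lin T" "subspace X" "Y \<subseteq> T ` X"
  shows "extends {x \<in> X. T x \<in> W} {x \<in> X. T x \<in> Y} n"
  using assms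
proof (induction)
  case (refl W)
  then show ?case by (intro extends.refl subspace_preimage)
next
  case (step W Y n x)
  have Y: "subspace Y" "subspace W" "W \<subseteq> Y" using extends_subspace[OF step.hyps(1)] by auto
  have sub: "Y \<subseteq> span (insert x Y)" by (meson span_superset subset_insertI order_trans)
  have IH: "extends {x \<in> X. T x \<in> W} {x \<in> X. T x \<in> Y} n" using step sub by blast
  have "x \<in> T ` X" using step.prems span_base by auto
  then obtain u where u: "u \<in> X" "T u = x" by auto
  have S: "subspace {x \<in> X. T x \<in> Y}" using step.prems Y by (intro subspace_preimage)
  have "{z \<in> X. T z \<in> span (insert x Y)} = span (insert u {x \<in> X. T x \<in> Y})"
  proof (intro set_eqI iffI)
    fix z
    {
      assume "z \<in> {z \<in> X. T z \<in> span (insert x Y)}"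
      then obtain k where "z \<in> X" "T z - scale k x \<in> Y" using mem_span_insert[OF Y(1)] by auto
      then have "z - scale k u \<in> {x \<in> X. T x \<in> Y}"
        using u lin_props[OF step.prems(1)] step.prems(2) by (auto intro: subspace_diff subspace_scale)
      then show "z \<in> span (insert u {x \<in> X. T x \<in> Y})" using mem_span_insert[OF S] by blast
    }
    assume "z \<in> span (insert u {x \<in> X. T x \<in> Y})"
    then obtain k where k: "z - scale k u \<in> X" "T (z - scale k u) \<in> Y"
      using mem_span_insert[OF S] by blast
    then have "z \<in> X" using u step.prems(2) subspace_add[OF step.prems(2), of "z - scale k u" "scale k u"]
      by (auto intro: subspace_scale)
    then show "z \<in> {z \<in> X. T z \<in> span (insert x Y)}"
      using k u lin_props[OF step.prems(1)] mem_span_insert[OF Y(1)] by auto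
  qed
  moreover have "u \<notin> {x \<in> X. T x \<in> Y}" using u step.hyps by auto
  ultimately show ?case using extends.step[OF IH] by simp
qed

text \<open>A relation, so that asserting a value also asserts that kernel and cokernel have finite
  dimension and that \<open>T\<close> maps \<open>X\<close> into \<open>Y\<close>.\<close>

definition fredholm_index :: "('b \<Rightarrow> 'b) \<Rightarrow> 'b set \<Rightarrow> 'b set \<Rightarrow> int \<Rightarrow> bool" where
  "fredholm_index T X Y i \<longleftrightarrow>
     (\<exists>k c. extends {0} {x \<in> X. T x = 0} k \<and> extends (T ` X) Y c \<and> i = int k - int c)"

lemma fredholm_index_cong:
  assumes "\<And>x. x \<in> X \<Longrightarrow> S x = T x"
  shows "fredholm_index S X Y i \<longleftrightarrow> fredholm_index T X Y i"
proof -
  have "{x \<in> X. S x = 0} = {x \<in> X. T x = 0}" "S ` X = T ` X" using assms by auto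
  then show ?thesis by (simp add: fredholm_index_def)
qed

lemma fredholm_index_unique: "fredholm_index T X Y i \<Longrightarrow> fredholm_index T X Y j \<Longrightarrow> i = j"
  unfolding fredholm_index_def using extends_unique by blast

lemma fredholm_index_bij:
  assumes "lin T" "subspace X" "subspace Y" "T ` X = Y" "\<And>x. x \<in> X \<Longrightarrow> T x = 0 \<Longrightarrow> x = 0"
  shows "fredholm_index T X Y 0"
proof -
  have "{x \<in> X. T x = 0} = {0}"
    using assms lin_props(3)[OF assms(1)] subspace_0[OF assms(2)] by auto
  then show ?thesis unfolding fredholm_index_def using assms extends_0_iff
    by (intro exI[of _ 0]) (auto simp: extends_0_iff)
qed

text \<open>With \<open>R\<close> the range of \<open>T\<close>, \<open>N\<close> the kernel of
  \<open>S\<close> and \<open>D\<close> their intersection, the kernel of the composition gains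
  \<open>e = dim D\<close> over that of \<open>T\<close>, and its cokernel gains
  \<open>g = dim Y / (N + R)\<close> over that of \<open>S\<close>. The number
  \<open>f = dim N / D = dim (N + R) / R\<close> occurs in \<open>c = e + f\<close> and in
  \<open>b = f + g\<close> and cancels in the sum of the indices.\<close>

lemma fredholm_index_comp:
  assumes T: "lin T" "subspace X" and S: "lin S"
    and i: "fredholm_index T X Y i" and j: "fredholm_index S Y Z j"
  shows "fredholm_index (\<lambda>x. S (T x)) X Z (i + j)"
proof -
  define N where "N = {y \<in> Y. S y = 0}"
  define R where "R = T ` X"
  define D where "D = R \<inter> N"
  obtain a b where ab: "extends {0} {x \<in> X. T x = 0} a" "extends R Y b" "i = int a - int b"
    using i unfolding fredholm_index_def R_def by auto
  obtain c d where cd: "extends {0} N c" "extends (S ` Y) Z d" "j = int c - int d"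
    using j unfolding fredholm_index_def N_def by auto
  have sub: "subspace R" "subspace Y" "R \<subseteq> Y" "subspace N"
    using extends_subspace[OF ab(2)] extends_subspace[OF cd(1)] by auto
  then have D: "subspace D" by (simp add: D_def subspace_inter)
  obtain e f where ef: "extends {0} D e" "extends D N f" "e + f = c"
    using extends_mid[OF cd(1) D] subspace_0[OF D] by (auto simp: D_def)
  define RN where "RN = {n + r | n r. n \<in> N \<and> r \<in> R}"
  have RN: "extends R RN f"
    unfolding RN_def using ef(2) sub by (intro extends_sum) (auto simp: D_def)
  have "RN \<subseteq> Y" using sub by (auto simp: RN_def N_def intro: subspace_add)
  then obtain f' g where g: "extends R RN f'" "extends RN Y g" "f' + g = b"
    using extends_mid[OF ab(2)] extends_subspace[OF RN] by blast
  have "f' = f" using RN g extends_unique by blast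
  have "extends {x \<in> X. T x \<in> {0}} {x \<in> X. T x \<in> D} e"
    using ef(1) T by (intro extends_preimage) (auto simp: D_def R_def)
  moreover have "{x \<in> X. T x \<in> D} = {x \<in> X. S (T x) = 0}"
    using sub(3) by (auto simp: D_def R_def N_def)
  ultimately have k: "extends {0} {x \<in> X. S (T x) = 0} (a + e)"
    using ab(1) extends_trans by auto
  have "extends (S ` RN) (S ` Y) g"
  proof (rule extends_image[OF g(2) S])
    have "n = n + 0" for n :: 'b by simp
    then show "{y \<in> Y. S y = 0} \<subseteq> RN"
      unfolding RN_def N_def using subspace_0[OF sub(1)] by blast
  qed
  moreover have "S ` RN = (\<lambda>x. S (T x)) ` X"
  proof (intro set_eqI iffI)
    fix z
    { assume "z \<in> S ` RN"
      then obtain n x where "z = S (n + T x)" "S n = 0" "x \<in> X" by (auto simp: RN_def N_def R_def)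
      then show "z \<in> (\<lambda>x. S (T x)) ` X" using lin_props[OF S] by auto }
    assume "z \<in> (\<lambda>x. S (T x)) ` X"
    then obtain x where "x \<in> X" "z = S (0 + T x)" by auto
    then show "z \<in> S ` RN" unfolding RN_def using subspace_0[OF sub(4)] R_def by blast
  qed
  ultimately have "extends ((\<lambda>x. S (T x)) ` X) Z (g + d)" using extends_trans cd by simp
  moreover have "i + j = int (a + e) - int (g + d)"
    using ab(3) cd(3) ef(3) g(3) \<open>f' = f\<close> by linarith
  ultimately show ?thesis using k unfolding fredholm_index_def by blast
qed

text \<open>The kernel of \<open>T\<close> lies in that of \<open>S T\<close>, and the range of
  \<open>T\<close> contains that of \<open>T S\<close>. Only the existence of an index is obtained;
  its value comes from other arguments.\<close>

lemma fredholm_index_from_comp: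
  assumes T: "lin T" "subspace X" "T ` X \<subseteq> Y" and S: "lin S" "subspace Y" "S ` Y \<subseteq> X"
    and i: "fredholm_index (\<lambda>x. S (T x)) X X i" and j: "fredholm_index (\<lambda>x. T (S x)) Y Y j"
  shows "\<exists>k. fredholm_index T X Y k"
proof -
  obtain a where a: "extends {0} {x \<in> X. S (T x) = 0} a"
    using i unfolding fredholm_index_def by auto
  have "\<exists>k. extends {0} {x \<in> X. T x = 0} k"
  proof -
    have "{0} \<subseteq> {x \<in> X. T x = 0}" "{x \<in> X. T x = 0} \<subseteq> {x \<in> X. S (T x) = 0}"
      using lin_props(3)[OF T(1)] lin_props(3)[OF S(1)] subspace_0[OF T(2)] by auto
    then show ?thesis using extends_mid[OF a subspace_kernel[OF T(1,2)]] by blast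
  qed
  moreover obtain b where b: "extends ((\<lambda>x. T (S x)) ` Y) Y b"
    using j unfolding fredholm_index_def by auto
  have "\<exists>c. extends (T ` X) Y c"
  proof -
    have "(\<lambda>x. T (S x)) ` Y \<subseteq> T ` X" using S(3) by auto
    then show ?thesis using extends_mid[OF b subspace_image[OF T(1,2)]] T(3) by blast
  qed
  ultimately show ?thesis unfolding fredholm_index_def by blast
qed

text \<open>Kernels add up because the images of the two summands lie in the independent spaces
  \<open>Y\<close> and \<open>Y'\<close>. For the cokernel, the range \<open>A\<close> is enlarged
  one summand at a time: \<open>A\<close> to \<open>B = Y + T X'\<close>, and \<open>B\<close> to
  \<open>U = Y + Y'\<close>.\<close>

lemma fredholm_index_sum:
  assumes T: "lin T" and i: "fredholm_index T X Y i" and j: "fredholm_index T X' Y' j"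
    and X: "subspace X" "subspace X'" "X \<inter> X' = {0}" and Y: "Y \<inter> Y' = {0}"
    and XX: "{x + x' | x x'. x \<in> X \<and> x' \<in> X'} = V" and YY: "{y + y' | y y'. y \<in> Y \<and> y' \<in> Y'} = U"
  shows "fredholm_index T V U (i + j)"
proof -
  obtain a b where ab: "extends {0} {x \<in> X. T x = 0} a" "extends (T ` X) Y b" "i = int a - int b"
    using i unfolding fredholm_index_def by auto
  obtain c d where cd: "extends {0} {x \<in> X'. T x = 0} c" "extends (T ` X') Y' d" "j = int c - int d"
    using j unfolding fredholm_index_def by auto
  note sub = extends_subspace[OF ab(2)] extends_subspace[OF cd(2)]
  have ker: "{x \<in> V. T x = 0} = {x + x' | x x'. x \<in> {x \<in> X. T x = 0} \<and> x' \<in> {x \<in> X'. T x = 0}}"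
    (is "?l = ?r")
  proof
    show "?r \<subseteq> ?l" using XX lin_props[OF T] by auto
    show "?l \<subseteq> ?r"
    proof
      fix z assume z: "z \<in> ?l"
      then obtain x x' where x: "z = x + x'" "x \<in> X" "x' \<in> X'" using XX by auto
      then have "T x + T x' = 0" using z lin_props[OF T] by auto
      moreover have "T x \<in> Y" "T x' \<in> Y'" using sub x by auto
      moreover have "T x = - T x'" using calculation(1) by (simp add: eq_neg_iff_add_eq_0)
      ultimately have "T x \<in> Y \<inter> Y'" using sub subspace_neg by auto
      then have "T x = 0" "T x' = 0" using Y \<open>T x + T x' = 0\<close> by auto
      then show "z \<in> ?r" using x by blast
    qed
  qed
  have k': "extends {x \<in> X'. T x = 0} {x \<in> V. T x = 0} a"
    unfolding ker using X lin_props(3)[OF T] subspace_0[OF X(2)]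
    by (intro extends_sum[OF ab(1)] subspace_kernel[OF T]) auto
  have k: "extends {0} {x \<in> V. T x = 0} (c + a)" using extends_trans[OF k' cd(1)] .
  define A where "A = {y + z | y z. y \<in> T ` X \<and> z \<in> T ` X'}"
  define B where "B = {y + z | y z. y \<in> Y \<and> z \<in> T ` X'}"
  have A: "T ` V = A"
  proof (intro set_eqI iffI)
    fix z
    { assume "z \<in> T ` V"
      then obtain x x' where "x \<in> X" "x' \<in> X'" "z = T x + T x'"
        using XX lin_props[OF T] by auto
      then show "z \<in> A" unfolding A_def by auto }
    assume "z \<in> A"
    then obtain x x' where "x \<in> X" "x' \<in> X'" "z = T (x + x')"
      using lin_props[OF T] unfolding A_def by auto
    then show "z \<in> T ` V" using XX by auto
  qed
  have zero: "0 \<in> T ` X" "0 \<in> T ` X'" "0 \<in> Y" using sub subspace_0 by auto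
  have sA: "subspace A" unfolding A_def by (intro subspace_sum sub)
  have sB: "subspace B" unfolding B_def by (intro subspace_sum sub)
  have "extends A {y + r | y r. y \<in> Y \<and> r \<in> A} b"
  proof (rule extends_sum[OF ab(2) sA])
    show "T ` X \<subseteq> A" using zero by (force simp: A_def)
    show "Y \<inter> A \<subseteq> T ` X"
    proof
      fix z assume "z \<in> Y \<inter> A"
      then obtain p q where pq: "z = p + q" "p \<in> T ` X" "q \<in> T ` X'" "z \<in> Y" by (auto simp: A_def)
      then have "z - p \<in> Y" using sub by (intro subspace_diff) auto
      then have "q \<in> Y \<inter> Y'" using pq sub by auto
      then show "z \<in> T ` X" using pq Y by auto
    qed
  qed
  moreover have "{y + r | y r. y \<in> Y \<and> r \<in> A} = B"
  proof
    show "{y + r | y r. y \<in> Y \<and> r \<in> A} \<subseteq> B"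
    proof
      fix z assume "z \<in> {y + r | y r. y \<in> Y \<and> r \<in> A}"
      then obtain y p q where "z = y + p + q" "y \<in> Y" "p \<in> T ` X" "q \<in> T ` X'"
        by (auto simp: A_def add.assoc)
      moreover have "y + p \<in> Y" using calculation sub by (intro subspace_add) auto
      ultimately show "z \<in> B" by (auto simp: B_def)
    qed
    have "q = 0 + q" for q :: 'b by simp
    then show "B \<subseteq> {y + r | y r. y \<in> Y \<and> r \<in> A}"
      using zero unfolding A_def B_def by blast
  qed
  ultimately have 1: "extends (T ` V) B b" using A by simp
  have "extends B {y + r | y r. y \<in> Y' \<and> r \<in> B} d"
  proof (rule extends_sum[OF cd(2) sB])
    show "T ` X' \<subseteq> B" using zero by (force simp: B_def)
    show "Y' \<inter> B \<subseteq> T ` X'"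
    proof
      fix z assume "z \<in> Y' \<inter> B"
      then obtain p q where pq: "z = p + q" "p \<in> Y" "q \<in> T ` X'" "z \<in> Y'" by (auto simp: B_def)
      then have "z - q \<in> Y'" using sub by (intro subspace_diff) auto
      then have "p \<in> Y \<inter> Y'" using pq sub by auto
      then show "z \<in> T ` X'" using pq Y by auto
    qed
  qed
  moreover have "{y + r | y r. y \<in> Y' \<and> r \<in> B} = U"
  proof
    show "{y + r | y r. y \<in> Y' \<and> r \<in> B} \<subseteq> U"
    proof
      fix z assume "z \<in> {y + r | y r. y \<in> Y' \<and> r \<in> B}"
      then obtain y p q where "z = y + (p + q)" "y \<in> Y'" "p \<in> Y" "q \<in> T ` X'"
        by (auto simp: B_def)
      then have "z = p + (y + q)" "y \<in> Y'" "p \<in> Y" "q \<in> T ` X'" by (auto simp: algebra_simps)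
      moreover have "y + q \<in> Y'" using calculation sub by (intro subspace_add) auto
      ultimately show "z \<in> U" using YY by auto
    qed
    show "U \<subseteq> {y + r | y r. y \<in> Y' \<and> r \<in> B}"
    proof
      fix z assume "z \<in> U"
      then obtain p y where "z = y + (p + 0)" "y \<in> Y'" "p \<in> Y" using YY by (auto simp: add.commute)
      then show "z \<in> {y + r | y r. y \<in> Y' \<and> r \<in> B}" unfolding B_def using zero by blast
    qed
  qed
  ultimately have "extends (T ` V) U (b + d)" using 1 extends_trans by metis
  moreover have "i + j = int (c + a) - int (b + d)" using ab cd by simp
  ultimately show ?thesis using k unfolding fredholm_index_def by blast
qed

lemma lin_funpow: "lin T \<Longrightarrow> lin (T ^^ n)"
  by (induction n) (auto simp: lin_def)

text \<open>Fitting decomposition: \<open>X\<close> is the direct sum of the kernel of \<open>T\<^sup>p\<close>, where rank plus nullity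
  gives index \<open>0\<close>, and the range of \<open>T\<^sup>p\<close>, on which \<open>T\<close> is onto.\<close>

lemma fredholm_index_fitting:
  assumes T: "lin T" and X: "subspace X" "T ` X \<subseteq> X"
    and ker: "\<And>q. q \<ge> p \<Longrightarrow> {x \<in> X. (T ^^ q) x = 0} = {x \<in> X. (T ^^ p) x = 0}"
    and ran: "\<And>q. q \<ge> p \<Longrightarrow> (T ^^ q) ` X = (T ^^ p) ` X"
    and fin: "finite F" "{x \<in> X. (T ^^ p) x = 0} \<subseteq> span F"
  shows "fredholm_index T X X 0"
proof -
  define N where "N = {x \<in> X. (T ^^ p) x = 0}"
  define R where "R = (T ^^ p) ` X"
  have Tp: "lin (T ^^ q)" for q using lin_funpow T by blast
  have Xp: "(T ^^ q) x \<in> X" if "x \<in> X" for q x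
    using that X(2) by (induction q) auto
  have sN: "subspace N" unfolding N_def by (intro subspace_kernel Tp X)
  have sR: "subspace R" unfolding R_def by (intro subspace_image Tp X)
  have RX: "R \<subseteq> X" using Xp by (auto simp: R_def)
  have NR: "N \<inter> R = {0}"
  \<comment> \<open>If \<open>x\<close> is the image of \<open>y\<close> under \<open>T^p\<close>
    and is killed by \<open>T^p\<close>, then \<open>y\<close> lies in the kernel of
    \<open>T^(2p)\<close>, which equals that of \<open>T^p\<close>, so \<open>x = 0\<close>.\<close>
  proof -
    have "x = 0" if "x \<in> N" "x \<in> R" for x
    proof -
      obtain y where y: "y \<in> X" "x = (T ^^ p) y" using \<open>x \<in> R\<close> R_def by auto
      have "(T ^^ (p + p)) y = 0" using y \<open>x \<in> N\<close> by (simp add: N_def funpow_add)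
      then show "x = 0" using ker[of "p + p"] y by auto
    qed
    then show ?thesis using subspace_0[OF sN] subspace_0[OF sR] by auto
  qed
  have XNR: "{n + r | n r. n \<in> N \<and> r \<in> R} = X"
  proof
    show "{n + r | n r. n \<in> N \<and> r \<in> R} \<subseteq> X" using RX X by (auto simp: N_def intro: subspace_add)
    show "X \<subseteq> {n + r | n r. n \<in> N \<and> r \<in> R}"
    proof
      fix x assume x: "x \<in> X"
      have "(T ^^ p) x \<in> (T ^^ (p + p)) ` X" using ran[of "p + p"] x by auto
      then obtain y where y: "y \<in> X" "(T ^^ p) x = (T ^^ p) ((T ^^ p) y)" by (auto simp: funpow_add)
      then have "x - (T ^^ p) y \<in> N"
        using lin_props(4)[OF Tp] x Xp X by (auto simp: N_def intro: subspace_diff)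
      moreover have "(T ^^ p) y \<in> R" using y R_def by auto
      moreover have "x = (x - (T ^^ p) y) + (T ^^ p) y" by simp
      ultimately show "x \<in> {n + r | n r. n \<in> N \<and> r \<in> R}" by blast
    qed
  qed
  have TN: "T ` N \<subseteq> N"
  proof
    fix z assume "z \<in> T ` N"
    then obtain x where x: "x \<in> X" "(T ^^ p) x = 0" "z = T x" by (auto simp: N_def)
    have "(T ^^ p) (T x) = T ((T ^^ p) x)" by (metis comp_apply funpow_Suc_right funpow.simps(2))
    then show "z \<in> N" using x X(2) lin_props(3)[OF T] by (auto simp: N_def)
  qed
  have TR: "T ` R = R"
    using ran[of "Suc p"] by (simp add: R_def image_comp)
  have kerN: "{x \<in> X. T x = 0} = {x \<in> N. T x = 0}"
  proof -
    have "x \<in> N" if "x \<in> X" "T x = 0" for x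
    proof -
      have "(T ^^ Suc p) x = 0" using that lin_props(3)[OF Tp] by (metis comp_apply funpow_Suc_right)
      then show ?thesis using ker[of "Suc p"] that N_def by auto
    qed
    then show ?thesis by (auto simp: N_def)
  qed
  have sub0: "subspace {0}" by (simp add: subspace_def)
  obtain n where n: "extends {0} N n"
    using extends_between[OF fin(1) sub0 sN] fin(2) subspace_0[OF sN] N_def
      span_mono[of F "{0} \<union> F"] by auto
  have sK: "subspace {x \<in> N. T x = 0}" using subspace_kernel[OF T sN] .
  obtain a b where ab: "extends {0} {x \<in> N. T x = 0} a" "extends {x \<in> N. T x = 0} N b" "a + b = n"
    using extends_mid[OF n sK] subspace_0[OF sK] by auto
  have "T ` {x \<in> N. T x = 0} = {0}" using subspace_0[OF sK] by force
  then have "extends {0} (T ` N) b" using extends_image[OF ab(2) T] by auto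
  moreover obtain c d where cd: "extends {0} (T ` N) c" "extends (T ` N) N d" "c + d = n"
    using extends_mid[OF n subspace_image[OF T sN] _ TN] subspace_0[OF subspace_image[OF T sN]] by auto
  \<comment> \<open>Rank plus nullity inside \<open>N\<close>: the image of \<open>N\<close> has
    dimension \<open>b\<close>, so \<open>b + d = n = a + b\<close>.\<close>
  ultimately have "d = a" using extends_unique ab(3) by fastforce
  define B where "B = {y + r | y r. y \<in> T ` N \<and> r \<in> R}"
  have TX: "T ` X = B"
  proof (intro set_eqI iffI)
    fix z
    { assume "z \<in> T ` X"
      then obtain x r where "x \<in> N" "r \<in> R" "z = T x + T r" using XNR lin_props[OF T] by auto
      then show "z \<in> B" using TR by (auto simp: B_def) }
    assume "z \<in> B"
    then obtain x r where "x \<in> N" "r \<in> R" "z = T (x + r)"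
      using TR lin_props[OF T] unfolding B_def by (smt (verit) imageE mem_Collect_eq)
    then show "z \<in> T ` X" using XNR by auto
  qed
  \<comment> \<open>Since \<open>N\<close> and \<open>R\<close> are independent, adding
    \<open>R\<close> to both the image of \<open>N\<close> and \<open>N\<close> itself leaves the
    codimension unchanged.\<close>
  have "extends B {y + r | y r. y \<in> N \<and> r \<in> B} d"
  proof (rule extends_sum[OF cd(2)])
    show "subspace B" unfolding B_def by (intro subspace_sum subspace_image[OF T sN] sR)
    show "T ` N \<subseteq> B" using subspace_0[OF sR] by (force simp: B_def)
    show "N \<inter> B \<subseteq> T ` N"
    proof
      fix z assume "z \<in> N \<inter> B"
      then obtain p q where pq: "z = p + q" "p \<in> T ` N" "q \<in> R" "z \<in> N" by (auto simp: B_def)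
      then have "z - p \<in> N" using TN sN by (intro subspace_diff) auto
      then have "q \<in> N \<inter> R" using pq by auto
      then show "z \<in> T ` N" using pq NR by auto
    qed
  qed
  moreover have "{y + r | y r. y \<in> N \<and> r \<in> B} = X"
  proof
    have "B \<subseteq> X" using TX X(2) by simp
    then show "{y + r | y r. y \<in> N \<and> r \<in> B} \<subseteq> X"
      using X(1) by (auto simp: N_def intro: subspace_add)
    have "0 \<in> T ` N" using subspace_0[OF subspace_image[OF T sN]] .
    then have "R \<subseteq> B" by (force simp: B_def)
    then show "X \<subseteq> {y + r | y r. y \<in> N \<and> r \<in> B}" using XNR by blast
  qed
  ultimately have "extends (T ` X) X d" using TX by simp
  then show ?thesis unfolding fredholm_index_def kerN
    using ab(1) \<open>d = a\<close> by (intro exI[of _ a]) auto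
qed

end

section \<open>Compact operators\<close>

lemma compact_operatorI:
  fixes T :: "'a::real_normed_vector \<Rightarrow>\<^sub>L 'b::real_normed_vector"
  assumes "\<And>S. bounded S \<Longrightarrow> \<exists>C. compact C \<and> T ` S \<subseteq> C"
  shows "compact_operator T"
  unfolding compact_operator_def
proof (intro allI impI)
  fix S :: "'a set" assume "bounded S"
  then obtain C where C: "compact C" "T ` S \<subseteq> C" using assms by blast
  then have "closure (T ` S) \<subseteq> C" by (simp add: closure_minimal compact_imp_closed)
  then have "closure (T ` S) = C \<inter> closure (T ` S)" by blast
  then show "compact (closure (T ` S))"
    using compact_Int_closed[OF C(1) closed_closure] by metis
qed

lemma compact_operator_subset:
  fixes T :: "'a::real_normed_vector \<Rightarrow>\<^sub>L 'b::real_normed_vector"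
  assumes "compact_operator T" "bounded S"
  shows "compact (closure (T ` S))" "T ` S \<subseteq> closure (T ` S)"
proof -
  show "compact (closure (T ` S))" using assms by (simp add: compact_operator_def)
  show "T ` S \<subseteq> closure (T ` S)" by (rule closure_subset)
qed

lemma compact_operator_comp_left:
  fixes T :: "'a::real_normed_vector \<Rightarrow>\<^sub>L 'b::real_normed_vector"
    and R :: "'b \<Rightarrow>\<^sub>L 'c::real_normed_vector"
  assumes "compact_operator T"
  shows "compact_operator (R o\<^sub>L T)"
proof (rule compact_operatorI)
  fix S :: "'a set" assume S: "bounded S"
  have "compact (R ` closure (T ` S))"
    by (intro compact_continuous_image compact_operator_subset[OF assms S] linear_continuous_on
        blinfun.bounded_linear_right)
  moreover have "(R o\<^sub>L T) ` S \<subseteq> R ` closure (T ` S)"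
    using compact_operator_subset(2)[OF assms S] by (auto simp: blinfun_apply_blinfun_compose)
  ultimately show "\<exists>C. compact C \<and> (R o\<^sub>L T) ` S \<subseteq> C" by blast
qed

lemma compact_operator_comp_right:
  fixes T :: "'b::real_normed_vector \<Rightarrow>\<^sub>L 'c::real_normed_vector"
    and R :: "'a::real_normed_vector \<Rightarrow>\<^sub>L 'b"
  assumes "compact_operator T"
  shows "compact_operator (T o\<^sub>L R)"
proof (rule compact_operatorI)
  fix S :: "'a set" assume S: "bounded S"
  have "bounded (R ` S)"
    using S by (intro bounded_linear_image blinfun.bounded_linear_right)
  note C = compact_operator_subset[OF assms this]
  then show "\<exists>C. compact C \<and> (T o\<^sub>L R) ` S \<subseteq> C"
    by (intro exI[of _ "closure (T ` R ` S)"]) (auto simp: blinfun_apply_blinfun_compose)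
qed

lemma compact_operator_add:
  fixes T R :: "'a::real_normed_vector \<Rightarrow>\<^sub>L 'b::real_normed_vector"
  assumes "compact_operator T" "compact_operator R"
  shows "compact_operator (T + R)"
proof (rule compact_operatorI)
  fix S :: "'a set" assume S: "bounded S"
  note T = compact_operator_subset[OF assms(1) S] and R = compact_operator_subset[OF assms(2) S]
  have "(T + R) ` S \<subseteq> {x + y | x y. x \<in> closure (T ` S) \<and> y \<in> closure (R ` S)}"
  proof
    fix z assume "z \<in> (T + R) ` S"
    then obtain x where "x \<in> S" "z = T x + R x" by (auto simp: blinfun.add_left)
    then show "z \<in> {x + y | x y. x \<in> closure (T ` S) \<and> y \<in> closure (R ` S)}"
      using T(2) R(2) by blast
  qed
  with compact_sums[OF T(1) R(1)] show "\<exists>C. compact C \<and> (T + R) ` S \<subseteq> C"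
    by (intro exI conjI)
qed

lemma compact_operator_minus:
  fixes T :: "'a::real_normed_vector \<Rightarrow>\<^sub>L 'b::real_normed_vector"
  assumes "compact_operator T"
  shows "compact_operator (- T)"
proof -
  have "(- id_blinfun) o\<^sub>L T = - T" by (rule blinfun_eqI) (simp add: blinfun.minus_left)
  then show ?thesis using compact_operator_comp_left[OF assms, of "- id_blinfun"] by simp
qed

lemma compact_operator_diff:
  fixes T R :: "'a::real_normed_vector \<Rightarrow>\<^sub>L 'b::real_normed_vector"
  assumes "compact_operator T" "compact_operator R"
  shows "compact_operator (T - R)"
  using compact_operator_add[OF assms(1) compact_operator_minus[OF assms(2)]] by simp

lemma compact_operator_0: "compact_operator (0 :: 'a::real_normed_vector \<Rightarrow>\<^sub>L 'b::real_normed_vector)"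
  by (rule compact_operatorI) (auto intro!: exI[of _ "{0}"])

lemma compact_operator_diff_swap:
  fixes T R :: "'a::real_normed_vector \<Rightarrow>\<^sub>L 'b::real_normed_vector"
  assumes "compact_operator (T - R)"
  shows "compact_operator (R - T)"
  using compact_operator_minus[OF assms] by simp

lemma compact_operator_diff_trans:
  fixes T R U :: "'a::real_normed_vector \<Rightarrow>\<^sub>L 'b::real_normed_vector"
  assumes "compact_operator (T - R)" "compact_operator (R - U)"
  shows "compact_operator (T - U)"
  using compact_operator_add[OF assms] by simp

text \<open>Needed to carry compactness of the differences of positive projectors over to the limits
  at plus and minus infinity. A finite net for the image under a nearby \<open>T i\<close> is a
  slightly coarser net for the image under \<open>L\<close>.\<close>

lemma compact_operator_limit:
  fixes T :: "'i \<Rightarrow> 'a::real_normed_vector \<Rightarrow>\<^sub>L 'b::banach"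
  assumes lim: "(T \<longlongrightarrow> L) F" and F: "F \<noteq> bot" and cpt: "\<And>i. compact_operator (T i)"
  shows "compact_operator L"
  unfolding compact_operator_def
proof (intro allI impI)
  fix S :: "'a set" assume S: "bounded S"
  then obtain B where B: "B > 0" "\<And>x. x \<in> S \<Longrightarrow> norm x \<le> B" unfolding bounded_pos by blast
  show "compact (closure (L ` S))"
    unfolding compact_eq_totally_bounded
  proof (intro conjI allI impI)
    show "complete (closure (L ` S))" by (simp add: complete_eq_closed)
    fix e :: real assume e: "e > 0"
    \<comment> \<open>Three errors of at most \<open>e / 4\<close> are added below: from the closure
      to \<open>L x\<close>, from \<open>L x\<close> to \<open>T i x\<close> on the ball of radius
      \<open>B\<close>, and from there to the net.\<close>
    have "\<forall>\<^sub>F i in F. dist (T i) L < e / (4 * B)"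
      using lim e B(1) unfolding tendsto_iff by simp
    then obtain i where i: "dist (T i) L < e / (4 * B)"
      using eventually_happens'[OF F] by blast
    obtain k where k: "finite k" "closure (T i ` S) \<subseteq> (\<Union>x\<in>k. ball x (e / 4))"
      using compact_operator_subset(1)[OF cpt S, of i] e unfolding compact_eq_totally_bounded
      by (meson divide_pos_pos zero_less_numeral)
    have "closure (L ` S) \<subseteq> (\<Union>x\<in>k. ball x e)"
    proof
      fix y assume "y \<in> closure (L ` S)"
      then obtain x where x: "x \<in> S" "dist (L x) y < e / 4"
        using e closure_approachable[of y "L ` S"] by (metis divide_pos_pos imageE zero_less_numeral)
      have "T i x \<in> closure (T i ` S)" by (intro subsetD[OF closure_subset] imageI x(1))
      then obtain c where c: "c \<in> k" "dist c (T i x) < e / 4" using k(2) by auto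
      have "dist (T i x) (L x) = norm ((T i - L) x)" by (simp add: dist_norm blinfun.diff_left)
      also have "\<dots> \<le> norm (T i - L) * norm x" by (rule norm_blinfun)
      also have "\<dots> \<le> norm (T i - L) * B" by (intro mult_left_mono B x) simp
      also have "\<dots> \<le> e / (4 * B) * B" using i B(1) by (intro mult_right_mono) (auto simp: dist_norm)
      also have "\<dots> = e / 4" using B(1) by simp
      finally have "dist (T i x) (L x) \<le> e / 4" .
      then have "dist c y < e"
        using c(2) x(2) dist_triangle[of c y "T i x"] dist_triangle[of "T i x" y "L x"] e by linarith
      then show "y \<in> (\<Union>x\<in>k. ball x e)" using c(1) by auto
    qed
    then show "\<exists>k. finite k \<and> closure (L ` S) \<subseteq> (\<Union>x\<in>k. ball x e)" using k(1) by blast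
  qed
qed

lemma compact_operator_subseq:
  fixes T :: "'a::real_normed_vector \<Rightarrow>\<^sub>L 'b::real_normed_vector" and x :: "nat \<Rightarrow> 'a"
  assumes "compact_operator T" "bounded (range x)"
  shows "\<exists>l r. strict_mono r \<and> (\<lambda>n. T (x (r n))) \<longlonglongrightarrow> l"
proof -
  have "seq_compact (closure (T ` range x))"
    using compact_operator_subset(1)[OF assms] compact_imp_seq_compact by blast
  moreover have "\<forall>n. T (x n) \<in> closure (T ` range x)"
    by (intro allI subsetD[OF closure_subset] imageI rangeI)
  ultimately obtain l r where "strict_mono r" "((\<lambda>n. T (x n)) \<circ> r) \<longlonglongrightarrow> l"
    unfolding seq_compact_def by metis
  then show ?thesis unfolding o_def by blast
qed

lemma compact_operator_not_separated:
  fixes T :: "'a::real_normed_vector \<Rightarrow>\<^sub>L 'b::real_normed_vector" and x :: "nat \<Rightarrow> 'a"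
  assumes "compact_operator T" "bounded (range x)"
    and sep: "\<And>i j. i < j \<Longrightarrow> 1 / 2 \<le> norm (T (x i) - T (x j))"
  shows False
proof -
  obtain l r where r: "strict_mono r" "(\<lambda>n. T (x (r n))) \<longlonglongrightarrow> l"
    using compact_operator_subseq[OF assms(1,2)] by blast
  have "(1::real) / 2 > 0" by simp
  then obtain N where N: "\<And>m n. m \<ge> N \<Longrightarrow> n \<ge> N \<Longrightarrow> dist (T (x (r m))) (T (x (r n))) < 1 / 2"
    using metric_CauchyD[OF LIMSEQ_imp_Cauchy[OF r(2)]] by blast
  have "r N < r (Suc N)" using r(1) by (simp add: strict_mono_def)
  from sep[OF this] N[of N "Suc N"] show False by (simp add: dist_norm)
qed

section \<open>Riesz theory\<close>

lemma infdist_pos_of_notin: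
  fixes V :: "'a::metric_space set"
  assumes "closed V" "V \<noteq> {}" "x \<notin> V"
  shows "infdist x V > 0"
  using assms in_closed_iff_infdist_zero[of V x] infdist_nonneg[of x V] by linarith

lemma infdist_approx:
  fixes V :: "'a::metric_space set"
  assumes "V \<noteq> {}" "infdist x V < d"
  shows "\<exists>v\<in>V. dist x v < d"
proof -
  have "bdd_below (dist x ` V)" by (intro bdd_belowI2[of _ 0]) simp
  then show ?thesis using assms cINF_less_iff[of V "dist x" d] by (auto simp: infdist_def)
qed

text \<open>Take a point \<open>v\<close> of \<open>V\<close> whose distance to \<open>w\<close> is
  less than twice the infimum and normalise \<open>w - v\<close>; the factor two becomes the
  separation \<open>1 / 2\<close>.\<close>

lemma riesz_lemma:
  fixes V W :: "'a::real_normed_vector set"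
  assumes V: "subspace V" "closed V" and W: "subspace W" "V \<subseteq> W" "V \<noteq> W"
  shows "\<exists>x\<in>W. norm x = 1 \<and> (\<forall>v\<in>V. 1 / 2 \<le> norm (x - v))"
proof -
  obtain w where w: "w \<in> W" "w \<notin> V" using W by blast
  have ne: "V \<noteq> {}" using subspace_0[OF V(1)] by blast
  define d where "d = infdist w V"
  have d: "d > 0" unfolding d_def using infdist_pos_of_notin[OF V(2) ne w(2)] .
  then obtain v where v: "v \<in> V" "dist w v < 2 * d"
    using infdist_approx[OF ne, of w "2 * d"] by (auto simp: d_def)
  define n where "n = norm (w - v)"
  have n: "n > 0" "n < 2 * d" using v w by (auto simp: n_def dist_norm)
  define x where "x = (1 / n) *\<^sub>R (w - v)"
  have "x \<in> W" unfolding x_def using w v W by (intro subspace_scale subspace_diff) auto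
  moreover have "norm x = 1" using n by (simp add: x_def n_def)
  moreover have "1 / 2 \<le> norm (x - u)" if u: "u \<in> V" for u
  proof -
    have "v + n *\<^sub>R u \<in> V" using V v u by (intro subspace_add subspace_scale)
    then have "d \<le> norm (w - (v + n *\<^sub>R u))" unfolding d_def dist_norm[symmetric] by (rule infdist_le)
    also have "w - (v + n *\<^sub>R u) = n *\<^sub>R (x - u)" using n by (simp add: x_def algebra_simps)
    finally have "d \<le> n * norm (x - u)" using n by simp
    then have "n / 2 \<le> n * norm (x - u)" using n by linarith
    then show ?thesis using n by (simp add: field_simps)
  qed
  ultimately show ?thesis by blast
qed

text \<open>The Riesz lemma gives unit vectors \<open>x n\<close> in \<open>V (Suc n)\<close> at
  distance at least \<open>1 / 2\<close> from \<open>V n\<close>. For \<open>i < j\<close> the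
  difference \<open>C (x j) - C (x i)\<close> is \<open>x j\<close> up to an element of
  \<open>V j\<close>, so the images under \<open>C\<close> stay separated, against
  compactness.\<close>

lemma no_strict_chain_up:
  fixes C :: "'a::real_normed_vector \<Rightarrow>\<^sub>L 'a" and V :: "nat \<Rightarrow> 'a set"
  assumes C: "compact_operator C" and V: "\<And>n. subspace (V n)" "\<And>n. closed (V n)"
    and strict: "\<And>n. V n \<subseteq> V (Suc n)" "\<And>n. V n \<noteq> V (Suc n)"
    and T: "\<And>n x. x \<in> V (Suc n) \<Longrightarrow> x - C x \<in> V n"
  shows False
proof -
  have "\<forall>n. \<exists>x. x \<in> V (Suc n) \<and> norm x = 1 \<and> (\<forall>v\<in>V n. 1 / 2 \<le> norm (x - v))"
    using riesz_lemma[OF V V(1) strict] by blast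
  then obtain x where x: "\<And>n. x n \<in> V (Suc n)" "\<And>n. norm (x n) = 1"
      "\<And>n v. v \<in> V n \<Longrightarrow> 1 / 2 \<le> norm (x n - v)" by metis
  have mono: "V i \<subseteq> V j" if "i \<le> j" for i j
    using lift_Suc_mono_le[of V, OF strict(1) that] .
  show False
  proof (rule compact_operator_not_separated[OF C])
    show "bounded (range x)" unfolding bounded_iff using x(2) by (auto intro!: exI[of _ 1])
    fix i j :: nat assume ij: "i < j"
    have "x i \<in> V j" using x(1)[of i] mono[of "Suc i" j] ij by auto
    moreover have "x i - C (x i) \<in> V j" using T[OF x(1)[of i]] mono[of i j] ij by auto
    ultimately have "x i - (x i - C (x i)) + (x j - C (x j)) \<in> V j"
      using subspace_add[OF V(1) subspace_diff[OF V(1)] T[OF x(1)[of j]]] by blast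
    from x(3)[OF this] show "1 / 2 \<le> norm (C (x i) - C (x j))"
      by (simp add: norm_minus_commute)
  qed
qed

text \<open>As for ascending chains, except that for \<open>i < j\<close> it is now
  \<open>x i\<close> that is far from the smaller space \<open>V (Suc i)\<close>, which contains all
  the correction terms.\<close>

lemma no_strict_chain_down:
  fixes C :: "'a::real_normed_vector \<Rightarrow>\<^sub>L 'a" and V :: "nat \<Rightarrow> 'a set"
  assumes C: "compact_operator C" and V: "\<And>n. subspace (V n)" "\<And>n. closed (V n)"
    and strict: "\<And>n. V (Suc n) \<subseteq> V n" "\<And>n. V (Suc n) \<noteq> V n"
    and T: "\<And>n x. x \<in> V n \<Longrightarrow> x - C x \<in> V (Suc n)"
  shows False
proof -
  have "\<forall>n. \<exists>x. x \<in> V n \<and> norm x = 1 \<and> (\<forall>v\<in>V (Suc n). 1 / 2 \<le> norm (x - v))"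
    using riesz_lemma[OF V V(1) strict] by blast
  then obtain x where x: "\<And>n. x n \<in> V n" "\<And>n. norm (x n) = 1"
      "\<And>n v. v \<in> V (Suc n) \<Longrightarrow> 1 / 2 \<le> norm (x n - v)" by metis
  have mono: "V j \<subseteq> V i" if "i \<le> j" for i j
    using lift_Suc_antimono_le[of V, OF strict(1) that] .
  show False
  proof (rule compact_operator_not_separated[OF C])
    show "bounded (range x)" unfolding bounded_iff using x(2) by (auto intro!: exI[of _ 1])
    fix i j :: nat assume ij: "i < j"
    have "x j \<in> V (Suc i)" using x(1)[of j] mono[of "Suc i" j] ij by auto
    moreover have "x j - C (x j) \<in> V (Suc i)" using T[OF x(1)[of j]] mono[of "Suc i" "Suc j"] ij by auto
    ultimately have "x j - (x j - C (x j)) + (x i - C (x i)) \<in> V (Suc i)"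
      using subspace_add[OF V(1) subspace_diff[OF V(1)] T[OF x(1)[of i]]] by blast
    from x(3)[OF this] show "1 / 2 \<le> norm (C (x i) - C (x j))"
      by simp
  qed
qed

text \<open>The coefficient of \<open>x\<close> is controlled by the norm, because \<open>x\<close>
  has positive distance \<open>d\<close> from \<open>V\<close>. So coefficients along a convergent
  sequence are Cauchy, and the parts in \<open>V\<close> converge as well.\<close>

lemma closed_span_insert:
  fixes V :: "'a::real_normed_vector set"
  assumes V: "subspace V" "closed V"
  shows "closed (span (insert x V))"
proof (cases "x \<in> V")
  case True
  then show ?thesis using V by (metis insert_absorb span_eq_iff)
next
  case False
  have ne: "V \<noteq> {}" using subspace_0[OF V(1)] by blast
  define d where "d = infdist x V"
  have d: "d > 0" unfolding d_def using infdist_pos_of_notin[OF V(2) ne False] .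
  have mem: "z \<in> span (insert x V) \<longleftrightarrow> (\<exists>k. z - k *\<^sub>R x \<in> V)" for z
  proof -
    have "span V = V" using V(1) by (rule span_subspace[OF order_refl span_superset])
    then show ?thesis by (simp only: span_insert mem_Collect_eq)
  qed
  have bound: "\<bar>k\<bar> * d \<le> norm y" if "y - k *\<^sub>R x \<in> V" for k y
  proof (cases "k = 0")
    case False
    have "- (1 / k) *\<^sub>R (y - k *\<^sub>R x) \<in> V" using that V(1) subspace_scale by blast
    then have "d \<le> norm (x - (- (1 / k) *\<^sub>R (y - k *\<^sub>R x)))"
      unfolding d_def dist_norm[symmetric] by (rule infdist_le)
    also have "x - (- (1 / k) *\<^sub>R (y - k *\<^sub>R x)) = (1 / k) *\<^sub>R y"
      using False by (simp add: scaleR_diff_right)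
    finally have "d \<le> norm y / \<bar>k\<bar>" by simp
    then show ?thesis using False by (simp add: field_simps)
  qed simp
  show ?thesis
    unfolding closed_sequential_limits
  proof (intro allI impI)
    fix y l assume A: "(\<forall>n. y n \<in> span (insert x V)) \<and> y \<longlonglongrightarrow> l"
    then have "\<forall>n. \<exists>k. y n - k *\<^sub>R x \<in> V" unfolding mem by blast
    then obtain k where k: "\<And>n. y n - k n *\<^sub>R x \<in> V" by metis
    have diff: "\<bar>k m - k n\<bar> * d \<le> norm (y m - y n)" for m n
    proof (rule bound)
      have "(y m - k m *\<^sub>R x) - (y n - k n *\<^sub>R x) \<in> V" by (rule subspace_diff[OF V(1) k k])
      then show "y m - y n - (k m - k n) *\<^sub>R x \<in> V" by (simp add: algebra_simps)
    qed
    have "Cauchy k"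
      unfolding Cauchy_def
    proof (intro allI impI)
      fix e :: real assume e: "e > 0"
      then obtain M where M: "\<And>m n. m \<ge> M \<Longrightarrow> n \<ge> M \<Longrightarrow> dist (y m) (y n) < e * d"
        using metric_CauchyD[OF LIMSEQ_imp_Cauchy, of y l "e * d"] A d by auto
      have "dist (k m) (k n) < e" if "m \<ge> M" "n \<ge> M" for m n
      proof -
        have "\<bar>k m - k n\<bar> * d < e * d" using diff[of m n] M[OF that] by (simp add: dist_norm)
        then show ?thesis using d by (simp add: dist_real_def)
      qed
      then show "\<exists>M. \<forall>m\<ge>M. \<forall>n\<ge>M. dist (k m) (k n) < e" by blast
    qed
    then obtain c where "k \<longlonglongrightarrow> c" using Cauchy_convergent_iff convergent_def by blast
    then have "(\<lambda>n. y n - k n *\<^sub>R x) \<longlonglongrightarrow> l - c *\<^sub>R x" using A by (intro tendsto_intros) auto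
    from closed_sequentially[OF V(2) _ this] have "l - c *\<^sub>R x \<in> V" using k by simp
    then show "l \<in> span (insert x V)" unfolding mem by blast
  qed
qed

lemma closed_span_finite:
  fixes F :: "'a::real_normed_vector set"
  assumes "finite F"
  shows "closed (span F)"
  using assms
proof induction
  case (insert x F)
  have "span (insert x F) = span (insert x (span F))" by (simp only: span_insert span_span)
  then show ?case using closed_span_insert[OF subspace_span insert.IH] by metis
qed simp

text \<open>If \<open>N\<close> were not finitely spanned, adding vectors one at a time would give a
  strictly ascending chain of closed spaces on which \<open>x - C x\<close> vanishes, which
  \<open>no_strict_chain_up\<close> excludes.\<close>

lemma finite_dim_of_compact_identity:
  fixes C :: "'a::real_normed_vector \<Rightarrow>\<^sub>L 'a"
  assumes C: "compact_operator C" and N: "subspace N" "\<And>x. x \<in> N \<Longrightarrow> C x = x"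
  shows "\<exists>F. finite F \<and> N \<subseteq> span F"
proof (rule ccontr)
  assume no: "\<nexists>F. finite F \<and> N \<subseteq> span F"
  have "\<exists>F. \<forall>n::nat. (finite (F n) \<and> F n \<subseteq> N) \<and> (\<exists>x\<in>N. x \<notin> span (F n) \<and> F (Suc n) = insert x (F n))"
  proof (rule dependent_nat_choice)
    show "\<exists>F. finite F \<and> F \<subseteq> N" by (intro exI[of _ "{}"]) simp
    fix F :: "'a set" and n :: nat assume F: "finite F \<and> F \<subseteq> N"
    then obtain x where "x \<in> N" "x \<notin> span F" using no by blast
    then show "\<exists>G. (finite G \<and> G \<subseteq> N) \<and> (\<exists>x\<in>N. x \<notin> span F \<and> G = insert x F)"
      using F by (intro exI[of _ "insert x F"]) auto
  qed
  then obtain F where F: "\<And>n::nat. finite (F n)" "\<And>n. F n \<subseteq> N"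
    "\<And>n. \<exists>x\<in>N. x \<notin> span (F n) \<and> F (Suc n) = insert x (F n)" by metis
  show False
  proof (rule no_strict_chain_up[OF C, of "\<lambda>n. span (F n)"])
    show "subspace (span (F n))" for n by simp
    show "closed (span (F n))" for n by (rule closed_span_finite[OF F(1)])
    fix n
    obtain x where x: "x \<in> N" "x \<notin> span (F n)" "F (Suc n) = insert x (F n)" using F(3) by blast
    show "span (F n) \<subseteq> span (F (Suc n))" unfolding x(3) by (rule span_mono) blast
    show "span (F n) \<noteq> span (F (Suc n))" using x span_base[of x "F (Suc n)"] by blast
    fix y assume "y \<in> span (F (Suc n))"
    then have "y \<in> N" using span_minimal[OF F(2) N(1)] by blast
    then show "y - C y \<in> span (F n)" using N(2) by (simp add: span_zero)
  qed
qed

text \<open>Preimages of a convergent sequence are corrected by kernel elements to be almost minimal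
  in norm. If they were unbounded, their normalisations would accumulate at a kernel element, from
  which they keep distance \<open>1 / 2\<close>. Once they are bounded, compactness of
  \<open>C\<close> yields a convergent subsequence.\<close>

lemma closed_range_id_minus_compact:
  fixes C :: "'a::real_normed_vector \<Rightarrow>\<^sub>L 'a"
  assumes C: "compact_operator C" and X: "subspace X" "closed X"
  shows "closed ((\<lambda>x. x - C x) ` X)"
proof -
  define T where "T = id_blinfun - C"
  have T: "T x = x - C x" for x by (simp add: T_def blinfun.diff_left)
  define N where "N = {x \<in> X. T x = 0}"
  have N: "subspace N" using X(1) by (auto simp: N_def subspace_def blinfun.add_right blinfun.scaleR_right)
  have Nne: "N \<noteq> {}" using subspace_0[OF N] by blast
  have closedN: "closed N"
  proof -
    have "N = X \<inter> T -` {0}" by (auto simp: N_def)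
    moreover have "closed (T -` {0})"
      by (intro closed_vimage closed_singleton linear_continuous_on blinfun.bounded_linear_right)
    ultimately show ?thesis using X(2) by (simp add: closed_Int)
  qed
  have "closed (T ` X)"
    unfolding closed_sequential_limits
  proof (intro allI impI)
    fix y l assume A: "(\<forall>n. y n \<in> T ` X) \<and> y \<longlonglongrightarrow> l"
    then have "\<forall>n. \<exists>x. x \<in> X \<and> y n = T x" by blast
    then obtain x where x: "\<And>n. x n \<in> X" "\<And>n. y n = T (x n)" by metis
    have "\<exists>z. z \<in> N \<and> norm (x n - z) \<le> 2 * infdist (x n) N" for n
    proof (cases "x n \<in> N")
      case True
      then show ?thesis by (intro exI[of _ "x n"]) (simp add: infdist_nonneg)
    next
      case False
      then have "infdist (x n) N > 0" using infdist_pos_of_notin[OF closedN Nne] by blast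
      then obtain z where "z \<in> N" "dist (x n) z < 2 * infdist (x n) N"
        using infdist_approx[OF Nne, of "x n" "2 * infdist (x n) N"] by auto
      then show ?thesis by (intro exI[of _ z]) (simp add: dist_norm)
    qed
    then obtain z where z: "\<And>n. z n \<in> N" "\<And>n. norm (x n - z n) \<le> 2 * infdist (x n) N" by metis
    define u where "u n = x n - z n" for n
    have uX: "u n \<in> X" for n using x(1) z(1) X(1) by (auto simp: u_def N_def intro: subspace_diff)
    have Tu: "T (u n) = y n" for n using z(1)[of n] x(2) by (simp add: u_def N_def blinfun.diff_right)
    \<comment> \<open>This is what almost minimal means after rescaling; the factor two is needed
      because the distance to the kernel may not be attained.\<close>
    have far: "norm (u n) / 2 \<le> norm (u n - v)" if "v \<in> N" for n v
    proof -
      have "z n + v \<in> N" using that z(1) N subspace_add by blast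
      then have "infdist (x n) N \<le> norm (x n - (z n + v))" unfolding dist_norm[symmetric] by (rule infdist_le)
      then show ?thesis using z(2)[of n] by (simp add: u_def algebra_simps)
    qed
    obtain D where D: "D > 0" "\<And>n. norm (y n) \<le> D"
      using A convergent_imp_Bseq[of y] convergentI[of y l] unfolding Bseq_def by blast
    have "bounded (range u)"
    proof (rule ccontr)
      assume "\<not> bounded (range u)"
      then have "\<forall>k::nat. \<exists>n. norm (u n) > real k + 1"
        unfolding bounded_iff by (metis not_le rangeE)
      then obtain r where r: "\<And>k::nat. norm (u (r k)) > real k + 1" by metis
      define w where "w k = (1 / norm (u (r k))) *\<^sub>R u (r k)" for k
      have pos: "norm (u (r k)) > 0" for k using r[of k] by linarith
      have wX: "w k \<in> X" for k unfolding w_def using uX X(1) subspace_scale by blast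
      have nw: "norm (w k) = 1" for k using pos[of k] by (simp add: w_def)
      have "norm (T (w k)) \<le> D * inverse (real (Suc k))" for k
      proof -
        have "norm (T (w k)) = norm (y (r k)) / norm (u (r k))"
          by (simp add: w_def blinfun.scaleR_right Tu)
        also have "\<dots> \<le> D / (real k + 1)" using D r[of k] by (intro frac_le) auto
        finally show ?thesis by (simp add: divide_inverse add.commute)
      qed
      moreover have "(\<lambda>k. D * inverse (real (Suc k))) \<longlonglongrightarrow> 0"
        using tendsto_mult_right_zero[OF LIMSEQ_inverse_real_of_nat] .
      ultimately have Tw: "(\<lambda>k. T (w k)) \<longlonglongrightarrow> 0"
        by (intro Lim_null_comparison[of "\<lambda>k. T (w k)"]) (auto intro!: always_eventually)
      have "bounded (range w)" unfolding bounded_iff using nw by (auto intro!: exI[of _ 1])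
      then obtain p s where s: "strict_mono s" "(\<lambda>k. C (w (s k))) \<longlonglongrightarrow> p"
        using compact_operator_subseq[OF C] by blast
      have "(\<lambda>k. T (w (s k)) + C (w (s k))) \<longlonglongrightarrow> 0 + p"
        using LIMSEQ_subseq_LIMSEQ[OF Tw s(1)] s(2) by (intro tendsto_add) (auto simp: o_def)
      \<comment> \<open>The identity is \<open>T + C\<close>, so convergence of \<open>T w\<close>
        to zero and of \<open>C w\<close> to \<open>p\<close> gives convergence of \<open>w\<close>
        itself.\<close>
      then have wp: "(\<lambda>k. w (s k)) \<longlonglongrightarrow> p" by (simp add: T)
      have "p \<in> X" using closed_sequentially[OF X(2) _ wp] wX by blast
      moreover have "(\<lambda>k. T (w (s k))) \<longlonglongrightarrow> T p" by (intro tendsto_intros wp)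
      then have "T p = 0" using LIMSEQ_unique LIMSEQ_subseq_LIMSEQ[OF Tw s(1)] unfolding o_def by blast
      ultimately have pN: "p \<in> N" by (simp add: N_def)
      have "1 / 2 \<le> norm (w k - p)" for k
      proof -
        define n where "n = norm (u (r k))"
        have n: "n > 0" using pos by (simp add: n_def)
        have "n *\<^sub>R p \<in> N" using pN N subspace_scale by blast
        then have "n / 2 \<le> norm (u (r k) - n *\<^sub>R p)" using far n_def by blast
        also have "u (r k) - n *\<^sub>R p = n *\<^sub>R (w k - p)"
          using n by (simp add: w_def n_def scaleR_diff_right)
        also have "norm (n *\<^sub>R (w k - p)) = n * norm (w k - p)" using n by simp
        finally have "n * (1 / 2) \<le> n * norm (w k - p)" by simp
        then show ?thesis using n by (simp only: mult_le_cancel_left_pos)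
      qed
      moreover obtain k where "dist (w (s k)) p < 1 / 2"
        using wp unfolding lim_sequentially by (metis half_gt_zero_iff le_refl zero_less_one)
      ultimately show False by (metis dist_norm not_le)
    qed
    then obtain p s where s: "strict_mono s" "(\<lambda>k. C (u (s k))) \<longlonglongrightarrow> p"
      using compact_operator_subseq[OF C] by blast
    have ys: "(\<lambda>k. y (s k)) \<longlonglongrightarrow> l" using A LIMSEQ_subseq_LIMSEQ[OF _ s(1)] unfolding o_def by blast
    have "(\<lambda>k. T (u (s k)) + C (u (s k))) \<longlonglongrightarrow> l + p"
      unfolding Tu using ys s(2) by (intro tendsto_add)
    then have us: "(\<lambda>k. u (s k)) \<longlonglongrightarrow> l + p" by (simp add: T)
    have "l + p \<in> X" using closed_sequentially[OF X(2) _ us] uX by blast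
    moreover have "(\<lambda>k. T (u (s k))) \<longlonglongrightarrow> T (l + p)" by (intro tendsto_intros us)
    then have "T (l + p) = l" using LIMSEQ_unique ys unfolding Tu by blast
    ultimately show "l \<in> T ` X" by (metis imageI)
  qed
  then show ?thesis by (simp add: T)
qed

text \<open>Every power of \<open>I - C\<close> is again the identity minus a compact operator.
  Hence the iterated kernels and ranges are closed, and the two chain lemmas forbid strict growth
  and strict decrease; two equal consecutive members force equality from there on.\<close>

lemma riesz_stabilization:
  fixes C :: "'a::real_normed_vector \<Rightarrow>\<^sub>L 'a"
  assumes C: "compact_operator C" and X: "subspace X" "closed X" "C ` X \<subseteq> X"
  defines "T \<equiv> \<lambda>x. x - C x"
  shows "\<exists>p F. (\<forall>q\<ge>p. {x \<in> X. (T ^^ q) x = 0} = {x \<in> X. (T ^^ p) x = 0}) \<and>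
    (\<forall>q\<ge>p. (T ^^ q) ` X = (T ^^ p) ` X) \<and> finite F \<and> {x \<in> X. (T ^^ p) x = 0} \<subseteq> span F"
proof -
  have "\<exists>D. compact_operator D \<and> (\<forall>x. (T ^^ n) x = x - D x)" for n
  proof (induction n)
    case 0
    then show ?case by (intro exI[of _ 0]) (simp add: compact_operator_0)
  next
    case (Suc n)
    then obtain D where D: "compact_operator D" "\<And>x. (T ^^ n) x = x - blinfun_apply D x" by blast
    have "compact_operator (D + C - (C o\<^sub>L D))"
      using D C by (intro compact_operator_diff compact_operator_add compact_operator_comp_left)
    moreover have "(T ^^ Suc n) x = x - (D + C - (C o\<^sub>L D)) x" for x
    proof -
      have "(T ^^ Suc n) x = T (x - blinfun_apply D x)" by (simp add: D(2))
      then show ?thesis by (simp add: T_def blinfun.bilinear_simps)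
    qed
    ultimately show ?case by blast
  qed
  then obtain D where D: "\<And>n. compact_operator (D n)" "\<And>n x. (T ^^ n) x = x - blinfun_apply (D n) x"
    by metis
  have TX: "T x \<in> X" if "x \<in> X" for x using that X by (auto simp: T_def intro: subspace_diff)
  have TnX: "(T ^^ n) x \<in> X" if "x \<in> X" for n x using that TX by (induction n) auto
  have bl: "bounded_linear (T ^^ n)" for n
  proof -
    have "(T ^^ n) = blinfun_apply (id_blinfun - D n)" using D by (auto simp: blinfun.diff_left)
    then show ?thesis using blinfun.bounded_linear_right by metis
  qed
  note lin = linear_simps[OF bl]
  define N where "N n = {x \<in> X. (T ^^ n) x = 0}" for n
  define R where "R n = (T ^^ n) ` X" for n
  have sN: "subspace (N n)" for n using X(1) lin[of n] by (auto simp: N_def subspace_def)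
  have sR: "subspace (R n)" for n
    unfolding R_def using X(1) bl[of n] by (intro linear_subspace_image bounded_linear.linear)
  have cN: "closed (N n)" for n
  proof -
    have "N n = X \<inter> (T ^^ n) -` {0}" by (auto simp: N_def)
    moreover have "closed ((T ^^ n) -` {0})"
      by (intro closed_vimage closed_singleton linear_continuous_on bl)
    ultimately show ?thesis using X(2) by (simp add: closed_Int)
  qed
  have cR: "closed (R n)" for n
    using closed_range_id_minus_compact[OF D(1)[of n] X(1,2)] by (simp add: R_def D(2))
  have T0: "T 0 = 0" by (simp add: T_def)
  have Nmono: "N n \<subseteq> N (Suc n)" for n using T0 by (auto simp: N_def)
  have shift: "(T ^^ Suc n) x = (T ^^ n) (T x)" for n x by (metis comp_apply funpow_Suc_right)
  have Rmono: "R (Suc n) \<subseteq> R n" for n using TX shift by (auto simp: R_def)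
  obtain p where p: "N p = N (Suc p)"
  proof (rule ccontr)
    assume "\<not> thesis"
    then have ne: "N n \<noteq> N (Suc n)" for n using that by blast
    show False
    proof (rule no_strict_chain_up[OF C, of N])
      fix n x assume x: "x \<in> N (Suc n)"
      then have "T x \<in> N n" using TX shift by (auto simp: N_def)
      then show "x - C x \<in> N n" by (simp add: T_def)
    qed (use sN cN Nmono ne in blast)+
  qed
  obtain r where r: "R (Suc r) = R r"
  proof (rule ccontr)
    assume "\<not> thesis"
    then have ne: "R (Suc n) \<noteq> R n" for n using that by blast
    show False
    proof (rule no_strict_chain_down[OF C, of R])
      fix n x assume x: "x \<in> R n"
      then have "T x \<in> R (Suc n)" by (auto simp: R_def)
      then show "x - C x \<in> R (Suc n)" by (simp add: T_def)
    qed (use sR cR Rmono ne in blast)+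
  qed
  have Nq: "N (p + k) = N p" for k
  proof (induction k)
    case (Suc k)
    have "N (p + Suc k) \<subseteq> N (p + k)"
    proof
      fix x assume x: "x \<in> N (p + Suc k)"
      have "(T ^^ Suc p) ((T ^^ k) x) = (T ^^ (Suc p + k)) x" by (simp only: funpow_add comp_apply)
      also have "\<dots> = 0" using x by (simp add: N_def)
      finally have "(T ^^ k) x \<in> N (Suc p)" using x TnX by (simp add: N_def)
      then have "(T ^^ p) ((T ^^ k) x) = 0" unfolding p[symmetric] by (simp add: N_def)
      then have "(T ^^ (p + k)) x = 0" by (simp only: funpow_add comp_apply)
      then show "x \<in> N (p + k)" using x by (simp add: N_def)
    qed
    then show ?case using Suc Nmono[of "p + k"] by auto
  qed simp
  have Rq: "R (r + k) = R r" for k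
  proof (induction k)
    case (Suc k)
    have "R (Suc n) = T ` R n" for n by (auto simp: R_def)
    then show ?case using Suc r by simp
  qed simp
  \<comment> \<open>One exponent that serves both the kernels and the ranges.\<close>
  define m where "m = max p r"
  have 1: "N q = N m" if "q \<ge> m" for q
    using Nq[of "q - p"] Nq[of "m - p"] that by (simp add: m_def)
  have 2: "R q = R m" if "q \<ge> m" for q
    using Rq[of "q - r"] Rq[of "m - r"] that by (simp add: m_def)
  have "D m x = x" if "x \<in> N m" for x using that D(2)[of m x] by (simp add: N_def)
  then obtain F where "finite F" "N m \<subseteq> span F"
    using finite_dim_of_compact_identity[OF D(1) sN] by metis
  then show ?thesis using 1 2 unfolding N_def R_def by (intro exI[of _ m] exI[of _ F]) blast
qed

text \<open>The equation \<open>x = y + S x\<close> is solved by the contraction principle;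
  uniqueness of the fixed point gives linearity of the solution operator and both inverse
  identities.\<close>

lemma neumann_inverse:
  fixes S :: "'a::banach \<Rightarrow>\<^sub>L 'a"
  assumes S: "norm S < 1"
  shows "\<exists>R. R o\<^sub>L (id_blinfun - S) = id_blinfun \<and> (id_blinfun - S) o\<^sub>L R = id_blinfun
    \<and> norm R \<le> 1 / (1 - norm S)"
proof -
  have ex: "\<exists>!x. y + S x = x" for y
  proof -
    have "\<exists>!x\<in>UNIV. y + S x = x"
    proof (rule Banach_fix[of UNIV "norm S"])
      show "dist (y + S x) (y + S x') \<le> norm S * dist x x'" for x x'
        using norm_blinfun[of S "x - x'"] by (simp add: dist_norm blinfun.diff_right)
    qed (use S in \<open>auto simp: complete_UNIV\<close>)
    then show ?thesis by simp
  qed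
  define f where "f y = (THE x. y + S x = x)" for y
  have f: "y + S (f y) = f y" for y unfolding f_def using theI'[OF ex] .
  have f_unique: "f y = x" if "y + S x = x" for x y using ex f that by blast
  have bound: "norm (f y) \<le> norm y * (1 / (1 - norm S))" for y
  proof -
    have "norm (f y) \<le> norm y + norm (S (f y))" using norm_triangle_ineq[of y "S (f y)"] f by metis
    then have "norm (f y) * (1 - norm S) \<le> norm y"
      using norm_blinfun[of S "f y"] by (simp add: algebra_simps)
    then show ?thesis using S by (simp add: field_simps)
  qed
  have "bounded_linear f"
  proof (rule bounded_linear_intro[OF _ _ bound])
    show "f (x + y) = f x + f y" for x y
    proof (rule f_unique)
      have "x + y + S (f x + f y) = (x + S (f x)) + (y + S (f y))" by (simp add: blinfun.add_right)
      then show "x + y + S (f x + f y) = f x + f y" by (simp only: f)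
    qed
    show "f (c *\<^sub>R x) = c *\<^sub>R f x" for c x
    proof (rule f_unique)
      have "c *\<^sub>R x + S (c *\<^sub>R f x) = c *\<^sub>R (x + S (f x))"
        by (simp add: blinfun.scaleR_right scaleR_add_right)
      then show "c *\<^sub>R x + S (c *\<^sub>R f x) = c *\<^sub>R f x" by (simp only: f)
    qed
  qed
  then have app: "blinfun_apply (Blinfun f) = f" by (rule bounded_linear_Blinfun_apply)
  have "Blinfun f o\<^sub>L (id_blinfun - S) = id_blinfun"
    by (rule blinfun_eqI) (auto simp: app blinfun.diff_left intro!: f_unique)
  moreover have "(id_blinfun - S) o\<^sub>L Blinfun f = id_blinfun"
  proof (rule blinfun_eqI)
    fix y
    have "f y - S (f y) = y" using f[of y] by (metis add_diff_cancel_right')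
    then show "((id_blinfun - S) o\<^sub>L Blinfun f) y = id_blinfun y" by (simp add: app blinfun.diff_left)
  qed
  moreover have "norm (Blinfun f) \<le> 1 / (1 - norm S)"
    using S bound by (intro norm_blinfun_bound) (auto simp: app mult.commute)
  ultimately show ?thesis by blast
qed

section \<open>Relative dimension of projectors\<close>

text \<open>Treats real and complex spaces at once: the notions that depend on \<open>K\<close> are
  identified with those of the vector space \<open>scale\<close>. By \<open>real_scalar\<close>
  every subspace over the scalars is a real subspace, so that Riesz theory over the reals applies to
  it.\<close>

locale scalar_banach = linear_space scale
  for scale :: "'f::field \<Rightarrow> 'a::banach \<Rightarrow> 'a" +
  fixes K :: "'a scalars"
  assumes real_scalar: "\<And>r. \<exists>c. \<forall>x. scale c x = r *\<^sub>R x"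
    and subspace_over: "subspace_over K = subspace"
    and dim_over: "dim_over K = dim"
    and operators: "\<And>T. T \<in> operators K \<longleftrightarrow> (\<forall>c x. blinfun_apply T (scale c x) = scale c (blinfun_apply T x))"
begin

lemma real_subspace: "subspace S \<Longrightarrow> Real_Vector_Spaces.subspace S"
  using real_scalar unfolding subspace_def Real_Vector_Spaces.real_vector.subspace_def by metis

lemma real_span: "Real_Vector_Spaces.span F \<subseteq> span F"
  by (rule Real_Vector_Spaces.real_vector.span_minimal[OF span_superset real_subspace[OF subspace_span]])

lemma lin_operator: "T \<in> operators K \<Longrightarrow> lin (blinfun_apply T)"
  by (simp add: operators lin_def blinfun.add_right)

lemma operators_intros:
  "id_blinfun \<in> operators K"
  "S \<in> operators K \<Longrightarrow> T \<in> operators K \<Longrightarrow> S o\<^sub>L T \<in> operators K"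
  "S \<in> operators K \<Longrightarrow> T \<in> operators K \<Longrightarrow> S + T \<in> operators K"
  "S \<in> operators K \<Longrightarrow> T \<in> operators K \<Longrightarrow> S - T \<in> operators K"
  by (simp_all add: operators blinfun.add_left blinfun.diff_left scale_right_distrib scale_right_diff_distrib)

text \<open>A finite set spanning the stable kernel over the reals spans it over the larger scalars
  too, so the real stabilisation result feeds the Fitting decomposition. \<open>T\<close> is
  prescribed on \<open>X\<close> only, which allows compositions of restricted projectors.\<close>

lemma fredholm_index_id_minus_compact:
  assumes C: "C \<in> operators K" "compact_operator C"
    and X: "subspace X" "closed X" "C ` X \<subseteq> X"
    and T: "\<And>x. x \<in> X \<Longrightarrow> T x = x - C x"
  shows "fredholm_index T X X 0"
proof -
  define D where "D = (\<lambda>x. x - C x)"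
  obtain p F where p: "\<And>q. q \<ge> p \<Longrightarrow> {x \<in> X. (D ^^ q) x = 0} = {x \<in> X. (D ^^ p) x = 0}"
    "\<And>q. q \<ge> p \<Longrightarrow> (D ^^ q) ` X = (D ^^ p) ` X" "finite F"
    "{x \<in> X. (D ^^ p) x = 0} \<subseteq> Real_Vector_Spaces.span F"
    using riesz_stabilization[OF C(2) real_subspace[OF X(1)] X(2,3)] unfolding D_def by blast
  have "D = blinfun_apply (id_blinfun - C)" by (auto simp: D_def blinfun.diff_left)
  moreover have "id_blinfun - C \<in> operators K" by (intro operators_intros C)
  ultimately have lin: "lin D" using lin_operator by metis
  have DX: "D ` X \<subseteq> X"
  proof
    fix z assume "z \<in> D ` X"
    then obtain x where "x \<in> X" "z = x - C x" by (auto simp: D_def)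
    then show "z \<in> X" using subspace_diff[OF X(1), of x "C x"] X(3) by blast
  qed
  have fin: "{x \<in> X. (D ^^ p) x = 0} \<subseteq> span F"
    by (rule subset_trans[OF p(4) real_span])
  have "fredholm_index D X X 0"
    by (rule fredholm_index_fitting[OF lin X(1) DX p(1,2,3) fin])
  then show ?thesis using fredholm_index_cong[of X T D X 0] T D_def by simp
qed

lemma index_between_eq:
  assumes "fredholm_index (blinfun_apply T) X Y i"
  shows "index_between K T X Y = i"
proof -
  obtain k c where kc: "extends {0} {x \<in> X. T x = 0} k" "extends (T ` X) Y c" "i = int k - int c"
    using assms unfolding fredholm_index_def by blast
  define P where "P C \<longleftrightarrow> subspace C \<and> T ` X \<inter> C = {0} \<and> {w + c | w c. w \<in> T ` X \<and> c \<in> C} = Y" for C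
  have "\<exists>C. P C" unfolding P_def by (rule extends_complement_ex[OF kc(2)])
  then have "P (SOME C. P C)" by (rule someI_ex)
  then have "extends {0} (SOME C. P C) c"
    using extends_complement[OF kc(2)] unfolding P_def by blast
  then have "codim_in K (T ` X) Y = c"
    unfolding codim_in_def subspace_over dim_over P_def[symmetric] by (rule extends_dim)
  moreover have "dim_over K {x \<in> X. T x = 0} = k"
    unfolding dim_over by (rule extends_dim[OF kc(1)])
  ultimately show ?thesis using kc(3) by (simp add: index_between_def)
qed

section \<open>Projectors that are equal up to compact operators\<close>

lemma projector_apply: "projector K P \<Longrightarrow> P (P x) = P x"
  unfolding projector_def by (metis blinfun_apply_blinfun_compose)

lemma projector_operators: "projector K P \<Longrightarrow> P \<in> operators K"
  by (simp add: projector_def)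

lemma projector_compl: "projector K P \<Longrightarrow> projector K (id_blinfun - P)"
  unfolding projector_def
  by (auto intro!: operators_intros blinfun_eqI simp: blinfun.bilinear_simps) (metis blinfun_apply_blinfun_compose)

lemma mem_range_projector: "projector K P \<Longrightarrow> x \<in> range P \<longleftrightarrow> P x = x"
  using projector_apply by (metis rangeE rangeI)

lemma subspace_range: "projector K P \<Longrightarrow> subspace (range P)"
  using subspace_image[OF lin_operator subspace_UNIV] projector_operators by blast

lemma closed_range_projector:
  assumes "projector K P"
  shows "closed (range P)"
proof -
  have "range P = {x. P x = x}" using mem_range_projector[OF assms] by blast
  then show ?thesis by (simp add: closed_Collect_eq blinfun.continuous_on continuous_on_id)
qed

text \<open>The condition inside \<open>compact_perturbation\<close>. Unlike compactness of
  \<open>P - Q\<close>, it depends on the two ranges only, so it survives replacing \<open>Q\<close>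
  by another projector with the same range.\<close>

definition essentially_equal :: "('a \<Rightarrow>\<^sub>L 'a) \<Rightarrow> ('a \<Rightarrow>\<^sub>L 'a) \<Rightarrow> bool" where
  "essentially_equal P Q \<longleftrightarrow> projector K P \<and> projector K Q \<and>
    compact_operator ((id_blinfun - P) o\<^sub>L Q) \<and> compact_operator ((id_blinfun - Q) o\<^sub>L P)"

lemma essentially_equal_sym: "essentially_equal P Q \<Longrightarrow> essentially_equal Q P"
  by (simp add: essentially_equal_def)

lemma essentially_equalI:
  assumes P: "projector K P" and Q: "projector K Q" and C: "compact_operator (P - Q)"
  shows "essentially_equal P Q"
proof -
  have "(id_blinfun - P) o\<^sub>L Q = (Q - P) o\<^sub>L Q"
    by (rule blinfun_eqI) (simp add: blinfun.diff_left projector_apply[OF Q])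
  moreover have "(id_blinfun - Q) o\<^sub>L P = (P - Q) o\<^sub>L P"
    by (rule blinfun_eqI) (simp add: blinfun.diff_left projector_apply[OF P])
  ultimately show ?thesis unfolding essentially_equal_def
    using compact_operator_comp_right C compact_operator_diff_swap[OF C] P Q by metis
qed

lemma fredholm_index_loop2:
  assumes "essentially_equal P Q"
  shows "fredholm_index (\<lambda>x. P (Q x)) (range P) (range P) 0"
proof (rule fredholm_index_id_minus_compact)
  define C where "C = P o\<^sub>L ((id_blinfun - Q) o\<^sub>L P)"
  have P: "projector K P" and Q: "projector K Q" using assms by (auto simp: essentially_equal_def)
  show "C \<in> operators K" unfolding C_def by (intro operators_intros projector_operators P Q)
  show "compact_operator C" unfolding C_def
    using assms by (intro compact_operator_comp_left[where R = P]) (simp add: essentially_equal_def)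
  show "subspace (range P)" "closed (range P)" by (intro subspace_range closed_range_projector P)+
  show "C ` range P \<subseteq> range P" by (auto simp: C_def)
  fix x assume "x \<in> range P"
  then show "P (Q x) = x - C x"
    using mem_range_projector[OF P] by (simp add: C_def blinfun.bilinear_simps)
qed

lemma fredholm_index_loop3:
  assumes "essentially_equal P Q" "essentially_equal Q R" "essentially_equal R P"
  shows "fredholm_index (\<lambda>x. P (R (Q x))) (range P) (range P) 0"
proof (rule fredholm_index_id_minus_compact)
  \<comment> \<open>On the range of \<open>P\<close>, the first summand is what is lost in passing
    to \<open>Q\<close>, the second what is lost in going on to \<open>R\<close>.\<close>
  define C where "C = (P o\<^sub>L ((id_blinfun - Q) o\<^sub>L P)) + (P o\<^sub>L (((id_blinfun - R) o\<^sub>L Q) o\<^sub>L P))"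
  have P: "projector K P" and Q: "projector K Q" and R: "projector K R"
    using assms by (auto simp: essentially_equal_def)
  show "C \<in> operators K" unfolding C_def by (intro operators_intros projector_operators P Q R)
  show "compact_operator C" unfolding C_def
  proof (rule compact_operator_add)
    have "compact_operator ((id_blinfun - Q) o\<^sub>L P)" using assms by (simp add: essentially_equal_def)
    then show "compact_operator (P o\<^sub>L ((id_blinfun - Q) o\<^sub>L P))" by (rule compact_operator_comp_left)
    have "compact_operator ((id_blinfun - R) o\<^sub>L Q)" using assms by (simp add: essentially_equal_def)
    then show "compact_operator (P o\<^sub>L (((id_blinfun - R) o\<^sub>L Q) o\<^sub>L P))"
      by (intro compact_operator_comp_left[OF compact_operator_comp_right])
  qed
  show "subspace (range P)" "closed (range P)" by (intro subspace_range closed_range_projector P)+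
  show "C ` range P \<subseteq> range P"
  proof -
    have "P (C x) = C x" for x by (simp add: C_def blinfun.bilinear_simps projector_apply[OF P])
    then have "C x \<in> range P" for x by (metis rangeI)
    then show ?thesis by blast
  qed
  fix x assume "x \<in> range P"
  then show "P (R (Q x)) = x - C x"
    using mem_range_projector[OF P] by (simp add: C_def blinfun.bilinear_simps)
qed

lemma fredholm_index_projector_ex:
  assumes "essentially_equal P Q"
  shows "\<exists>i. fredholm_index Q (range P) (range Q) i"
proof (rule fredholm_index_from_comp)
  have P: "projector K P" and Q: "projector K Q" using assms by (auto simp: essentially_equal_def)
  show "lin (blinfun_apply P)" "lin (blinfun_apply Q)" by (intro lin_operator projector_operators P Q)+
  show "subspace (range P)" "subspace (range Q)" by (intro subspace_range P Q)+
  show "fredholm_index (\<lambda>x. P (Q x)) (range P) (range P) 0" by (rule fredholm_index_loop2[OF assms])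
  show "fredholm_index (\<lambda>x. Q (P x)) (range Q) (range Q) 0"
    by (rule fredholm_index_loop2[OF essentially_equal_sym[OF assms]])
qed auto

lemma fredholm_index_projector_sym:
  assumes PQ: "essentially_equal P Q" and i: "fredholm_index Q (range P) (range Q) i"
    and j: "fredholm_index P (range Q) (range P) j"
  shows "i + j = 0"
proof -
  have P: "projector K P" and Q: "projector K Q" using PQ by (auto simp: essentially_equal_def)
  have "fredholm_index (\<lambda>x. P (Q x)) (range P) (range P) (i + j)"
    by (rule fredholm_index_comp[OF _ _ _ i j]) (intro lin_operator projector_operators subspace_range P Q)+
  then show ?thesis using fredholm_index_unique[OF _ fredholm_index_loop2[OF PQ]] by blast
qed

lemma fredholm_index_projector_cycle:
  assumes "essentially_equal P Q" "essentially_equal Q R" "essentially_equal R P"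
    and i: "fredholm_index Q (range P) (range Q) i"
    and j: "fredholm_index R (range Q) (range R) j"
    and k: "fredholm_index P (range R) (range P) k"
  shows "i + j + k = 0"
proof -
  have P: "projector K P" and Q: "projector K Q" and R: "projector K R"
    using assms by (auto simp: essentially_equal_def)
  have lin: "lin (blinfun_apply P)" "lin (blinfun_apply Q)" "lin (blinfun_apply R)"
    by (intro lin_operator projector_operators P Q R)+
  note RQ = fredholm_index_comp[OF lin(2) subspace_range[OF P] lin(3) i j]
  have "fredholm_index (\<lambda>x. P (R (Q x))) (range P) (range P) (i + j + k)"
    by (rule fredholm_index_comp[OF lin_comp[OF lin(3,2)] subspace_range[OF P] lin(1) RQ k])
  then show ?thesis using fredholm_index_unique[OF _ fredholm_index_loop3[OF assms(1-3)]] by blast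
qed

text \<open>The projector chosen in \<open>relative_dim\<close> may differ from \<open>Q\<close>,
  but both have the same range. The index \<open>j\<close> of \<open>P\<close> from that range back
  to the range of \<open>P\<close> is therefore common to both, and each of the two indices equals
  \<open>- j\<close>.\<close>

lemma relative_dim_eq:
  assumes PQ: "essentially_equal P Q" and i: "fredholm_index Q (range P) (range Q) i"
  shows "relative_dim K (range P) (range Q) = i"
proof -
  have P: "projector K P" and Q: "projector K Q" using PQ by (auto simp: essentially_equal_def)
  define Q' where "Q' = (SOME Q'. projector K Q' \<and> range Q' = range Q)"
  have "projector K Q' \<and> range Q' = range Q"
    unfolding Q'_def by (rule someI[of _ Q]) (simp add: Q)
  then have Q': "projector K Q'" and rQ': "range Q' = range Q" by auto
  have QQ': "Q (Q' x) = Q' x" for x using mem_range_projector[OF Q] rQ' by blast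
  have Q'Q: "Q' (Q x) = Q x" for x using mem_range_projector[OF Q'] rQ' by blast
  have "essentially_equal P Q'"
  proof -
    have "(id_blinfun - P) o\<^sub>L Q' = ((id_blinfun - P) o\<^sub>L Q) o\<^sub>L Q'"
      by (rule blinfun_eqI) (simp add: blinfun.bilinear_simps QQ')
    moreover have "(id_blinfun - Q') o\<^sub>L P = (id_blinfun - Q') o\<^sub>L ((id_blinfun - Q) o\<^sub>L P)"
      by (rule blinfun_eqI) (simp add: blinfun.bilinear_simps Q'Q)
    ultimately show ?thesis
      using PQ P Q' compact_operator_comp_right compact_operator_comp_left
      unfolding essentially_equal_def by metis
  qed
  then obtain i' where i': "fredholm_index Q' (range P) (range Q') i'"
    using fredholm_index_projector_ex by blast
  obtain j where j: "fredholm_index P (range Q) (range P) j"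
    using fredholm_index_projector_ex[OF essentially_equal_sym[OF PQ]] by blast
  have "i + j = 0" by (rule fredholm_index_projector_sym[OF PQ i j])
  moreover have "i' + j = 0"
    by (rule fredholm_index_projector_sym[OF \<open>essentially_equal P Q'\<close> i']) (simp add: rQ' j)
  moreover have "relative_dim K (range P) (range Q) = i'"
    unfolding relative_dim_def Q'_def[symmetric] using index_between_eq[OF i'] rQ' by simp
  ultimately show ?thesis by simp
qed

lemma fredholm_index_relative_dim:
  assumes "projector K P" "projector K Q" "compact_operator (P - Q)"
  shows "fredholm_index Q (range P) (range Q) (projector_dim K P Q)"
proof -
  note PQ = essentially_equalI[OF assms]
  obtain i where "fredholm_index Q (range P) (range Q) i" using fredholm_index_projector_ex[OF PQ] by blast
  then show ?thesis unfolding projector_dim_def using relative_dim_eq[OF PQ] by simp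
qed

lemma projector_dim_cycle:
  assumes P: "projector K P" and Q: "projector K Q" and R: "projector K R"
    and PQ: "compact_operator (P - Q)" and QR: "compact_operator (Q - R)"
  shows "projector_dim K P Q + projector_dim K Q R + projector_dim K R P = 0"
proof -
  have RP: "compact_operator (R - P)"
    by (rule compact_operator_diff_swap[OF compact_operator_diff_trans[OF PQ QR]])
  show ?thesis
    by (rule fredholm_index_projector_cycle[OF essentially_equalI[OF P Q PQ] essentially_equalI[OF Q R QR]
          essentially_equalI[OF R P RP]]) (intro fredholm_index_relative_dim P Q R PQ QR RP)+
qed

lemma projector_dim_swap:
  assumes P: "projector K P" and Q: "projector K Q" and PQ: "compact_operator (P - Q)"
  shows "projector_dim K Q P = - projector_dim K P Q"
  using fredholm_index_projector_sym[OF essentially_equalI[OF P Q PQ] fredholm_index_relative_dim[OF P Q PQ]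
      fredholm_index_relative_dim[OF Q P compact_operator_diff_swap[OF PQ]]] by simp

lemma projector_dim_trans:
  assumes P: "projector K P" and Q: "projector K Q" and R: "projector K R"
    and PQ: "compact_operator (P - Q)" and QR: "compact_operator (Q - R)"
  shows "projector_dim K P R = projector_dim K P Q + projector_dim K Q R"
  using projector_dim_cycle[OF assms] projector_dim_swap[OF P R compact_operator_diff_trans[OF PQ QR]] by simp

text \<open>\<open>Q\<close> maps the range of \<open>P\<close> bijectively onto its own:
  injectivity uses that \<open>P - Q\<close> has norm below one, surjectivity that
  \<open>Q (Q - P)\<close> does. The factor \<open>1 + norm Q\<close> covers both.\<close>

lemma projector_dim_near:
  assumes P: "projector K P" and Q: "projector K Q" and PQ: "compact_operator (P - Q)"
    and near: "(1 + norm Q) * norm (P - Q) < 1"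
  shows "projector_dim K P Q = 0"
proof -
  have "norm (P - Q) \<le> (1 + norm Q) * norm (P - Q)" by (simp add: algebra_simps)
  then have n1: "norm (P - Q) < 1" using near by linarith
  define S where "S = Q o\<^sub>L (Q - P)"
  have "norm S \<le> norm Q * norm (P - Q)"
    unfolding S_def using norm_blinfun_compose[of Q "Q - P"] by (simp add: norm_minus_commute)
  also have "\<dots> \<le> (1 + norm Q) * norm (P - Q)" by (simp add: algebra_simps)
  finally have "norm S < 1" using near by simp
  then obtain R where R: "(id_blinfun - S) o\<^sub>L R = id_blinfun" using neumann_inverse by blast
  have "fredholm_index Q (range P) (range Q) 0"
  proof (rule fredholm_index_bij)
    show "lin (blinfun_apply Q)" by (intro lin_operator projector_operators Q)
    show "subspace (range P)" "subspace (range Q)" by (intro subspace_range P Q)+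
    show "Q ` range P = range Q"
    proof (rule subset_antisym)
      show "range Q \<subseteq> Q ` range P"
      proof
        fix y assume "y \<in> range Q"
        then have y: "Q y = y" using mem_range_projector[OF Q] by blast
        define x where "x = R y"
        have "((id_blinfun - S) o\<^sub>L R) y = y" using R by simp
        \<comment> \<open>Applying \<open>Q\<close> to this equation cancels \<open>Q x\<close> and
          leaves \<open>Q (P x) = y\<close>, so \<open>P x\<close> is the required preimage.\<close>
        then have x: "x - Q (Q x - P x) = y" by (simp add: x_def S_def blinfun.bilinear_simps)
        then have "Q x - Q (Q (Q x - P x)) = Q y" by (metis blinfun.diff_right)
        then have "Q (P x) = y" using y by (simp add: blinfun.diff_right projector_apply[OF Q])
        then show "y \<in> Q ` range P" by blast
      qed
    qed blast
    fix x assume "x \<in> range P" "Q x = 0"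
    then have "(P - Q) x = x" using mem_range_projector[OF P] by (simp add: blinfun.diff_left)
    then have "norm x \<le> norm (P - Q) * norm x" using norm_blinfun[of "P - Q" x] by simp
    then have "norm x * (1 - norm (P - Q)) \<le> 0" by (simp add: algebra_simps)
    then show "x = 0" using n1 by (simp add: mult_le_0_iff)
  qed
  then show ?thesis
    unfolding projector_dim_def by (rule relative_dim_eq[OF essentially_equalI[OF P Q PQ]])
qed

text \<open>The index from \<open>Q s\<close> to \<open>Q u\<close> is locally constant in
  \<open>u\<close>, by additivity and the vanishing for close projectors; compact differences are
  what makes it defined for distant parameters.\<close>

lemma projector_dim_path:
  fixes Q :: "'i::topological_space \<Rightarrow> 'a \<Rightarrow>\<^sub>L 'a"
  assumes S: "connected S" "s \<in> S" "t \<in> S" and cont: "continuous_on S Q"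
    and Q: "\<And>t. t \<in> S \<Longrightarrow> projector K (Q t)"
    and cpt: "\<And>s t. s \<in> S \<Longrightarrow> t \<in> S \<Longrightarrow> compact_operator (Q s - Q t)"
  shows "projector_dim K (Q s) (Q t) = 0"
proof -
  define f where "f u = projector_dim K (Q s) (Q u)" for u
  have "f constant_on S"
  proof (rule locally_constant_imp_constant[OF S(1)])
    fix u assume u: "u \<in> S"
    have "((\<lambda>v. (1 + norm (Q u)) * norm (Q v - Q u)) \<longlongrightarrow> (1 + norm (Q u)) * norm (Q u - Q u)) (at u within S)"
      using cont u unfolding continuous_on_def by (intro tendsto_intros) blast
    then have "\<forall>\<^sub>F v in at u within S. (1 + norm (Q u)) * norm (Q v - Q u) < 1"
      by (rule order_tendstoD) simp
    then have "\<forall>\<^sub>F v in at u within S. f v = f u"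
      unfolding eventually_at_filter
    proof (rule eventually_mono, intro impI)
      fix v assume "v \<noteq> u \<longrightarrow> v \<in> S \<longrightarrow> (1 + norm (Q u)) * norm (Q v - Q u) < 1"
        and "v \<noteq> u" and v: "v \<in> S"
      then have "projector_dim K (Q v) (Q u) = 0"
        using projector_dim_near[OF Q[OF v] Q[OF u] cpt[OF v u]] by blast
      then show "f v = f u"
        using projector_dim_trans[OF Q[OF S(2)] Q[OF v] Q[OF u] cpt[OF S(2) v] cpt[OF v u]]
        by (simp add: f_def)
    qed
    then obtain N where N: "open N" "u \<in> N" "\<And>v. v \<in> N \<Longrightarrow> v \<noteq> u \<Longrightarrow> v \<in> S \<Longrightarrow> f v = f u"
      unfolding eventually_at_topological by blast
    show "\<exists>T. openin (top_of_set S) T \<and> u \<in> T \<and> (\<forall>v\<in>T. f v = f u)"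
    proof (intro exI[of _ "S \<inter> N"] conjI ballI)
      show "openin (top_of_set S) (S \<inter> N)" using N(1) by (rule openin_open_Int)
      show "u \<in> S \<inter> N" using u N(2) by blast
      show "f v = f u" if "v \<in> S \<inter> N" for v using that N(3) by blast
    qed
  qed
  then have "f t = f s" using S unfolding constant_on_def by metis
  also have "f s = 0"
    unfolding f_def by (rule projector_dim_near[OF Q[OF S(2)] Q[OF S(2)] cpt[OF S(2,2)]]) simp
  finally show ?thesis by (simp add: f_def)
qed

text \<open>The operator \<open>Q P + (I - Q) (I - P)\<close> acts as \<open>Q\<close> on the range
  of \<open>P\<close> and as \<open>I - Q\<close> on the complementary range, so its index is the
  sum of the two relative dimensions. It equals the identity minus a compact operator, so this sum
  is zero.\<close>

lemma projector_dim_compl: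
  assumes P: "projector K P" and Q: "projector K Q" and PQ: "compact_operator (P - Q)"
  shows "projector_dim K (id_blinfun - P) (id_blinfun - Q) = - projector_dim K P Q"
proof -
  define P' where "P' = id_blinfun - P"
  define Q' where "Q' = id_blinfun - Q"
  have P': "projector K P'" and Q': "projector K Q'" unfolding P'_def Q'_def by (intro projector_compl P Q)+
  have PP': "x = P x + P' x" for x by (simp add: P'_def blinfun.diff_left)
  have QQ': "x = Q x + Q' x" for x by (simp add: Q'_def blinfun.diff_left)
  have zero: "P' (P x) = 0" "P (P' x) = 0" "Q' (Q x) = 0" for x
    by (simp_all add: P'_def Q'_def blinfun.bilinear_simps projector_apply[OF P] projector_apply[OF Q])
  have PQ': "compact_operator (P' - Q')"
    using compact_operator_diff_swap[OF PQ] by (simp add: P'_def Q'_def)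
  define T where "T = (Q o\<^sub>L P) + (Q' o\<^sub>L P')"
  have T: "T \<in> operators K" unfolding T_def by (intro operators_intros projector_operators P Q P' Q')
  have i: "fredholm_index T (range P) (range Q) (projector_dim K P Q)"
  proof -
    have "T x = Q x" if "x \<in> range P" for x
    proof -
      have "P x = x" using that mem_range_projector[OF P] by blast
      then show ?thesis using zero(1)[of x] by (simp add: T_def blinfun.bilinear_simps)
    qed
    then show ?thesis
      using fredholm_index_cong fredholm_index_relative_dim[OF P Q PQ] by blast
  qed
  have j: "fredholm_index T (range P') (range Q') (projector_dim K P' Q')"
  proof -
    have "T x = Q' x" if "x \<in> range P'" for x
    proof -
      have "P' x = x" using that mem_range_projector[OF P'] by blast
      then show ?thesis using zero(2)[of x] by (simp add: T_def blinfun.bilinear_simps)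
    qed
    then show ?thesis
      using fredholm_index_cong fredholm_index_relative_dim[OF P' Q' PQ'] by blast
  qed
  have int: "range R \<inter> range (id_blinfun - R) = {0}" if R: "projector K R" for R
  proof -
    have "x = 0" if "R x = x" "(id_blinfun - R) x = x" for x
      using that by (simp add: blinfun.diff_left)
    moreover have "R 0 = 0" "(id_blinfun - R) 0 = 0" by simp_all
    ultimately show ?thesis
      using mem_range_projector[OF R] mem_range_projector[OF projector_compl[OF R]] by blast
  qed
  have sumP: "{x + x' | x x'. x \<in> range P \<and> x' \<in> range P'} = UNIV"
    using PP' by blast
  have sumQ: "{x + x' | x x'. x \<in> range Q \<and> x' \<in> range Q'} = UNIV"
    using QQ' by blast
  have "fredholm_index T UNIV UNIV (projector_dim K P Q + projector_dim K P' Q')"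
    by (rule fredholm_index_sum[OF lin_operator[OF T] i j subspace_range[OF P] subspace_range[OF P']
          int[OF P, folded P'_def] int[OF Q, folded Q'_def] sumP sumQ])
  moreover have "fredholm_index T UNIV UNIV 0"
  proof (rule fredholm_index_id_minus_compact)
    define C where "C = (Q o\<^sub>L (Q - P)) + ((P - Q) o\<^sub>L P)"
    show "C \<in> operators K" unfolding C_def by (intro operators_intros projector_operators P Q)
    show "compact_operator C" unfolding C_def
      by (intro compact_operator_add compact_operator_comp_left compact_operator_comp_right PQ
          compact_operator_diff_swap[OF PQ])
    fix x
    show "T x = x - C x"
      by (simp add: T_def C_def P'_def Q'_def blinfun.bilinear_simps projector_apply[OF P] projector_apply[OF Q])
  qed (auto simp: subspace_UNIV)
  ultimately have "projector_dim K P Q + projector_dim K P' Q' = 0" by (rule fredholm_index_unique)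
  then show ?thesis by (simp add: P'_def Q'_def)
qed

end

lemma scalar_banach_real: "scalar_banach scaleR (Real_Scalars :: 'a::banach scalars)"
proof -
  interpret linear_space "scaleR :: real \<Rightarrow> 'a \<Rightarrow> 'a"
    by (simp add: linear_space_def real_vector.vector_space_axioms)
  show ?thesis
  proof (rule scalar_banach.intro[OF linear_space_axioms scalar_banach_axioms.intro])
    show "\<exists>c. \<forall>x. c *\<^sub>R x = r *\<^sub>R (x :: 'a)" for r by blast
    show "subspace_over (Real_Scalars :: 'a scalars) = module.subspace scaleR"
      by (rule ext) (simp add: subspace_raw_def)
    show "dim_over (Real_Scalars :: 'a scalars) = vector_space.dim scaleR"
      by (rule ext) (simp add: dim_raw_def)
    show "T \<in> operators (Real_Scalars :: 'a scalars) \<longleftrightarrow> (\<forall>c x. T (c *\<^sub>R x) = c *\<^sub>R T x)" for T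
      by (simp add: blinfun.scaleR_right)
  qed
qed

lemma scalar_banach_complex:
  fixes m :: "complex \<Rightarrow> 'a::banach \<Rightarrow>\<^sub>L 'a"
  assumes "banach_over (Complex_Scalars m)"
  shows "scalar_banach (\<lambda>c. blinfun_apply (m c)) (Complex_Scalars m)"
proof -
  have "vector_space (\<lambda>c. blinfun_apply (m c))"
  proof
    show "m a (x + y) = m a x + m a y" for a x y by (rule blinfun.add_right)
    show "m (a + b) x = m a x + m b x" "m a (m b x) = m (a * b) x" for a b x using assms by auto
    show "m 1 x = x" for x using assms by (metis banach_over.simps(2) of_real_1 scaleR_one)
  qed
  then interpret linear_space "\<lambda>c. blinfun_apply (m c)" by (simp add: linear_space_def)
  show ?thesis
  proof unfold_locales
    show "\<exists>c. \<forall>x. m c x = r *\<^sub>R x" for r using assms by (intro exI[of _ "complex_of_real r"]) simp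
    show "subspace_over (Complex_Scalars m) = subspace" by (rule ext) simp
    show "dim_over (Complex_Scalars m) = dim" by (rule ext) simp
    show "T \<in> operators (Complex_Scalars m) \<longleftrightarrow> (\<forall>c x. T (m c x) = m c (T x))" for T
    proof
      assume "T \<in> operators (Complex_Scalars m)"
      then show "\<forall>c x. T (m c x) = m c (T x)"
        by simp (metis blinfun_apply_blinfun_compose)
    next
      assume "\<forall>c x. T (m c x) = m c (T x)"
      then show "T \<in> operators (Complex_Scalars m)" by (auto intro: blinfun_eqI)
    qed
  qed
qed

section \<open>Resolvents\<close>

definition inverse_pair :: "('a::real_normed_vector \<Rightarrow>\<^sub>L 'a) \<Rightarrow> ('a \<Rightarrow>\<^sub>L 'a) \<Rightarrow> bool" where
  "inverse_pair S R \<longleftrightarrow> R o\<^sub>L S = id_blinfun \<and> S o\<^sub>L R = id_blinfun"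

lemma blinfun_compose_id [simp]: "id_blinfun o\<^sub>L T = T" "T o\<^sub>L id_blinfun = T"
  by (auto intro: blinfun_eqI)

lemma compose_assoc: "(A o\<^sub>L B) o\<^sub>L C = A o\<^sub>L (B o\<^sub>L C)"
  by (rule blinfun_eqI) simp

lemmas compose_bilinear = bounded_bilinear_blinfun_compose
lemmas compose_simps = bounded_bilinear.add_left[OF compose_bilinear]
  bounded_bilinear.add_right[OF compose_bilinear]
  bounded_bilinear.diff_left[OF compose_bilinear]
  bounded_bilinear.diff_right[OF compose_bilinear]
  bounded_bilinear.minus_left[OF compose_bilinear]
  bounded_bilinear.minus_right[OF compose_bilinear]
  bounded_bilinear.scaleR_left[OF compose_bilinear]
  bounded_bilinear.scaleR_right[OF compose_bilinear]
  bounded_bilinear.sum_left[OF compose_bilinear]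
  bounded_bilinear.sum_right[OF compose_bilinear]
  bounded_bilinear.zero_left[OF compose_bilinear]
  bounded_bilinear.zero_right[OF compose_bilinear]

lemma inverse_pair_unique:
  assumes "inverse_pair S R" "inverse_pair S R'"
  shows "R = R'"
proof -
  have "R = R o\<^sub>L (S o\<^sub>L R')" using assms by (simp add: inverse_pair_def)
  also have "\<dots> = (R o\<^sub>L S) o\<^sub>L R'" by (simp add: compose_assoc)
  finally show ?thesis using assms by (simp add: inverse_pair_def)
qed

lemma inverse_pair_commute:
  assumes R: "inverse_pair S R" and U: "U o\<^sub>L S = S o\<^sub>L U"
  shows "U o\<^sub>L R = R o\<^sub>L U"
proof -
  have "U o\<^sub>L R = (R o\<^sub>L S) o\<^sub>L (U o\<^sub>L R)" using R by (simp add: inverse_pair_def)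
  also have "\<dots> = R o\<^sub>L ((S o\<^sub>L U) o\<^sub>L R)" by (simp add: compose_assoc)
  also have "\<dots> = R o\<^sub>L (U o\<^sub>L (S o\<^sub>L R))" by (simp add: U[symmetric] compose_assoc)
  finally show ?thesis using R by (simp add: inverse_pair_def)
qed

lemma norm_compose3: "norm (A o\<^sub>L (B o\<^sub>L C)) \<le> norm A * (norm B * norm C)"
  by (meson norm_blinfun_compose mult_left_mono norm_ge_zero order_trans)

text \<open>Factor \<open>S' = (I - U) S\<close> with \<open>U = (S - S') R\<close> of norm at most
  \<open>1 / 2\<close>, so the Neumann inverse has norm at most two. The explicit bound on
  \<open>R' - R\<close> serves continuity of the resolvent, its behaviour at infinity and its
  dependence on the operator.\<close>

lemma inverse_pair_perturb:
  fixes S :: "'a::banach \<Rightarrow>\<^sub>L 'a"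
  assumes R: "inverse_pair S R" and small: "norm (S' - S) * norm R \<le> 1 / 2"
  shows "\<exists>R'. inverse_pair S' R' \<and> norm R' \<le> 2 * norm R \<and> norm (R' - R) \<le> 2 * (norm R)\<^sup>2 * norm (S' - S)"
proof -
  define U where "U = (S - S') o\<^sub>L R"
  have U: "norm U \<le> 1 / 2"
    using norm_blinfun_compose[of "S - S'" R] small by (simp add: U_def norm_minus_commute)
  then obtain V where V: "V o\<^sub>L (id_blinfun - U) = id_blinfun" "(id_blinfun - U) o\<^sub>L V = id_blinfun"
      "norm V \<le> 1 / (1 - norm U)"
    using neumann_inverse[of U] by auto
  have "1 / (1 - norm U) \<le> 2" using U by (simp add: field_simps)
  then have V2: "norm V \<le> 2" using V(3) by linarith
  have RS: "R o\<^sub>L S = id_blinfun" "S o\<^sub>L R = id_blinfun" using R by (auto simp: inverse_pair_def)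
  have S': "S' = (id_blinfun - U) o\<^sub>L S"
    by (simp add: U_def compose_simps compose_assoc RS)
  define R' where "R' = R o\<^sub>L V"
  have "R' o\<^sub>L S' = R o\<^sub>L ((V o\<^sub>L (id_blinfun - U)) o\<^sub>L S)" by (simp add: R'_def S' compose_assoc)
  then have 1: "R' o\<^sub>L S' = id_blinfun" by (simp only: V blinfun_compose_id RS)
  have "S' o\<^sub>L R' = (id_blinfun - U) o\<^sub>L ((S o\<^sub>L R) o\<^sub>L V)" by (simp add: R'_def S' compose_assoc)
  then have 2: "S' o\<^sub>L R' = id_blinfun" by (simp only: V blinfun_compose_id RS)
  have 3: "norm R' \<le> 2 * norm R"
  proof -
    have "norm R' \<le> norm R * norm V" unfolding R'_def by (rule norm_blinfun_compose)
    also have "\<dots> \<le> norm R * 2" by (intro mult_left_mono V2) simp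
    finally show ?thesis by simp
  qed
  have "R' - R = R' o\<^sub>L ((S - S') o\<^sub>L R)"
    using 1 RS by (simp add: compose_simps compose_assoc[symmetric])
  then have "norm (R' - R) \<le> norm R' * (norm (S - S') * norm R)" using norm_compose3 by metis
  also have "\<dots> \<le> 2 * norm R * (norm (S - S') * norm R)" by (intro mult_right_mono 3) simp
  finally have "norm (R' - R) \<le> 2 * (norm R)\<^sup>2 * norm (S' - S)"
    by (simp add: power2_eq_square norm_minus_commute algebra_simps)
  then show ?thesis using 1 2 3 by (auto simp: inverse_pair_def)
qed

text \<open>The norm is not assumed to be compatible with the multiplication by complex scalars, in order
  to include the complexification of a real space.\<close>

locale complex_multiplication =
  fixes m :: "complex \<Rightarrow> 'a::banach \<Rightarrow>\<^sub>L 'a"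
  assumes m_add: "m (c + d) = m c + m d"
    and m_mult: "m (c * d) = m c o\<^sub>L m d"
    and m_of_real: "m (complex_of_real r) = r *\<^sub>R id_blinfun"
begin

lemma m_0: "m 0 = 0" using m_of_real[of 0] by simp
lemma m_1: "m 1 = id_blinfun" using m_of_real[of 1] by simp
lemma m_minus: "m (- c) = - m c" using m_add[of c "- c"] m_0 by (simp add: eq_neg_iff_add_eq_0 add.commute)
lemma m_diff: "m (c - d) = m c - m d" using m_add[of c "- d"] m_minus by simp
lemma m_comm: "m c o\<^sub>L m d = m d o\<^sub>L m c" using m_mult[of c d] m_mult[of d c] by (simp add: mult.commute)

text \<open>Replaces the identity \<open>norm (m c) = cmod c\<close>, which fails for the product
  norm on a complexification. The bound comes from splitting \<open>c\<close> into real and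
  imaginary parts.\<close>

definition \<kappa> :: real where "\<kappa> = 1 + norm (m \<i>)"

lemma \<kappa>_ge: "\<kappa> \<ge> 1" by (simp add: \<kappa>_def)

lemma norm_m: "norm (m c) \<le> \<kappa> * cmod c"
proof -
  have "c = complex_of_real (Re c) + complex_of_real (Im c) * \<i>" by (simp add: complex_eq_iff)
  then have "m c = m (complex_of_real (Re c) + complex_of_real (Im c) * \<i>)" by (rule arg_cong)
  also have "\<dots> = Re c *\<^sub>R id_blinfun + Im c *\<^sub>R m \<i>"
    by (simp only: m_add m_mult m_of_real compose_simps blinfun_compose_id)
  finally have "norm (m c) \<le> norm (Re c *\<^sub>R (id_blinfun :: 'a \<Rightarrow>\<^sub>L 'a)) + norm (Im c *\<^sub>R m \<i>)"
    by (metis norm_triangle_ineq)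
  also have "\<dots> \<le> cmod c * 1 + cmod c * norm (m \<i>)"
    by (simp only: norm_scaleR)
      (intro add_mono mult_mono abs_Re_le_cmod abs_Im_le_cmod norm_blinfun_id_le, auto)
  finally show ?thesis by (simp add: \<kappa>_def algebra_simps)
qed

lemma bounded_linear_m: "bounded_linear m"
proof (rule bounded_linear_intro)
  show "m (r *\<^sub>R c) = r *\<^sub>R m c" for r c
    by (simp only: scaleR_conv_of_real m_mult m_of_real compose_simps blinfun_compose_id)
  show "norm (m c) \<le> norm c * \<kappa>" for c using norm_m[of c] by (simp add: mult.commute)
qed (rule m_add)

definition ops :: "('a \<Rightarrow>\<^sub>L 'a) set" where
  "ops = {T. \<forall>c. T o\<^sub>L m c = m c o\<^sub>L T}"

lemma opsD: "T \<in> ops \<Longrightarrow> T o\<^sub>L m c = m c o\<^sub>L T" by (simp add: ops_def)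

lemma m_in_ops: "m c \<in> ops" by (simp add: ops_def m_comm)

section \<open>Regularity of the resolvent\<close>

lemma spectrum_iff: "z \<notin> complex_spectrum m T \<longleftrightarrow> (\<exists>R. inverse_pair (m z - T) R)"
  by (simp add: complex_spectrum_def inverse_pair_def)

lemma resolvent_eqI: "inverse_pair (m z - T) R \<Longrightarrow> resolvent m T z = R"
  unfolding resolvent_def inverse_pair_def[symmetric] using inverse_pair_unique by blast

lemma resolvent_inverse: "z \<notin> complex_spectrum m T \<Longrightarrow> inverse_pair (m z - T) (resolvent m T z)"
  using spectrum_iff resolvent_eqI by metis

text \<open>The point and the operator vary together: with \<open>T' = T\<close> this gives
  continuity in the point, with \<open>w = z\<close> continuity in the operator.\<close>

lemma resolvent_perturb:
  assumes z: "z \<notin> complex_spectrum m T"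
    and small: "norm (m w - T' - (m z - T)) * norm (resolvent m T z) \<le> 1 / 2"
  shows "w \<notin> complex_spectrum m T'"
    "norm (resolvent m T' w - resolvent m T z)
      \<le> 2 * (norm (resolvent m T z))\<^sup>2 * norm (m w - T' - (m z - T))"
proof -
  obtain R' where R': "inverse_pair (m w - T') R'"
    "norm (R' - resolvent m T z) \<le> 2 * (norm (resolvent m T z))\<^sup>2 * norm (m w - T' - (m z - T))"
    using inverse_pair_perturb[OF resolvent_inverse[OF z] small] by blast
  show "w \<notin> complex_spectrum m T'" using spectrum_iff R'(1) by blast
  show "norm (resolvent m T' w - resolvent m T z)
      \<le> 2 * (norm (resolvent m T z))\<^sup>2 * norm (m w - T' - (m z - T))"
    using R'(2) resolvent_eqI[OF R'(1)] by simp
qed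

lemma norm_m_le: "norm (m w - T - (m z - T)) \<le> \<kappa> * dist w z"
  using norm_m[of "w - z"] by (simp add: m_diff dist_norm)

lemma open_resolvent_set: "open (- complex_spectrum m T)"
  unfolding open_dist
proof (intro ballI)
  fix z assume "z \<in> - complex_spectrum m T"
  then have z: "z \<notin> complex_spectrum m T" by simp
  \<comment> \<open>The added one makes \<open>B\<close> positive, also on the zero space;
    \<open>e\<close> below is chosen so that \<open>\<kappa> * e * B = 1 / 2\<close>.\<close>
  define B where "B = norm (resolvent m T z) + 1"
  have B: "B > 0" "norm (resolvent m T z) \<le> B"
    using norm_ge_zero[of "resolvent m T z"] unfolding B_def by linarith+
  define e where "e = 1 / (2 * \<kappa> * B)"
  have e: "e > 0" using B \<kappa>_ge by (simp add: e_def)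
  have "w \<in> - complex_spectrum m T" if w: "dist w z < e" for w
  proof -
    have "norm (m w - T - (m z - T)) * norm (resolvent m T z) \<le> (\<kappa> * dist w z) * B"
      using norm_m_le B \<kappa>_ge by (intro mult_mono) auto
    also have "\<dots> \<le> (\<kappa> * e) * B" using w B \<kappa>_ge by (intro mult_right_mono mult_left_mono) auto
    also have "\<dots> = 1 / 2" using B \<kappa>_ge by (simp add: e_def)
    finally show ?thesis using resolvent_perturb(1)[OF z] by simp
  qed
  then show "\<exists>e>0. \<forall>w. dist w z < e \<longrightarrow> w \<in> - complex_spectrum m T" using e by blast
qed

lemma continuous_resolvent:
  assumes "S \<inter> complex_spectrum m T = {}"
  shows "continuous_on S (resolvent m T)"
  unfolding continuous_on_eq_continuous_within
proof (intro ballI)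
  fix z assume "z \<in> S"
  then have z: "z \<notin> complex_spectrum m T" using assms by blast
  define r where "r = norm (resolvent m T z)"
  have lim: "((\<lambda>w. (\<kappa> * dist w z) * r) \<longlongrightarrow> (\<kappa> * dist z z) * r) (at z)"
    by (intro tendsto_intros)
  then have "\<forall>\<^sub>F w in at z. (\<kappa> * dist w z) * r < 1 / 2" by (rule order_tendstoD) simp
  then have "\<forall>\<^sub>F w in at z. norm (resolvent m T w - resolvent m T z) \<le> 2 * r\<^sup>2 * (\<kappa> * dist w z)"
  proof eventually_elim
    case (elim w)
    have "norm (m w - T - (m z - T)) * r \<le> (\<kappa> * dist w z) * r"
      by (intro mult_right_mono norm_m_le) (simp add: r_def)
    then have "norm (m w - T - (m z - T)) * r \<le> 1 / 2" using elim by linarith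
    then have "norm (resolvent m T w - resolvent m T z) \<le> 2 * r\<^sup>2 * norm (m w - T - (m z - T))"
      by (rule resolvent_perturb(2)[OF z, folded r_def])
    also have "\<dots> \<le> 2 * r\<^sup>2 * (\<kappa> * dist w z)" by (intro mult_left_mono norm_m_le) simp
    finally show ?case .
  qed
  moreover have "((\<lambda>w. 2 * r\<^sup>2 * (\<kappa> * dist w z)) \<longlongrightarrow> 2 * r\<^sup>2 * (\<kappa> * dist z z)) (at z)"
    by (intro tendsto_intros)
  ultimately have "((\<lambda>w. resolvent m T w - resolvent m T z) \<longlongrightarrow> 0) (at z)"
    using Lim_null_comparison[of "\<lambda>w. resolvent m T w - resolvent m T z"] by simp
  then have "isCont (resolvent m T) z" unfolding isCont_def by (rule LIM_zero_cancel)
  then show "continuous (at z within S) (resolvent m T)" by (rule continuous_at_imp_continuous_at_within)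
qed

lemma resolvent_in_ops:
  assumes T: "T \<in> ops" and z: "z \<notin> complex_spectrum m T"
  shows "resolvent m T z \<in> ops"
proof -
  have "m c o\<^sub>L resolvent m T z = resolvent m T z o\<^sub>L m c" for c
    by (rule inverse_pair_commute[OF resolvent_inverse[OF z]])
      (simp add: compose_simps m_comm[of c] opsD[OF T])
  then show ?thesis by (simp add: ops_def)
qed

lemma resolvent_identity:
  assumes T: "T \<in> ops" and z: "z \<notin> complex_spectrum m T" and w: "w \<notin> complex_spectrum m T"
  shows "resolvent m T z - resolvent m T w = m (w - z) o\<^sub>L (resolvent m T z o\<^sub>L resolvent m T w)"
proof -
  define R where "R = resolvent m T z"
  define Q where "Q = resolvent m T w"
  have R: "R o\<^sub>L (m z - T) = id_blinfun" and Q: "(m w - T) o\<^sub>L Q = id_blinfun"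
    using resolvent_inverse[OF z] resolvent_inverse[OF w] by (auto simp: inverse_pair_def R_def Q_def)
  have "m (w - z) o\<^sub>L (R o\<^sub>L Q) = R o\<^sub>L (m (w - z) o\<^sub>L Q)"
    using opsD[OF resolvent_in_ops[OF T z], of "w - z"] by (simp add: R_def compose_assoc[symmetric])
  also have "\<dots> = (R o\<^sub>L ((m w - T) o\<^sub>L Q)) - ((R o\<^sub>L (m z - T)) o\<^sub>L Q)"
    by (simp add: m_diff compose_simps compose_assoc)
  also have "\<dots> = R - Q" by (simp only: R Q blinfun_compose_id)
  finally show ?thesis by (simp add: R_def Q_def)
qed

lemma resolvent_commute:
  assumes T: "T \<in> ops" and z: "z \<notin> complex_spectrum m T" and w: "w \<notin> complex_spectrum m T"
  shows "resolvent m T z o\<^sub>L resolvent m T w = resolvent m T w o\<^sub>L resolvent m T z"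
proof (rule inverse_pair_commute[OF resolvent_inverse[OF w]])
  have "T o\<^sub>L resolvent m T z = resolvent m T z o\<^sub>L T"
    by (rule inverse_pair_commute[OF resolvent_inverse[OF z]]) (simp add: compose_simps opsD[OF T])
  then show "resolvent m T z o\<^sub>L (m w - T) = (m w - T) o\<^sub>L resolvent m T z"
    by (simp add: compose_simps opsD[OF resolvent_in_ops[OF T z]])
qed

text \<open>\<open>m z - T\<close> is a perturbation of \<open>m z\<close>, whose inverse is
  \<open>m (1 / z)\<close>. The quadratic decay of the error beats the linear growth of the contour
  in \<open>rint_full\<close>.\<close>

lemma resolvent_large:
  assumes "z \<noteq> 0" "2 * \<kappa> * norm T \<le> cmod z"
  shows "z \<notin> complex_spectrum m T"
    "norm (resolvent m T z - m (1 / z)) \<le> 2 * (\<kappa> / cmod z)\<^sup>2 * norm T"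
proof -
  have ip: "inverse_pair (m z) (m (1 / z))"
    using assms m_mult[of z "1 / z"] m_mult[of "1 / z" z] by (simp add: inverse_pair_def m_1)
  have n: "norm (m (1 / z)) \<le> \<kappa> / cmod z" using norm_m[of "1 / z"] by (simp add: norm_divide)
  have "norm (m z - T - m z) * norm (m (1 / z)) \<le> norm T * (\<kappa> / cmod z)"
  proof -
    have "m z - T - m z = - T" by simp
    then show ?thesis by (simp only: norm_minus_cancel) (intro mult_left_mono n norm_ge_zero)
  qed
  also have "\<dots> \<le> 1 / 2" using assms by (simp add: field_simps)
  finally obtain R where R: "inverse_pair (m z - T) R"
    "norm (R - m (1 / z)) \<le> 2 * (norm (m (1 / z)))\<^sup>2 * norm (m z - T - m z)"
    using inverse_pair_perturb[OF ip] by blast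
  show "z \<notin> complex_spectrum m T" using R spectrum_iff by blast
  have "norm (R - m (1 / z)) \<le> 2 * (norm (m (1 / z)))\<^sup>2 * norm T" using R(2) by simp
  also have "\<dots> \<le> 2 * (\<kappa> / cmod z)\<^sup>2 * norm T"
    by (intro mult_right_mono mult_left_mono power_mono n) auto
  finally show "norm (resolvent m T z - m (1 / z)) \<le> 2 * (\<kappa> / cmod z)\<^sup>2 * norm T"
    using resolvent_eqI[OF R(1)] by simp
qed

text \<open>By the resolvent identity the error of the linear approximation is \<open>w - z\<close>
  times \<open>(R z - R w) R z\<close>, and the second factor tends to zero by continuity.\<close>

lemma resolvent_has_derivative:
  assumes T: "T \<in> ops" and z: "z \<notin> complex_spectrum m T"
  shows "(resolvent m T has_derivative
    (\<lambda>d. - (m d o\<^sub>L (resolvent m T z o\<^sub>L resolvent m T z)))) (at z)"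
proof -
  define R where "R = resolvent m T"
  obtain e where e: "e > 0" "\<And>w. dist w z < e \<Longrightarrow> w \<notin> complex_spectrum m T"
    using open_resolvent_set[of T] z unfolding open_dist by auto
  have "isCont R z"
    using continuous_resolvent[of "- complex_spectrum m T" T] open_resolvent_set z
    by (simp add: R_def continuous_on_eq_continuous_at)
  then have lim: "((\<lambda>w. \<kappa> * (norm (R z - R w) * norm (R z))) \<longlongrightarrow> \<kappa> * (norm (R z - R z) * norm (R z))) (at z)"
    unfolding isCont_def by (intro tendsto_intros)
  have "(R has_derivative (\<lambda>d. - (m d o\<^sub>L (R z o\<^sub>L R z)))) (at z)"
  proof (rule has_derivativeI_sandwich[OF e(1)])
    have "bounded_linear (\<lambda>d. m d o\<^sub>L (R z o\<^sub>L R z))"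
      by (rule bounded_linear_compose[OF bounded_bilinear.bounded_linear_left[OF compose_bilinear]
            bounded_linear_m])
    then show "bounded_linear (\<lambda>d. - (m d o\<^sub>L (R z o\<^sub>L R z)))" by (rule bounded_linear_minus)
    fix w assume w: "w \<in> UNIV" "w \<noteq> z" "dist w z < e"
    have "R w - R z = - (m (w - z) o\<^sub>L (R z o\<^sub>L R w))"
      using resolvent_identity[OF T z e(2)[OF w(3)]] unfolding R_def by (metis minus_diff_eq)
    also have "\<dots> = - (m (w - z) o\<^sub>L (R w o\<^sub>L R z))"
      using resolvent_commute[OF T z e(2)[OF w(3)]] unfolding R_def by simp
    finally have "(R w - R z) - (- (m (w - z) o\<^sub>L (R z o\<^sub>L R z))) = m (w - z) o\<^sub>L ((R z - R w) o\<^sub>L R z)"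
      by (simp add: compose_simps)
    then have "norm ((R w - R z) - (- (m (w - z) o\<^sub>L (R z o\<^sub>L R z))))
        \<le> norm (m (w - z)) * (norm (R z - R w) * norm (R z))"
      using norm_compose3 by metis
    also have "\<dots> \<le> (\<kappa> * cmod (w - z)) * (norm (R z - R w) * norm (R z))"
      by (intro mult_right_mono norm_m) simp
    finally show "norm ((R w - R z) - (- (m (w - z) o\<^sub>L (R z o\<^sub>L R z)))) / norm (w - z)
        \<le> \<kappa> * (norm (R z - R w) * norm (R z))"
      using w by (simp add: field_simps)
  qed (use lim in simp)
  then show ?thesis by (simp add: R_def)
qed

section \<open>Line integrals\<close>

definition lint :: "(complex \<Rightarrow> 'a \<Rightarrow>\<^sub>L 'a) \<Rightarrow> complex \<Rightarrow> complex \<Rightarrow> 'a \<Rightarrow>\<^sub>L 'a" where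
  "lint F u v = integral {0..1} (\<lambda>t. m (v - u) o\<^sub>L F (linepath u v t))"

lemma linepath_in_segment: "t \<in> {0..1} \<Longrightarrow> linepath u v t \<in> closed_segment u v"
  using linepath_image_01[of u v] by blast

lemma continuous_compose_linepath:
  assumes "continuous_on (closed_segment u v) F"
  shows "continuous_on {0..1} (\<lambda>t. F (linepath u v t))"
  by (rule continuous_on_compose2[OF assms continuous_on_linepath]) (use linepath_in_segment in blast)

lemma has_integral_lint:
  assumes "continuous_on (closed_segment u v) F"
  shows "((\<lambda>t. m (v - u) o\<^sub>L F (linepath u v t)) has_integral lint F u v) {0..1}"
  unfolding lint_def
  by (intro integrable_integral integrable_continuous_interval
      bounded_bilinear.continuous_on[OF compose_bilinear]
      continuous_on_const continuous_compose_linepath assms)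

lemma lint_eqI:
  "((\<lambda>t. m (v - u) o\<^sub>L F (linepath u v t)) has_integral I) {0..1} \<Longrightarrow> lint F u v = I"
  unfolding lint_def by (rule integral_unique)

lemma lint_cong:
  assumes "\<And>z. z \<in> closed_segment u v \<Longrightarrow> F z = G z"
  shows "lint F u v = lint G u v"
  unfolding lint_def by (rule integral_cong) (simp add: assms linepath_in_segment)

text \<open>One change-of-variables rule for two uses: composition with a fixed operator, where
  \<open>f\<close> is the identity, and complex conjugation, where \<open>f\<close> is
  \<open>cnj\<close>.\<close>

lemma lint_linear:
  assumes F: "continuous_on (closed_segment u v) F" and h: "bounded_linear h"
    and hm: "\<And>z. z \<in> closed_segment u v \<Longrightarrow> h (m (v - u) o\<^sub>L F z) = m (v' - u') o\<^sub>L G (f z)"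
    and f: "\<And>t. f (linepath u v t) = linepath u' v' t"
  shows "lint G u' v' = h (lint F u v)"
proof (rule lint_eqI)
  have "((h \<circ> (\<lambda>t. m (v - u) o\<^sub>L F (linepath u v t))) has_integral h (lint F u v)) {0..1}"
    by (rule has_integral_linear[OF has_integral_lint[OF F] h])
  then show "((\<lambda>t. m (v' - u') o\<^sub>L G (linepath u' v' t)) has_integral h (lint F u v)) {0..1}"
    by (rule has_integral_eq[rotated]) (simp add: hm linepath_in_segment f)
qed

lemma lint_comp_right:
  assumes "continuous_on (closed_segment u v) F"
  shows "lint (\<lambda>z. F z o\<^sub>L S) u v = lint F u v o\<^sub>L S"
  by (rule lint_linear[OF assms bounded_bilinear.bounded_linear_left[OF compose_bilinear],
        where f = "\<lambda>z. z"]) (simp_all add: compose_assoc)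

lemma lint_comp_left:
  assumes "continuous_on (closed_segment u v) F" "S \<in> ops"
  shows "lint (\<lambda>z. S o\<^sub>L F z) u v = S o\<^sub>L lint F u v"
  by (rule lint_linear[OF assms(1) bounded_bilinear.bounded_linear_right[OF compose_bilinear],
        where f = "\<lambda>z. z"]) (simp_all add: compose_assoc[symmetric] opsD[OF assms(2)])

lemma lint_diff:
  assumes "continuous_on (closed_segment u v) F" "continuous_on (closed_segment u v) G"
  shows "lint (\<lambda>z. F z - G z) u v = lint F u v - lint G u v"
  by (rule lint_eqI)
    (use has_integral_diff[OF assms[THEN has_integral_lint]] in \<open>simp add: compose_simps\<close>)

lemma lint_sum:
  assumes "finite J" "\<And>j. j \<in> J \<Longrightarrow> continuous_on (closed_segment u v) (F j)"
  shows "lint (\<lambda>z. \<Sum>j\<in>J. F j z) u v = (\<Sum>j\<in>J. lint (F j) u v)"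
  by (rule lint_eqI)
    (use has_integral_sum[OF assms(1) has_integral_lint[OF assms(2)]] in \<open>simp add: compose_simps\<close>)

lemma lint_same: "lint F u u = 0"
  by (simp add: lint_def m_0 compose_simps)

lemma lint_bound:
  assumes F: "continuous_on (closed_segment u v) F"
    and B: "B \<ge> 0" "\<And>z. z \<in> closed_segment u v \<Longrightarrow> norm (F z) \<le> B"
  shows "norm (lint F u v) \<le> \<kappa> * cmod (v - u) * B"
proof -
  have "norm (lint F u v) \<le> \<kappa> * cmod (v - u) * B * measure lborel (cbox 0 (1::real))"
  proof (rule has_integral_bound)
    show "0 \<le> \<kappa> * cmod (v - u) * B" using \<kappa>_ge B(1) by simp
    show "((\<lambda>t. m (v - u) o\<^sub>L F (linepath u v t)) has_integral lint F u v) (cbox 0 1)"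
      using has_integral_lint[OF F] by (simp add: cbox_interval)
    fix t :: real assume "t \<in> cbox 0 1"
    then have "t \<in> {0..1}" by (simp add: cbox_interval)
    have "norm (m (v - u) o\<^sub>L F (linepath u v t)) \<le> norm (m (v - u)) * norm (F (linepath u v t))"
      by (rule norm_blinfun_compose)
    also have "\<dots> \<le> (\<kappa> * cmod (v - u)) * B"
      using B(2)[OF linepath_in_segment[OF \<open>t \<in> {0..1}\<close>]] \<kappa>_ge by (intro mult_mono norm_m) auto
    finally show "norm (m (v - u) o\<^sub>L F (linepath u v t)) \<le> \<kappa> * cmod (v - u) * B" .
  qed
  then show ?thesis by simp
qed

lemma continuous_compose_linepath2:
  assumes "continuous_on (A \<times> B) (\<lambda>(z, w). G z w)"
    and f: "continuous_on S f" "f ` S \<subseteq> A" and g: "continuous_on S g" "g ` S \<subseteq> B"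
  shows "continuous_on S (\<lambda>x. G (f x) (g x))"
proof -
  have "continuous_on S (\<lambda>x. (f x, g x))" by (intro continuous_on_Pair f g)
  from continuous_on_compose2[OF assms(1) this] show ?thesis using f g by force
qed

lemma lint_continuous:
  assumes G: "continuous_on (A \<times> closed_segment u v) (\<lambda>(z, w). G z w)"
  shows "continuous_on A (\<lambda>z. lint (G z) u v)"
proof -
  have "continuous_on (A \<times> cbox 0 1) (\<lambda>x. m (v - u) o\<^sub>L G (fst x) (linepath u v (snd x)))"
    by (intro bounded_bilinear.continuous_on[OF compose_bilinear] continuous_on_const
        continuous_compose_linepath2[OF G] continuous_on_fst continuous_on_id
        continuous_on_compose2[OF continuous_on_linepath[of UNIV]] continuous_on_snd)
      (auto simp: cbox_interval linepath_in_segment)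
  then have "continuous_on (A \<times> cbox 0 1) (\<lambda>(z, t). m (v - u) o\<^sub>L G z (linepath u v t))"
    by (simp add: case_prod_unfold)
  from integral_continuous_on_param[OF this] show ?thesis
    by (simp add: lint_def cbox_interval)
qed

lemma lint_swap:
  assumes G: "continuous_on (closed_segment u v \<times> closed_segment u' v') (\<lambda>(z, w). G z w)"
  shows "lint (\<lambda>z. lint (G z) u' v') u v = lint (\<lambda>w. lint (\<lambda>z. G z w) u v) u' v'"
proof -
  define H where "H s t = m (v - u) o\<^sub>L (m (v' - u') o\<^sub>L G (linepath u v s) (linepath u' v' t))" for s t
  have H: "continuous_on (cbox (0, 0) (1, 1)) (\<lambda>(s, t). H s t)"
    unfolding H_def case_prod_unfold
    by (intro bounded_bilinear.continuous_on[OF compose_bilinear] continuous_on_const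
        continuous_compose_linepath2[OF G] continuous_on_fst continuous_on_id
        continuous_on_compose2[OF continuous_on_linepath[of UNIV]] continuous_on_snd)
      (auto simp: cbox_Pair_eq cbox_interval linepath_in_segment)
  have G1: "continuous_on (closed_segment u' v') (G z)" if "z \<in> closed_segment u v" for z
    using continuous_compose_linepath2[OF G continuous_on_const _ continuous_on_id] that by auto
  have G2: "continuous_on (closed_segment u v) (\<lambda>z. G z w)" if "w \<in> closed_segment u' v'" for w
    using continuous_compose_linepath2[OF G continuous_on_id _ continuous_on_const] that by auto
  have "lint (\<lambda>z. lint (G z) u' v') u v = integral {0..1} (\<lambda>s. integral {0..1} (H s))"
    unfolding lint_def[of _ u v]
  proof (rule integral_cong)
    fix s :: real assume "s \<in> {0..1}"
    then have z: "linepath u v s \<in> closed_segment u v" by (rule linepath_in_segment)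
    show "m (v - u) o\<^sub>L lint (G (linepath u v s)) u' v' = integral {0..1} (H s)"
      using has_integral_linear[OF has_integral_lint[OF G1[OF z]]
          bounded_bilinear.bounded_linear_right[OF compose_bilinear], of "m (v - u)"]
      by (intro integral_unique[symmetric]) (simp add: H_def[abs_def] o_def)
  qed
  also have "\<dots> = integral {0..1} (\<lambda>t. integral {0..1} (\<lambda>s. H s t))"
    using integral_swap_continuous[OF H] by (simp add: cbox_interval)
  also have "\<dots> = lint (\<lambda>w. lint (\<lambda>z. G z w) u v) u' v'"
    unfolding lint_def[of _ u' v']
  proof (rule integral_cong)
    fix t :: real assume "t \<in> {0..1}"
    then have w: "linepath u' v' t \<in> closed_segment u' v'" by (rule linepath_in_segment)
    have "H s t = m (v' - u') o\<^sub>L (m (v - u) o\<^sub>L G (linepath u v s) (linepath u' v' t))" for s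
      by (simp add: H_def compose_assoc[symmetric] m_comm[of "v - u"])
    then show "integral {0..1} (\<lambda>s. H s t) = m (v' - u') o\<^sub>L lint (\<lambda>z. G z (linepath u' v' t)) u v"
      using has_integral_linear[OF has_integral_lint[OF G2[OF w]]
          bounded_bilinear.bounded_linear_right[OF compose_bilinear], of "m (v' - u')"]
      by (intro integral_unique) (simp add: o_def)
  qed
  finally show ?thesis .
qed

text \<open>Cauchy's theorem for the resolvent along the boundary of the image of the unit square under
  the bilinear map \<open>q\<close>: both inner integrals of \<open>H\<close> are evaluated by the fundamental theorem.\<close>

lemma cauchy_quadrilateral:
  fixes u v u' v' :: complex
  defines "q \<equiv> \<lambda>s t. linepath (linepath u u' s) (linepath v v' s) t"
  assumes T: "T \<in> ops"
    and q: "\<And>s t. s \<in> {0..1} \<Longrightarrow> t \<in> {0..1} \<Longrightarrow> q s t \<notin> complex_spectrum m T"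
  shows "lint (resolvent m T) u' v' - lint (resolvent m T) u v
    = lint (resolvent m T) v v' - lint (resolvent m T) u u'"
proof -
  define R where "R = resolvent m T"
  define c where "c = (v' - u') - (v - u)"
  define a where "a t = linepath (u' - u) (v' - v) t" for t
  define b where "b s = linepath (v - u) (v' - u') s" for s
  \<comment> \<open>Here \<open>a\<close> and \<open>b\<close> are the partial derivatives of
    \<open>q\<close> in \<open>s\<close> and \<open>t\<close>, and \<open>c\<close> is its mixed
    derivative. So \<open>H\<close> is both the \<open>s\<close>-derivative of \<open>b R(q)\<close>
    and the \<open>t\<close>-derivative of \<open>a R(q)\<close>, and its two iterated integrals are
    the two sides of the claim.\<close>
  define H where "H s t = (m c o\<^sub>L R (q s t)) - (m (a t * b s) o\<^sub>L (R (q s t) o\<^sub>L R (q s t)))" for s t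
  have ds: "((\<lambda>s. q s t) has_vector_derivative a t) (at s within {0..1})" for s t
    unfolding q_def a_def linepath_def
    by (auto intro!: derivative_eq_intros simp: algebra_simps scaleR_conv_of_real)
  have dt: "((\<lambda>t. q s t) has_vector_derivative b s) (at t within {0..1})" for s t
    unfolding q_def b_def linepath_def
    by (auto intro!: derivative_eq_intros simp: algebra_simps scaleR_conv_of_real)
  have da: "((\<lambda>t. m (a t)) has_vector_derivative m c) (at t within {0..1})" for t
    unfolding a_def c_def linepath_def
    by (rule bounded_linear.has_vector_derivative[OF bounded_linear_m])
      (auto intro!: derivative_eq_intros simp: algebra_simps scaleR_conv_of_real)
  have db: "((\<lambda>s. m (b s)) has_vector_derivative m c) (at s within {0..1})" for s
    unfolding b_def c_def linepath_def
    by (rule bounded_linear.has_vector_derivative[OF bounded_linear_m])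
      (auto intro!: derivative_eq_intros simp: algebra_simps scaleR_conv_of_real)
  have dR: "((\<lambda>x. R (f x)) has_vector_derivative - (m f' o\<^sub>L (R (f x) o\<^sub>L R (f x)))) (at x within {0..1})"
    if "(f has_vector_derivative f') (at x within {0..1})" "f x \<notin> complex_spectrum m T"
    for f f' and x :: real
    using vector_derivative_diff_chain_within[OF that(1)
        has_derivative_at_withinI[OF resolvent_has_derivative[OF T that(2)]]]
    by (simp add: R_def o_def)
  have FTC1: "((\<lambda>s. H s t) has_integral (m (b 1) o\<^sub>L R (q 1 t)) - (m (b 0) o\<^sub>L R (q 0 t))) {0..1}"
    if t: "t \<in> {0..1}" for t
  proof (rule fundamental_theorem_of_calculus)
    fix s :: real assume s: "s \<in> {0..1}"
    show "((\<lambda>s. m (b s) o\<^sub>L R (q s t)) has_vector_derivative H s t) (at s within {0..1})"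
      by (rule has_vector_derivative_eq_rhs[OF bounded_bilinear.has_vector_derivative[OF
              compose_bilinear db dR[OF ds q[OF s t]]]])
        (simp add: H_def compose_simps compose_assoc[symmetric] m_mult m_comm[of "a t"])
  qed simp
  have FTC2: "((\<lambda>t. H s t) has_integral (m (a 1) o\<^sub>L R (q s 1)) - (m (a 0) o\<^sub>L R (q s 0))) {0..1}"
    if s: "s \<in> {0..1}" for s
  proof (rule fundamental_theorem_of_calculus)
    fix t :: real assume t: "t \<in> {0..1}"
    show "((\<lambda>t. m (a t) o\<^sub>L R (q s t)) has_vector_derivative H s t) (at t within {0..1})"
      by (rule has_vector_derivative_eq_rhs[OF bounded_bilinear.has_vector_derivative[OF
              compose_bilinear da dR[OF dt q[OF s t]]]])
        (simp add: H_def compose_simps compose_assoc[symmetric] m_mult)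
  qed simp
  have contq: "continuous_on (cbox (0, 0) (1, 1)) (\<lambda>x. q (fst x) (snd x))"
    unfolding q_def linepath_def by (intro continuous_intros)
  have contR: "continuous_on (cbox (0, 0) (1, 1)) (\<lambda>x. R (q (fst x) (snd x)))"
  proof (rule continuous_on_compose2[OF _ contq])
    show "continuous_on (- complex_spectrum m T) R" unfolding R_def by (rule continuous_resolvent) blast
    show "(\<lambda>x. q (fst x) (snd x)) ` cbox (0, 0) (1, 1) \<subseteq> - complex_spectrum m T"
      using q by (auto simp: cbox_Pair_eq cbox_interval)
  qed
  have "continuous_on (cbox (0, 0) (1, 1)) (\<lambda>x. H (fst x) (snd x))"
    unfolding H_def a_def b_def linepath_def
    by (intro continuous_intros bounded_bilinear.continuous_on[OF compose_bilinear] contR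
        bounded_linear.continuous_on[OF bounded_linear_m])
  then have contH: "continuous_on (cbox (0, 0) (1, 1)) (\<lambda>(s, t). H s t)" by (simp add: case_prod_unfold)
  have seg: "closed_segment u v \<inter> complex_spectrum m T = {}" "closed_segment u' v' \<inter> complex_spectrum m T = {}"
    "closed_segment u u' \<inter> complex_spectrum m T = {}" "closed_segment v v' \<inter> complex_spectrum m T = {}"
    unfolding linepath_image_01[symmetric]
    using q[of 0] q[of 1] q[of _ 0] q[of _ 1] by (auto simp: q_def linepath_0' linepath_1')
  note hil = seg[THEN continuous_resolvent, THEN has_integral_lint, folded R_def]
  have "integral {0..1} (\<lambda>t. integral {0..1} (\<lambda>s. H s t)) = lint R u' v' - lint R u v"
  proof (rule integral_unique, rule has_integral_eq[rotated, OF has_integral_diff[OF hil(2) hil(1)]])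
    fix t :: real assume "t \<in> {0..1}"
    from integral_unique[OF FTC1[OF this]]
    show "(m (v' - u') o\<^sub>L R (linepath u' v' t)) - (m (v - u) o\<^sub>L R (linepath u v t))
      = integral {0..1} (\<lambda>s. H s t)"
      by (simp add: q_def b_def linepath_0' linepath_1')
  qed
  moreover have "integral {0..1} (\<lambda>s. integral {0..1} (H s)) = lint R v v' - lint R u u'"
  proof (rule integral_unique, rule has_integral_eq[rotated, OF has_integral_diff[OF hil(4) hil(3)]])
    fix s :: real assume "s \<in> {0..1}"
    from integral_unique[OF FTC2[OF this]]
    show "(m (v' - v) o\<^sub>L R (linepath v v' s)) - (m (u' - u) o\<^sub>L R (linepath u u' s))
      = integral {0..1} (H s)"
      by (simp add: q_def a_def linepath_0' linepath_1')
  qed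
  moreover have "integral {0..1} (\<lambda>s. integral {0..1} (H s)) = integral {0..1} (\<lambda>t. integral {0..1} (\<lambda>s. H s t))"
    using integral_swap_continuous[OF contH] by (simp add: cbox_interval)
  ultimately show ?thesis by (simp add: R_def)
qed

lemma linepath_in_convex:
  assumes "convex S" "x \<in> S" "y \<in> S" "t \<in> {0..1}"
  shows "linepath x y t \<in> S"
  using assms unfolding linepath_def by (intro convexD_alt) auto

text \<open>A quadrilateral with one side collapsed to the point \<open>u\<close>; convexity of
  \<open>S\<close> keeps the whole image away from the spectrum.\<close>

lemma cauchy_triangle:
  assumes T: "T \<in> ops" and S: "convex S" "S \<inter> complex_spectrum m T = {}" "u \<in> S" "v \<in> S" "w \<in> S"
  shows "lint (resolvent m T) u v + lint (resolvent m T) v w = lint (resolvent m T) u w"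
proof -
  have "linepath (linepath u u s) (linepath v w s) t \<in> S" if "s \<in> {0..1}" "t \<in> {0..1}" for s t
    using that S by (intro linepath_in_convex)
  then have "linepath (linepath u u s) (linepath v w s) t \<notin> complex_spectrum m T"
    if "s \<in> {0..1}" "t \<in> {0..1}" for s t
    using that S(2) by blast
  from cauchy_quadrilateral[OF T this] show ?thesis by (simp add: lint_same algebra_simps)
qed

lemma lint_reverse:
  assumes T: "T \<in> ops" and S: "convex S" "S \<inter> complex_spectrum m T = {}" "u \<in> S" "v \<in> S"
  shows "lint (resolvent m T) v u = - lint (resolvent m T) u v"
  using cauchy_triangle[OF T S S(3)] by (simp add: lint_same eq_neg_iff_add_eq_0 add.commute)

end

section \<open>Integrals over rectangles\<close>

text \<open>Counterclockwise from the lower left. The first corner is repeated at index 4, so the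
  four edges join \<open>i\<close> to \<open>Suc i\<close> and sums around the rectangle telescope
  to zero.\<close>

definition corner :: "complex \<Rightarrow> complex \<Rightarrow> nat \<Rightarrow> complex" where
  "corner a b i = [a, Complex (Re b) (Im a), b, Complex (Re a) (Im b), a] ! i"

lemma corner_simps [simp]:
  "corner a b 0 = a" "corner a b 1 = Complex (Re b) (Im a)" "corner a b (Suc 0) = Complex (Re b) (Im a)"
  "corner a b 2 = b" "corner a b (Suc (Suc 0)) = b" "corner a b 3 = Complex (Re a) (Im b)" "corner a b 4 = a"
  by (simp_all add: corner_def)

lemma less_4_cases: "(i::nat) < 4 \<Longrightarrow> i = 0 \<or> i = 1 \<or> i = 2 \<or> i = 3"
  by linarith

lemma rectpath_edge:
  assumes "i < 4"
  shows "closed_segment (corner a b i) (corner a b (Suc i)) \<subseteq> path_image (rectpath a b)"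
  using less_4_cases[OF assms]
  by (auto simp: rectpath_def Let_def path_image_join)

text \<open>The frame between two nested rectangles is covered by four convex strips, each
  containing an edge of the outer rectangle together with the corresponding inner edge.\<close>

lemma rectpath_edge_in_convex:
  assumes le: "Re a \<le> Re a'" "Im a \<le> Im a'" "Re a' \<le> Re b'" "Im a' \<le> Im b'" "Re b' \<le> Re b" "Im b' \<le> Im b"
    and i: "i < 4"
  shows "\<exists>S. convex S \<and> S \<subseteq> cbox a b - box a' b' \<and>
    {corner a b i, corner a b (Suc i), corner a' b' i, corner a' b' (Suc i)} \<subseteq> S"
proof -
  note box = in_box_complex_iff in_cbox_complex_iff
  consider "i = 0" | "i = 1" | "i = 2" | "i = 3" using less_4_cases[OF i] by blast
  then show ?thesis
  proof cases
    case 1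
    show ?thesis
      by (rule exI[of _ "cbox a b \<inter> {z. Im z \<le> Im a'}"])
        (use le 1 in \<open>auto simp: box intro!: convex_Int convex_halfspace_Im_le\<close>)
  next
    case 2
    show ?thesis
      by (rule exI[of _ "cbox a b \<inter> {z. Re z \<ge> Re b'}"])
        (use le 2 in \<open>auto simp: box intro!: convex_Int convex_halfspace_Re_ge\<close>)
  next
    case 3
    show ?thesis
      by (rule exI[of _ "cbox a b \<inter> {z. Im z \<ge> Im b'}"])
        (use le 3 in \<open>auto simp: box intro!: convex_Int convex_halfspace_Im_ge\<close>)
  next
    case 4
    show ?thesis
      by (rule exI[of _ "cbox a b \<inter> {z. Re z \<le> Re a'}"])
        (use le 4 in \<open>auto simp: box intro!: convex_Int convex_halfspace_Re_le\<close>)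
  qed
qed

context complex_multiplication
begin

definition rint :: "(complex \<Rightarrow> 'a \<Rightarrow>\<^sub>L 'a) \<Rightarrow> complex \<Rightarrow> complex \<Rightarrow> 'a \<Rightarrow>\<^sub>L 'a" where
  "rint F a b = (\<Sum>i<4. lint F (corner a b i) (corner a b (Suc i)))"

lemma rint_expand:
  "rint F a b = lint F a (Complex (Re b) (Im a)) + lint F (Complex (Re b) (Im a)) b
    + lint F b (Complex (Re a) (Im b)) + lint F (Complex (Re a) (Im b)) a"
proof -
  have "{..<4::nat} = {0, 1, 2, 3}" by auto
  then show ?thesis by (simp add: rint_def algebra_simps)
qed

text \<open>The operator-valued contour integral in the parametrised form used by
  \<open>complex_spectral_projector\<close>; it links that definition to the edgewise integrals
  \<open>rint\<close>.\<close>

definition has_path_integral :: "(complex \<Rightarrow> 'a \<Rightarrow>\<^sub>L 'a) \<Rightarrow> ('a \<Rightarrow>\<^sub>L 'a) \<Rightarrow> (real \<Rightarrow> complex) \<Rightarrow> bool" where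
  "has_path_integral F I g \<longleftrightarrow>
    ((\<lambda>t. m (vector_derivative g (at t within {0..1})) o\<^sub>L F (g t)) has_integral I) {0..1}"

lemma has_path_integral_interior:
  "has_path_integral F I g \<longleftrightarrow> ((\<lambda>t. m (vector_derivative g (at t)) o\<^sub>L F (g t)) has_integral I) {0..1}"
  unfolding has_path_integral_def
  by (rule has_integral_spike_finite_eq[of "{0, 1}"]) (auto simp: at_within_Icc_at)

lemma has_path_integral_linepath:
  assumes "continuous_on (closed_segment u v) F"
  shows "has_path_integral F (lint F u v) (linepath u v)"
  unfolding has_path_integral_def
  by (rule has_integral_eq[OF _ has_integral_lint[OF assms]]) (simp add: vector_derivative_linepath_within)

text \<open>Each half of the joined path runs at double speed, which compensates the halved
  interval. The midpoint and the points where a path is not differentiable form a finite set and do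
  not affect the integral.\<close>

lemma has_path_integral_join:
  assumes I: "has_path_integral F I1 g1" "has_path_integral F I2 g2"
    and g: "valid_path g1" "valid_path g2"
  shows "has_path_integral F (I1 + I2) (g1 +++ g2)"
proof -
  define h where "h g t = m (vector_derivative g (at t)) o\<^sub>L F (g t)" for g t
  have h: "(h g1 has_integral I1) {0..1}" "(h g2 has_integral I2) {0..1}"
    using I unfolding has_path_integral_interior h_def by blast+
  obtain s1 s2 where s1: "finite s1" "\<And>x. x \<in> {0..1} - s1 \<Longrightarrow> g1 differentiable at x"
      and s2: "finite s2" "\<And>x. x \<in> {0..1} - s2 \<Longrightarrow> g2 differentiable at x"
    using g by (auto simp: valid_path_def piecewise_C1_differentiable_on_def C1_differentiable_on_eq)
  have i1: "((\<lambda>x. 2 *\<^sub>R h g1 (2 * x)) has_integral I1) {0..1/2}"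
    using has_integral_cmul[OF has_integral_affinity01[OF h(1), of 2 0], of 2]
    by (simp add: image_affinity_atLeastAtMost_div_diff)
  have i2: "((\<lambda>x. 2 *\<^sub>R h g2 (2 * x - 1)) has_integral I2) {1/2..1}"
    using has_integral_cmul[OF has_integral_affinity01[OF h(2), of 2 "- 1"], of 2]
    by (simp_all only: image_affinity_atLeastAtMost_div_diff, simp_all)
  have d1: "vector_derivative (g1 +++ g2) (at x) = 2 *\<^sub>R vector_derivative g1 (at (2 * x))"
    if x: "0 \<le> x" "x < 1 / 2" "2 * x \<notin> s1" for x
  proof (rule vector_derivative_at, rule has_vector_derivative_transform_within[where d = "1 / 2 - x"])
    have "((\<lambda>x. 2 * x) has_vector_derivative 2) (at x)"
      by (auto intro!: derivative_eq_intros)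
    moreover have "(g1 has_vector_derivative vector_derivative g1 (at (2 * x))) (at (2 * x))"
      using s1(2)[of "2 * x"] x by (simp add: vector_derivative_works)
    ultimately show "((\<lambda>x. g1 (2 * x)) has_vector_derivative 2 *\<^sub>R vector_derivative g1 (at (2 * x))) (at x)"
      using vector_diff_chain_at[of "\<lambda>x. 2 * x" 2 x g1] by (simp add: o_def)
    show "g1 (2 * y) = (g1 +++ g2) y" if "y \<in> UNIV" "dist y x < 1 / 2 - x" for y
      using that by (simp add: joinpaths_def dist_real_def abs_if split: if_splits)
  qed (use x in auto)
  have d2: "vector_derivative (g1 +++ g2) (at x) = 2 *\<^sub>R vector_derivative g2 (at (2 * x - 1))"
    if x: "1 / 2 < x" "x \<le> 1" "2 * x - 1 \<notin> s2" for x
  proof (rule vector_derivative_at, rule has_vector_derivative_transform_within[where d = "x - 1 / 2"])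
    have "((\<lambda>x. 2 * x - 1) has_vector_derivative 2) (at x)"
      by (auto intro!: derivative_eq_intros)
    moreover have "(g2 has_vector_derivative vector_derivative g2 (at (2 * x - 1))) (at (2 * x - 1))"
      using s2(2)[of "2 * x - 1"] x by (simp add: vector_derivative_works)
    ultimately show "((\<lambda>x. g2 (2 * x - 1)) has_vector_derivative 2 *\<^sub>R vector_derivative g2 (at (2 * x - 1))) (at x)"
      using vector_diff_chain_at[of "\<lambda>x. 2 * x - 1" 2 x g2] by (simp add: o_def)
    show "g2 (2 * y - 1) = (g1 +++ g2) y" if "y \<in> UNIV" "dist y x < x - 1 / 2" for y
      using that by (simp add: joinpaths_def dist_real_def abs_if split: if_splits)
  qed (use x in auto)
  note m2 = linear_cmul[OF bounded_linear.linear[OF bounded_linear_m]]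
  have "(h (g1 +++ g2) has_integral I1) {0..1/2}"
  proof (rule has_integral_spike_finite[OF _ _ i1])
    show "finite (insert (1/2) ((\<lambda>x. 2 * x) -` s1))"
      using s1 by (intro finite.insertI finite_vimageI) (auto simp: inj_on_def)
    fix x :: real assume "x \<in> {0..1/2} - insert (1/2) ((\<lambda>x. 2 * x) -` s1)"
    then have "0 \<le> x" "x < 1 / 2" "2 * x \<notin> s1" by auto
    moreover from this have "(g1 +++ g2) x = g1 (2 * x)" by (simp add: joinpaths_def)
    ultimately show "h (g1 +++ g2) x = 2 *\<^sub>R h g1 (2 * x)"
      by (simp add: h_def d1 m2 compose_simps)
  qed
  moreover have "(h (g1 +++ g2) has_integral I2) {1/2..1}"
  proof (rule has_integral_spike_finite[OF _ _ i2])
    show "finite (insert (1/2) ((\<lambda>x. 2 * x - 1) -` s2))"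
      using s2 by (intro finite.insertI finite_vimageI) (auto simp: inj_on_def)
    fix x :: real assume "x \<in> {1/2..1} - insert (1/2) ((\<lambda>x. 2 * x - 1) -` s2)"
    then have "1 / 2 < x" "x \<le> 1" "2 * x - 1 \<notin> s2" by auto
    moreover from this have "(g1 +++ g2) x = g2 (2 * x - 1)" by (simp add: joinpaths_def)
    ultimately show "h (g1 +++ g2) x = 2 *\<^sub>R h g2 (2 * x - 1)"
      by (simp add: h_def d2 m2 compose_simps)
  qed
  ultimately have "(h (g1 +++ g2) has_integral I1 + I2) {0..1}"
    by (rule has_integral_combine[of 0 "1/2" 1, rotated 2]) auto
  then show ?thesis unfolding has_path_integral_interior h_def .
qed

lemma has_path_integral_rectpath:
  assumes F: "continuous_on (path_image (rectpath a b)) F"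
  shows "has_path_integral F (rint F a b) (rectpath a b)"
proof -
  have seg: "has_path_integral F (lint F (corner a b i) (corner a b (Suc i))) (linepath (corner a b i) (corner a b (Suc i)))"
    if "i < 4" for i
    by (rule has_path_integral_linepath[OF continuous_on_subset[OF F rectpath_edge[OF that]]])
  have "rint F a b = lint F (corner a b 0) (corner a b (Suc 0)) + (lint F (corner a b 1) (corner a b (Suc 1))
      + (lint F (corner a b 2) (corner a b (Suc 2)) + lint F (corner a b 3) (corner a b (Suc 3))))"
    by (simp add: rint_expand)
  moreover have "rectpath a b = linepath (corner a b 0) (corner a b (Suc 0)) +++ linepath (corner a b 1) (corner a b (Suc 1))
      +++ linepath (corner a b 2) (corner a b (Suc 2)) +++ linepath (corner a b 3) (corner a b (Suc 3))"
    by (simp add: rectpath_def Let_def)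
  ultimately show ?thesis
    by (simp only:) (intro has_path_integral_join seg valid_path_join valid_path_linepath, simp_all)
qed

lemma lint_scalar:
  assumes "continuous_on (closed_segment u v) f"
  shows "lint (\<lambda>z. m (f z)) u v = m (contour_integral (linepath u v) f)"
proof (rule lint_eqI)
  have "((\<lambda>x. f (linepath u v x) * (v - u)) has_integral contour_integral (linepath u v) f) {0..1}"
    unfolding has_contour_integral_linepath[symmetric]
    by (intro has_contour_integral_integral contour_integrable_continuous_linepath assms)
  from has_integral_linear[OF this bounded_linear_m]
  show "((\<lambda>t. m (v - u) o\<^sub>L m (f (linepath u v t))) has_integral m (contour_integral (linepath u v) f)) {0..1}"
    by (simp add: o_def m_mult m_comm)
qed

lemma rint_scalar:
  assumes f: "continuous_on (path_image (rectpath a b)) f"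
  shows "rint (\<lambda>z. m (f z)) a b = m (contour_integral (rectpath a b) f)"
proof -
  have seg: "continuous_on (closed_segment (corner a b i) (corner a b (Suc i))) f" if "i < 4" for i
    by (rule continuous_on_subset[OF f rectpath_edge[OF that]])
  note segs = seg[of 0, simplified] seg[of 1, simplified] seg[of 2, simplified] seg[of 3, simplified]
  note ints = segs[THEN contour_integrable_continuous_linepath]
  have "contour_integral (rectpath a b) f =
      contour_integral (linepath a (Complex (Re b) (Im a))) f + contour_integral (linepath (Complex (Re b) (Im a)) b) f
      + contour_integral (linepath b (Complex (Re a) (Im b))) f + contour_integral (linepath (Complex (Re a) (Im b)) a) f"
    unfolding rectpath_def Let_def using ints by (simp add: valid_path_join)
  then show ?thesis
    by (simp add: rint_expand m_add lint_scalar[OF segs(1)] lint_scalar[OF segs(2)] lint_scalar[OF segs(3)]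
        lint_scalar[OF segs(4)])
qed

lemma rint_winding_number:
  assumes z: "z \<notin> path_image (rectpath a b)"
  shows "rint (\<lambda>w. m (1 / (w - z))) a b = m (2 * pi * \<i> * winding_number (rectpath a b) z)"
proof -
  have "continuous_on (path_image (rectpath a b)) (\<lambda>w. 1 / (w - z))"
    using z by (intro continuous_intros) auto
  from rint_scalar[OF this] show ?thesis
    using winding_number_valid_path[OF valid_path_rectpath z] by simp
qed

lemma rint_cong:
  assumes "\<And>z. z \<in> path_image (rectpath a b) \<Longrightarrow> F z = G z"
  shows "rint F a b = rint G a b"
  unfolding rint_def using rectpath_edge[of _ a b] assms by (intro sum.cong lint_cong) auto

lemma rint_comp_right:
  assumes "continuous_on (path_image (rectpath a b)) F"
  shows "rint (\<lambda>z. F z o\<^sub>L S) a b = rint F a b o\<^sub>L S"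
  unfolding rint_def compose_simps
  by (intro sum.cong lint_comp_right continuous_on_subset[OF assms rectpath_edge]) auto

lemma rint_comp_left:
  assumes "continuous_on (path_image (rectpath a b)) F" "S \<in> ops"
  shows "rint (\<lambda>z. S o\<^sub>L F z) a b = S o\<^sub>L rint F a b"
  unfolding rint_def compose_simps
  by (intro sum.cong lint_comp_left continuous_on_subset[OF assms(1) rectpath_edge] assms(2)) auto

lemma rint_diff:
  assumes "continuous_on (path_image (rectpath a b)) F" "continuous_on (path_image (rectpath a b)) G"
  shows "rint (\<lambda>z. F z - G z) a b = rint F a b - rint G a b"
  unfolding rint_def sum_subtractf[symmetric]
  by (intro sum.cong lint_diff continuous_on_subset[OF assms(1) rectpath_edge]
      continuous_on_subset[OF assms(2) rectpath_edge]) auto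

lemma rint_bound:
  assumes F: "continuous_on (path_image (rectpath a b)) F"
    and B: "B \<ge> 0" "\<And>z. z \<in> path_image (rectpath a b) \<Longrightarrow> norm (F z) \<le> B"
  shows "norm (rint F a b) \<le> \<kappa> * (2 * \<bar>Re b - Re a\<bar> + 2 * \<bar>Im b - Im a\<bar>) * B"
proof -
  have bd: "norm (lint F (corner a b i) (corner a b (Suc i))) \<le> \<kappa> * cmod (corner a b (Suc i) - corner a b i) * B"
    if "i < 4" for i
    using rectpath_edge[OF that, of a b] by (intro lint_bound continuous_on_subset[OF F] B) auto
  have "norm (rint F a b) \<le> (\<Sum>i<4. \<kappa> * cmod (corner a b (Suc i) - corner a b i) * B)"
    unfolding rint_def by (intro sum_norm_le bd) simp
  also have "\<dots> = \<kappa> * (\<Sum>i<4. cmod (corner a b (Suc i) - corner a b i)) * B"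
    by (simp add: sum_distrib_left sum_distrib_right)
  also have "(\<Sum>i<4. cmod (corner a b (Suc i) - corner a b i)) = 2 * \<bar>Re b - Re a\<bar> + 2 * \<bar>Im b - Im a\<bar>"
  proof -
    have "{..<4::nat} = {0, 1, 2, 3}" by auto
    then show ?thesis by (simp add: cmod_def power2_commute[of "Re a"] power2_commute[of "Im a"])
  qed
  finally show ?thesis .
qed

lemma rint_swap:
  assumes G: "continuous_on (path_image (rectpath a b) \<times> path_image (rectpath a' b')) (\<lambda>(z, w). G z w)"
  shows "rint (\<lambda>z. rint (G z) a' b') a b = rint (\<lambda>w. rint (\<lambda>z. G z w) a b) a' b'"
proof -
  have sub: "continuous_on (closed_segment (corner a b i) (corner a b (Suc i)) \<times>
      closed_segment (corner a' b' j) (corner a' b' (Suc j))) (\<lambda>(z, w). G z w)" if "i < 4" "j < 4" for i j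
    using rectpath_edge that by (intro continuous_on_subset[OF G] Sigma_mono) auto
  have sub': "continuous_on (closed_segment (corner a' b' j) (corner a' b' (Suc j)) \<times>
      closed_segment (corner a b i) (corner a b (Suc i))) (\<lambda>(w, z). G z w)" if "i < 4" "j < 4" for i j
  proof -
    have "continuous_on (closed_segment (corner a' b' j) (corner a' b' (Suc j)) \<times>
        closed_segment (corner a b i) (corner a b (Suc i))) (\<lambda>x. (\<lambda>(z, w). G z w) (snd x, fst x))"
      by (rule continuous_on_compose2[OF sub[OF that]]) (auto intro!: continuous_intros)
    then show ?thesis by (simp add: case_prod_unfold)
  qed
  have "rint (\<lambda>z. rint (G z) a' b') a b =
      (\<Sum>i<4. \<Sum>j<4. lint (\<lambda>z. lint (G z) (corner a' b' j) (corner a' b' (Suc j))) (corner a b i) (corner a b (Suc i)))"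
    unfolding rint_def by (intro sum.cong lint_sum lint_continuous sub) auto
  also have "\<dots> = (\<Sum>i<4. \<Sum>j<4. lint (\<lambda>w. lint (\<lambda>z. G z w) (corner a b i) (corner a b (Suc i))) (corner a' b' j) (corner a' b' (Suc j)))"
    by (intro sum.cong lint_swap sub) auto
  also have "\<dots> = (\<Sum>j<4. \<Sum>i<4. lint (\<lambda>w. lint (\<lambda>z. G z w) (corner a b i) (corner a b (Suc i))) (corner a' b' j) (corner a' b' (Suc j)))"
    by (rule sum.swap)
  also have "\<dots> = rint (\<lambda>w. rint (\<lambda>z. G z w) a b) a' b'"
    unfolding rint_def by (intro sum.cong lint_sum[symmetric] lint_continuous sub') auto
  finally show ?thesis .
qed

text \<open>Cauchy's theorem for the four quadrilaterals between corresponding edges; the integrals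
  over the sides joining corresponding corners telescope to zero. The inequalities are not strict,
  so the inner rectangle may be a single point.\<close>

lemma rint_nested:
  assumes T: "T \<in> ops"
    and le: "Re a \<le> Re a'" "Im a \<le> Im a'" "Re a' \<le> Re b'" "Im a' \<le> Im b'" "Re b' \<le> Re b" "Im b' \<le> Im b"
    and spec: "(cbox a b - box a' b') \<inter> complex_spectrum m T = {}"
  shows "rint (resolvent m T) a' b' = rint (resolvent m T) a b"
proof -
  define R where "R = resolvent m T"
  define c where "c = corner a b"
  define c' where "c' = corner a' b'"
  have "lint R (c' i) (c' (Suc i)) - lint R (c i) (c (Suc i)) = lint R (c (Suc i)) (c' (Suc i)) - lint R (c i) (c' i)"
    if i: "i < 4" for i
    unfolding R_def
  proof (rule cauchy_quadrilateral[OF T])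
    fix s t :: real assume st: "s \<in> {0..1}" "t \<in> {0..1}"
    obtain S where S: "convex S" "S \<subseteq> cbox a b - box a' b'" "c i \<in> S" "c (Suc i) \<in> S" "c' i \<in> S" "c' (Suc i) \<in> S"
      using rectpath_edge_in_convex[OF le i] unfolding c_def c'_def by blast
    have "linepath (linepath (c i) (c' i) s) (linepath (c (Suc i)) (c' (Suc i)) s) t \<in> S"
      by (intro linepath_in_convex S st)
    then show "linepath (linepath (c i) (c' i) s) (linepath (c (Suc i)) (c' (Suc i)) s) t \<notin> complex_spectrum m T"
      using S(2) spec by blast
  qed
  then have "rint R a' b' - rint R a b = (\<Sum>i<4. lint R (c (Suc i)) (c' (Suc i)) - lint R (c i) (c' i))"
    unfolding rint_def c_def[symmetric] c'_def[symmetric] sum_subtractf[symmetric] by (intro sum.cong) auto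
  also have "\<dots> = lint R (c 4) (c' 4) - lint R (c 0) (c' 0)"
    by (rule sum_lessThan_telescope)
  also have "\<dots> = 0" by (simp add: c_def c'_def)
  finally show ?thesis by (simp add: R_def)
qed

section \<open>Riesz projectors as integrals over rectangles\<close>

definition encloses :: "('a \<Rightarrow>\<^sub>L 'a) \<Rightarrow> complex set \<Rightarrow> complex \<Rightarrow> complex \<Rightarrow> bool" where
  "encloses T \<Sigma> a b \<longleftrightarrow> Re a < Re b \<and> Im a < Im b \<and> \<Sigma> \<subseteq> box a b \<and> (complex_spectrum m T - \<Sigma>) \<inter> cbox a b = {}"

lemma encloses_path_image:
  assumes "encloses T \<Sigma> a b"
  shows "path_image (rectpath a b) \<inter> complex_spectrum m T = {}"
proof -
  have "path_image (rectpath a b) = cbox a b - box a b"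
    using assms by (intro path_image_rectpath_cbox_minus_box) (auto simp: encloses_def)
  then show ?thesis using assms unfolding encloses_def by blast
qed

text \<open>Both integrals equal the one over the intersection of the rectangles, which still
  contains \<Sigma>. If \<Sigma> is empty the rectangles may be disjoint; then each is shrunk to a
  point instead and both integrals vanish.\<close>

lemma rint_encloses_unique:
  assumes T: "T \<in> ops" and ab: "encloses T \<Sigma> a b" and cd: "encloses T \<Sigma> c d"
  shows "rint (resolvent m T) a b = rint (resolvent m T) c d"
proof (cases "\<Sigma> = {}")
  case True
  have "rint (resolvent m T) a b = 0" if "encloses T \<Sigma> a b" for a b
  proof -
    have "rint (resolvent m T) a a = rint (resolvent m T) a b"
      using that True by (intro rint_nested[OF T]) (auto simp: encloses_def)
    moreover have "rint (resolvent m T) a a = 0" by (simp add: rint_expand lint_same)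
    ultimately show ?thesis by simp
  qed
  then show ?thesis using ab cd by simp
next
  case False
  then obtain z where z: "z \<in> \<Sigma>" by blast
  define p where "p = Complex (max (Re a) (Re c)) (max (Im a) (Im c))"
  define q where "q = Complex (min (Re b) (Re d)) (min (Im b) (Im d))"
  have sub: "\<Sigma> \<subseteq> box p q" using ab cd by (auto simp: encloses_def p_def q_def in_box_complex_iff subset_iff)
  then have zb: "Re p \<le> Re q" "Im p \<le> Im q" using z by (force simp: in_box_complex_iff)+
  have "rint (resolvent m T) p q = rint (resolvent m T) a b"
    using ab sub zb by (intro rint_nested[OF T]) (auto simp: encloses_def p_def q_def)
  moreover have "rint (resolvent m T) p q = rint (resolvent m T) c d"
    using cd sub zb by (intro rint_nested[OF T]) (auto simp: encloses_def p_def q_def)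
  ultimately show ?thesis by simp
qed

text \<open>Removes the choice of contour: whichever rectangle is selected in the definition, its
  integral equals that over any given enclosing rectangle.\<close>

lemma complex_spectral_projector_eq:
  assumes T: "T \<in> ops" and ab: "encloses T \<Sigma> a b"
  shows "complex_spectral_projector m T \<Sigma> = m (1 / (2 * pi * \<i>)) o\<^sub>L rint (resolvent m T) a b"
proof -
  define P where "P = (\<lambda>(a, b). Re a < Re b \<and> Im a < Im b \<and>
            \<Sigma> \<subseteq> box a b \<and> (complex_spectrum m T - \<Sigma>) \<inter> cbox a b = {})"
  obtain c d where cd: "(SOME p. P p) = (c, d)" by fastforce
  have "P (a, b)" using ab by (simp add: P_def encloses_def)
  then have "P (SOME p. P p)" by (rule someI)
  then have enc: "encloses T \<Sigma> c d" by (simp add: cd) (simp add: P_def encloses_def)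
  define g where "g = rectpath c d"
  define R where "R = resolvent m T"
  have "has_path_integral R (rint R c d) g"
    unfolding g_def R_def
    by (rule has_path_integral_rectpath[OF continuous_resolvent[OF encloses_path_image[OF enc]]])
  then have "((\<lambda>t. m (vector_derivative g (at t within {0..1})) o\<^sub>L R (g t)) has_integral rint R c d) {0..1}"
    by (simp add: has_path_integral_def)
  from has_integral_linear[OF this bounded_bilinear.bounded_linear_right[OF compose_bilinear],
      of "m (1 / (2 * pi * \<i>))"]
  have "((\<lambda>t. m (vector_derivative g (at t within {0..1}) / (2 * pi * \<i>)) o\<^sub>L R (g t)) has_integral
      m (1 / (2 * pi * \<i>)) o\<^sub>L rint R c d) {0..1}"
    by (simp add: o_def compose_assoc[symmetric] m_mult[symmetric])
  then have "complex_spectral_projector m T \<Sigma> = m (1 / (2 * pi * \<i>)) o\<^sub>L rint R c d"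
    unfolding complex_spectral_projector_def P_def[symmetric] cd
    by (simp add: Let_def g_def R_def integral_unique)
  also have "rint R c d = rint R a b" unfolding R_def by (rule rint_encloses_unique[OF T enc ab])
  finally show ?thesis by (simp add: R_def)
qed

lemma spectral_projector_in_ops:
  assumes T: "T \<in> ops" and ab: "encloses T \<Sigma> a b"
  shows "complex_spectral_projector m T \<Sigma> \<in> ops"
proof -
  define I where "I = rint (resolvent m T) a b"
  note cont = continuous_resolvent[OF encloses_path_image[OF ab]]
  have "I o\<^sub>L m c = m c o\<^sub>L I" for c
  proof -
    have "I o\<^sub>L m c = rint (\<lambda>z. resolvent m T z o\<^sub>L m c) a b"
      unfolding I_def by (rule rint_comp_right[OF cont, symmetric])
    also have "\<dots> = rint (\<lambda>z. m c o\<^sub>L resolvent m T z) a b"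
      using encloses_path_image[OF ab] by (intro rint_cong opsD resolvent_in_ops T) blast
    also have "\<dots> = m c o\<^sub>L I" unfolding I_def by (rule rint_comp_left[OF cont m_in_ops])
    finally show ?thesis .
  qed
  then show ?thesis
    unfolding complex_spectral_projector_eq[OF T ab] I_def[symmetric] ops_def
    by (simp add: compose_assoc m_comm) (simp add: compose_assoc[symmetric] m_comm)
qed

text \<open>By the resolvent identity \<open>R(z) R(w)\<close> is
  \<open>(R(z) - R(w)) / (w - z)\<close>. In the double integral the first term dies in the
  \<open>w\<close>-integration, since \<open>z\<close> is outside the second rectangle; after
  interchanging the integrals the other dies in the \<open>z\<close>-integration, since
  \<open>w\<close> is outside the first.\<close>

lemma rint_disjoint_product:
  assumes T: "T \<in> ops"
    and ab: "path_image (rectpath a b) \<inter> complex_spectrum m T = {}" "Re a < Re b" "Im a < Im b"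
    and cd: "path_image (rectpath c d) \<inter> complex_spectrum m T = {}" "Re c < Re d" "Im c < Im d"
    and disj: "cbox a b \<inter> cbox c d = {}"
  shows "rint (resolvent m T) a b o\<^sub>L rint (resolvent m T) c d = 0"
proof -
  define R where "R = resolvent m T"
  define A where "A = path_image (rectpath a b)"
  define B where "B = path_image (rectpath c d)"
  have sub: "A \<subseteq> cbox a b" "B \<subseteq> cbox c d"
    unfolding A_def B_def using ab cd by (intro path_image_rectpath_subset_cbox; simp)+
  have ne: "w \<noteq> z" if "z \<in> A" "w \<in> B" for z w using that sub disj by blast
  have RA: "continuous_on A R" and RB: "continuous_on B R"
    unfolding A_def B_def R_def by (rule continuous_resolvent[OF ab(1)] continuous_resolvent[OF cd(1)])+
  define G where "G z w = m (1 / (w - z)) o\<^sub>L R w" for z w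
  have G: "continuous_on (A \<times> B) (\<lambda>(z, w). G z w)"
    unfolding G_def case_prod_unfold
    by (intro bounded_bilinear.continuous_on[OF compose_bilinear]
        bounded_linear.continuous_on[OF bounded_linear_m] continuous_intros
        continuous_on_compose2[OF RB continuous_on_snd[OF continuous_on_id]]) (use ne in force)+
  have zero: "rint (\<lambda>w. m (1 / (w - z))) c d = 0" if z: "z \<in> A" for z
  proof -
    have "z \<notin> cbox c d" using z sub disj by blast
    then have "winding_number (rectpath c d) z = 0" "z \<notin> path_image (rectpath c d)"
      using cd sub by (auto simp: winding_number_rectpath_outside B_def)
    then show ?thesis by (simp add: rint_winding_number m_0)
  qed
  have zero': "rint (\<lambda>z. m (1 / (w - z))) a b = 0" if w: "w \<in> B" for w
  proof -
    have "w \<notin> cbox a b" using w sub disj by blast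
    then have "winding_number (rectpath a b) w = 0" "w \<notin> path_image (rectpath a b)"
      using ab sub by (auto simp: winding_number_rectpath_outside A_def)
    then have z: "rint (\<lambda>z. m (1 / (z - w))) a b = 0" by (simp add: rint_winding_number m_0)
    have cont: "continuous_on A (\<lambda>z. m (1 / (z - w)))"
      using ne w by (intro bounded_linear.continuous_on[OF bounded_linear_m] continuous_intros) auto
    have "rint (\<lambda>z. m (1 / (w - z))) a b = rint (\<lambda>z. m (- 1) o\<^sub>L m (1 / (z - w))) a b"
    proof (rule rint_cong)
      fix z
      have "1 / (w - z) = - 1 * (1 / (z - w))" by (simp add: minus_divide_right)
      then show "m (1 / (w - z)) = m (- 1) o\<^sub>L m (1 / (z - w))" by (metis m_mult)
    qed
    also have "\<dots> = 0" using rint_comp_left[OF cont[unfolded A_def] m_in_ops, of "- 1"] z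
      by (simp add: compose_simps)
    finally show ?thesis .
  qed
  have "rint R a b o\<^sub>L rint R c d = rint (\<lambda>z. R z o\<^sub>L rint R c d) a b"
    by (rule rint_comp_right[OF RA[unfolded A_def], symmetric])
  also have "\<dots> = rint (\<lambda>z. m (- 1) o\<^sub>L rint (G z) c d) a b"
  proof (rule rint_cong)
    fix z assume "z \<in> path_image (rectpath a b)"
    then have z: "z \<in> A" by (simp add: A_def)
    then have zr: "z \<notin> complex_spectrum m T" using ab(1) by (auto simp: A_def)
    have c1: "continuous_on B (\<lambda>w. m (1 / (w - z)))"
      using ne z by (intro bounded_linear.continuous_on[OF bounded_linear_m] continuous_intros) auto
    have c2: "continuous_on B (\<lambda>w. m (1 / (w - z)) o\<^sub>L R z)"
      by (intro bounded_bilinear.continuous_on[OF compose_bilinear] c1 continuous_on_const)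
    have c3: "continuous_on B (G z)"
      unfolding G_def by (intro bounded_bilinear.continuous_on[OF compose_bilinear] c1 RB)
    have "R z o\<^sub>L rint R c d = rint (\<lambda>w. R z o\<^sub>L R w) c d"
      unfolding R_def
      by (rule rint_comp_left[OF continuous_resolvent[OF cd(1)] resolvent_in_ops[OF T zr], symmetric])
    also have "\<dots> = rint (\<lambda>w. (m (1 / (w - z)) o\<^sub>L R z) - G z w) c d"
    proof (rule rint_cong)
      fix w assume "w \<in> path_image (rectpath c d)"
      then have w: "w \<in> B" by (simp add: B_def)
      then have wr: "w \<notin> complex_spectrum m T" using cd(1) by (auto simp: B_def)
      have "(m (1 / (w - z)) o\<^sub>L R z) - G z w = m (1 / (w - z)) o\<^sub>L (R z - R w)"
        by (simp add: G_def compose_simps)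
      also have "\<dots> = m (1 / (w - z) * (w - z)) o\<^sub>L (R z o\<^sub>L R w)"
        unfolding R_def resolvent_identity[OF T zr wr] by (simp only: m_mult compose_assoc)
      also have "\<dots> = R z o\<^sub>L R w" using ne[OF z w] by (simp add: m_1)
      finally show "R z o\<^sub>L R w = (m (1 / (w - z)) o\<^sub>L R z) - G z w" by simp
    qed
    also have "\<dots> = (rint (\<lambda>w. m (1 / (w - z))) c d o\<^sub>L R z) - rint (G z) c d"
      using rint_diff[OF c2[unfolded B_def] c3[unfolded B_def]] rint_comp_right[OF c1[unfolded B_def], of "R z"]
      by simp
    finally show "R z o\<^sub>L rint R c d = m (- 1) o\<^sub>L rint (G z) c d"
      using zero[OF z] by (simp add: compose_simps m_minus m_1)
  qed
  also have "\<dots> = m (- 1) o\<^sub>L rint (\<lambda>z. rint (G z) c d) a b"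
  proof (rule rint_comp_left[OF _ m_in_ops])
    show "continuous_on (path_image (rectpath a b)) (\<lambda>z. rint (G z) c d)"
      unfolding rint_def using rectpath_edge[of _ c d]
      by (intro continuous_on_sum lint_continuous continuous_on_subset[OF G]) (auto simp: A_def B_def)
  qed
  also have "rint (\<lambda>z. rint (G z) c d) a b = rint (\<lambda>w. rint (\<lambda>z. G z w) a b) c d"
    by (rule rint_swap[OF G[unfolded A_def B_def]])
  also have "\<dots> = rint (\<lambda>w. 0) c d"
  proof (rule rint_cong)
    fix w assume "w \<in> path_image (rectpath c d)"
    then have w: "w \<in> B" by (simp add: B_def)
    have cont: "continuous_on A (\<lambda>z. m (1 / (w - z)))"
      using ne w by (intro bounded_linear.continuous_on[OF bounded_linear_m] continuous_intros) auto
    show "rint (\<lambda>z. G z w) a b = 0"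
      unfolding G_def using rint_comp_right[OF cont[unfolded A_def]] zero'[OF w] by (simp add: compose_simps)
  qed
  also have "\<dots> = 0" by (simp add: rint_def lint_def compose_simps)
  finally show ?thesis by (simp add: R_def compose_simps)
qed

end

section \<open>Spectral projectors of hyperbolic operators\<close>

context complex_multiplication
begin

text \<open>For \<open>M\<close> large, the rectangles \<open>[0, M] \<times> [-M, M]\<close> and \<open>[-M, 0] \<times> [-M, M]\<close> enclose the two
  parts of the spectrum: their common edge lies on the imaginary axis, which carries no spectrum.\<close>

definition no_imaginary_spectrum :: "('a \<Rightarrow>\<^sub>L 'a) \<Rightarrow> bool" where
  "no_imaginary_spectrum T \<longleftrightarrow> complex_spectrum m T \<inter> {z. Re z = 0} = {}"

lemma spectrum_bounded:
  assumes "2 * \<kappa> * norm T < M" "z \<in> complex_spectrum m T"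
  shows "cmod z < M" "\<bar>Re z\<bar> < M" "\<bar>Im z\<bar> < M"
proof -
  have "0 \<le> 2 * \<kappa> * norm T" using \<kappa>_ge by simp
  then have "M > 0" using assms(1) by linarith
  then have "M \<le> cmod z \<Longrightarrow> z \<notin> complex_spectrum m T"
    using assms(1) by (intro resolvent_large(1)) auto
  then show z: "cmod z < M" using assms(2) by linarith
  show "\<bar>Re z\<bar> < M" "\<bar>Im z\<bar> < M"
    using z abs_Re_le_cmod[of z] abs_Im_le_cmod[of z] by linarith+
qed

lemma encloses_positive:
  assumes "no_imaginary_spectrum T" "2 * \<kappa> * norm T < M"
  shows "encloses T {z \<in> complex_spectrum m T. Re z > 0} (Complex 0 (- M)) (Complex M M)"
proof -
  have "0 \<le> 2 * \<kappa> * norm T" using \<kappa>_ge by simp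
  then have "M > 0" using assms(2) by linarith
  moreover have "Re z \<noteq> 0" if "z \<in> complex_spectrum m T" for z
    using assms(1) that by (auto simp: no_imaginary_spectrum_def)
  ultimately show ?thesis
    using spectrum_bounded[OF assms(2)]
    by (force simp: encloses_def in_box_complex_iff in_cbox_complex_iff abs_less_iff)
qed

lemma encloses_negative:
  assumes "no_imaginary_spectrum T" "2 * \<kappa> * norm T < M"
  shows "encloses T {z \<in> complex_spectrum m T. Re z < 0} (Complex (- M) (- M)) (Complex 0 M)"
proof -
  have "0 \<le> 2 * \<kappa> * norm T" using \<kappa>_ge by simp
  then have "M > 0" using assms(2) by linarith
  moreover have "Re z \<noteq> 0" if "z \<in> complex_spectrum m T" for z
    using assms(1) that by (auto simp: no_imaginary_spectrum_def)
  ultimately show ?thesis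
    using spectrum_bounded[OF assms(2)]
    by (force simp: encloses_def in_box_complex_iff in_cbox_complex_iff abs_less_iff)
qed

text \<open>The rectangles for the two half planes share an edge, whereas
  \<open>rint_disjoint_product\<close> needs disjoint closed rectangles. Compactness of the spectrum
  in the closed left half plane leaves a gap next to the imaginary axis.\<close>

lemma encloses_negative_strict:
  assumes hyp: "no_imaginary_spectrum T" and M: "2 * \<kappa> * norm T < M"
  shows "\<exists>e>0. encloses T {z \<in> complex_spectrum m T. Re z < 0} (Complex (- M) (- M)) (Complex (- e) M)"
proof -
  have "0 \<le> 2 * \<kappa> * norm T" using \<kappa>_ge by simp
  then have M0: "M > 0" using M by linarith
  define N where "N = complex_spectrum m T \<inter> {z. Re z \<le> 0}"
  have neg: "Re z < 0" if "z \<in> N" for z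
    using hyp that by (force simp: no_imaginary_spectrum_def N_def)
  have "\<exists>e>0. e < M \<and> (\<forall>z\<in>N. Re z < - e)"
  proof (cases "N = {}")
    case True
    then show ?thesis using M0 by (intro exI[of _ "M / 2"]) simp
  next
    case False
    have "closed N"
      unfolding N_def using open_resolvent_set[of T]
      by (intro closed_Int closed_halfspace_Re_le) (simp add: open_closed)
    moreover have "bounded N"
      unfolding bounded_iff using spectrum_bounded(1)[OF M] by (auto simp: N_def intro!: exI[of _ M] less_imp_le)
    ultimately have "compact N" by (simp add: compact_eq_bounded_closed)
    then obtain x where x: "x \<in> N" "\<And>y. y \<in> N \<Longrightarrow> Re y \<le> Re x"
      using continuous_attains_sup[OF _ False continuous_on_Re[OF continuous_on_id]] by auto
    have "\<bar>Re x\<bar> < M" by (rule spectrum_bounded(2)[OF M]) (use x(1) in \<open>simp add: N_def\<close>)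
    \<comment> \<open>\<open>x\<close> is the rightmost point of \<open>N\<close>, and half its
      distance to the imaginary axis serves as the gap.\<close>
    then have "0 < - Re x / 2" "- Re x / 2 < M" using neg[OF x(1)] M0 by linarith+
    moreover have "Re z < - (- Re x / 2)" if "z \<in> N" for z using x(2)[OF that] neg[OF x(1)] by simp
    ultimately show ?thesis by blast
  qed
  then obtain e where e: "e > 0" "e < M" "\<And>z. z \<in> N \<Longrightarrow> Re z < - e" by blast
  have "encloses T {z \<in> complex_spectrum m T. Re z < 0} (Complex (- M) (- M)) (Complex (- e) M)"
    unfolding encloses_def
  proof (intro conjI)
    show "{z \<in> complex_spectrum m T. Re z < 0} \<subseteq> box (Complex (- M) (- M)) (Complex (- e) M)"
      using e(3) spectrum_bounded[OF M] by (force simp: N_def in_box_complex_iff abs_less_iff)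
    show "(complex_spectrum m T - {z \<in> complex_spectrum m T. Re z < 0})
        \<inter> cbox (Complex (- M) (- M)) (Complex (- e) M) = {}"
      using e(1) by (auto simp: in_cbox_complex_iff)
  qed (use e M0 in auto)
  then show ?thesis using e(1) by blast
qed

text \<open>The common edge is traversed twice in opposite directions, and the horizontal edges
  combine within half planes that contain no spectrum.\<close>

lemma rint_split:
  assumes T: "T \<in> ops" and hyp: "no_imaginary_spectrum T" and M: "2 * \<kappa> * norm T < M"
  shows "rint (resolvent m T) (Complex 0 (- M)) (Complex M M)
      + rint (resolvent m T) (Complex (- M) (- M)) (Complex 0 M)
    = rint (resolvent m T) (Complex (- M) (- M)) (Complex M M)"
proof -
  define L where "L = lint (resolvent m T)"
  have S: "{z. Im z \<le> - M} \<inter> complex_spectrum m T = {}" "{z. Im z \<ge> M} \<inter> complex_spectrum m T = {}"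
    using spectrum_bounded(3)[OF M] by (force simp: abs_less_iff)+
  have "{z. Re z = 0} = {z. Re z \<le> 0} \<inter> {z. Re z \<ge> 0}" by auto
  then have cv: "convex {z. Re z = 0}"
    using convex_Int[OF convex_halfspace_Re_le convex_halfspace_Re_ge] by metis
  have i: "{z. Re z = 0} \<inter> complex_spectrum m T = {}" using hyp by (auto simp: no_imaginary_spectrum_def)
  have bottom: "L (Complex (- M) (- M)) (Complex 0 (- M)) + L (Complex 0 (- M)) (Complex M (- M))
      = L (Complex (- M) (- M)) (Complex M (- M))"
    unfolding L_def by (rule cauchy_triangle[OF T convex_halfspace_Im_le S(1)]) auto
  have top: "L (Complex M M) (Complex 0 M) + L (Complex 0 M) (Complex (- M) M) = L (Complex M M) (Complex (- M) M)"
    unfolding L_def by (rule cauchy_triangle[OF T convex_halfspace_Im_ge S(2)]) auto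
  have middle: "L (Complex 0 M) (Complex 0 (- M)) = - L (Complex 0 (- M)) (Complex 0 M)"
    unfolding L_def by (rule lint_reverse[OF T cv i]) auto
  show ?thesis
    unfolding rint_expand L_def[symmetric] complex.sel bottom[symmetric] top[symmetric] middle
    by (simp add: algebra_simps)
qed

text \<open>The integral does not change when the square grows to half side \<open>N\<close>, and
  there the resolvent is compared with \<open>1 / z\<close>, whose integral is
  \<open>2 \<pi> i\<close>. The difference \<open>D\<close> is thus bounded by a quantity that tends
  to zero with \<open>1 / N\<close>.\<close>

lemma rint_full:
  assumes T: "T \<in> ops" and M: "2 * \<kappa> * norm T < M"
  shows "rint (resolvent m T) (Complex (- M) (- M)) (Complex M M) = m (2 * pi * \<i>)"
proof -
  have nn: "0 \<le> 2 * \<kappa> * norm T" using \<kappa>_ge by simp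
  then have M0: "M > 0" using M by linarith
  define D where "D = rint (resolvent m T) (Complex (- M) (- M)) (Complex M M) - m (2 * pi * \<i>)"
  have est: "norm D \<le> 16 * \<kappa>^3 * norm T / N" if N: "N \<ge> M" for N
  proof -
    define a where "a = Complex (- N) (- N)"
    define b where "b = Complex N N"
    have N0: "N > 0" using N M0 by simp
    have path: "path_image (rectpath a b) = cbox a b - box a b"
      using N0 by (intro path_image_rectpath_cbox_minus_box) (auto simp: a_def b_def)
    have large: "N \<le> cmod z" if "z \<in> path_image (rectpath a b)" for z
    proof -
      have "N \<le> \<bar>Re z\<bar> \<or> N \<le> \<bar>Im z\<bar>"
        using that unfolding path by (auto simp: in_box_complex_iff in_cbox_complex_iff a_def b_def)
      then show ?thesis using abs_Re_le_cmod[of z] abs_Im_le_cmod[of z] by linarith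
    qed
    have z0: "0 \<notin> path_image (rectpath a b)" using large N0 by force
    have spec: "path_image (rectpath a b) \<inter> complex_spectrum m T = {}"
      using large spectrum_bounded(1)[OF M] N by force
    have c1: "continuous_on (path_image (rectpath a b)) (resolvent m T)"
      by (rule continuous_resolvent[OF spec])
    have c2: "continuous_on (path_image (rectpath a b)) (\<lambda>z. m (1 / (z - 0)))"
      using z0 by (intro bounded_linear.continuous_on[OF bounded_linear_m] continuous_intros) auto
    have "winding_number (rectpath a b) 0 = 1"
      using N0 by (intro winding_number_rectpath) (auto simp: in_box_complex_iff a_def b_def)
    then have "rint (\<lambda>z. m (1 / (z - 0))) a b = m (2 * pi * \<i>)"
      using rint_winding_number[OF z0] by simp
    moreover have "rint (resolvent m T) (Complex (- M) (- M)) (Complex M M) = rint (resolvent m T) a b"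
      using N M0 spectrum_bounded(2,3)[OF M]
      by (intro rint_nested[OF T]) (force simp: a_def b_def in_box_complex_iff in_cbox_complex_iff abs_less_iff)+
    ultimately have "D = rint (\<lambda>z. resolvent m T z - m (1 / (z - 0))) a b"
      using rint_diff[OF c1 c2] by (simp add: D_def)
    also have "norm \<dots> \<le> \<kappa> * (2 * \<bar>Re b - Re a\<bar> + 2 * \<bar>Im b - Im a\<bar>) * (2 * (\<kappa> / N)\<^sup>2 * norm T)"
    proof (rule rint_bound[OF continuous_on_diff[OF c1 c2]])
      fix z assume z: "z \<in> path_image (rectpath a b)"
      have "norm (resolvent m T z - m (1 / z)) \<le> 2 * (\<kappa> / cmod z)\<^sup>2 * norm T"
        using large[OF z] N M N0 by (intro resolvent_large(2)) auto
      also have "\<dots> \<le> 2 * (\<kappa> / N)\<^sup>2 * norm T"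
        using large[OF z] N0 \<kappa>_ge by (intro mult_right_mono mult_left_mono power_mono frac_le) auto
      finally show "norm (resolvent m T z - m (1 / (z - 0))) \<le> 2 * (\<kappa> / N)\<^sup>2 * norm T" by simp
    qed simp
    \<comment> \<open>The perimeter is \<open>8 N\<close> and the integrand is at most
      \<open>2 (\<kappa> / N)^2 norm T\<close>; one more factor \<kappa> comes from the
      differential.\<close>
    also have "\<dots> = 16 * \<kappa>^3 * norm T / N"
      using N0 by (simp add: a_def b_def power2_eq_square power3_eq_cube field_simps)
    finally show ?thesis .
  qed
  have "(\<lambda>n. 16 * \<kappa>^3 * norm T / real n) \<longlonglongrightarrow> 0" by (rule lim_const_over_n)
  moreover have "\<exists>n0. \<forall>n\<ge>n0. norm D \<le> 16 * \<kappa>^3 * norm T / real n"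
  proof (intro exI[of _ "nat \<lceil>M\<rceil>"] allI impI est)
    fix n assume "nat \<lceil>M\<rceil> \<le> n"
    then show "M \<le> real n" by linarith
  qed
  ultimately have "norm D \<le> 0" by (rule LIMSEQ_le_const)
  then show ?thesis by (simp add: D_def)
qed

section \<open>The complementary projectors of a hyperbolic operator\<close>

definition positive_part :: "('a \<Rightarrow>\<^sub>L 'a) \<Rightarrow> 'a \<Rightarrow>\<^sub>L 'a" where
  "positive_part T = complex_spectral_projector m T {z \<in> complex_spectrum m T. Re z > 0}"

definition negative_part :: "('a \<Rightarrow>\<^sub>L 'a) \<Rightarrow> 'a \<Rightarrow>\<^sub>L 'a" where
  "negative_part T = complex_spectral_projector m T {z \<in> complex_spectrum m T. Re z < 0}"

lemma positive_part_eq: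
  assumes "T \<in> ops" "no_imaginary_spectrum T" "2 * \<kappa> * norm T < M"
  shows "positive_part T = m (1 / (2 * pi * \<i>)) o\<^sub>L rint (resolvent m T) (Complex 0 (- M)) (Complex M M)"
  unfolding positive_part_def by (rule complex_spectral_projector_eq[OF assms(1) encloses_positive[OF assms(2,3)]])

lemma positive_part_in_ops:
  assumes "T \<in> ops" "no_imaginary_spectrum T"
  shows "positive_part T \<in> ops"
  unfolding positive_part_def
  by (rule spectral_projector_in_ops[OF assms(1) encloses_positive[OF assms(2), of "2 * \<kappa> * norm T + 1"]]) simp

lemma positive_plus_negative:
  assumes T: "T \<in> ops" and hyp: "no_imaginary_spectrum T"
  shows "positive_part T + negative_part T = id_blinfun"
proof -
  define M where "M = 2 * \<kappa> * norm T + 1"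
  have M: "2 * \<kappa> * norm T < M" by (simp add: M_def)
  have "negative_part T = m (1 / (2 * pi * \<i>)) o\<^sub>L rint (resolvent m T) (Complex (- M) (- M)) (Complex 0 M)"
    unfolding negative_part_def by (rule complex_spectral_projector_eq[OF T encloses_negative[OF hyp M]])
  then have "positive_part T + negative_part T = m (1 / (2 * pi * \<i>)) o\<^sub>L m (2 * pi * \<i>)"
    unfolding positive_part_eq[OF T hyp M] rint_full[OF T M, symmetric] rint_split[OF T hyp M, symmetric]
    by (simp add: compose_simps)
  also have "\<dots> = m 1" by (simp add: m_mult[symmetric])
  finally show ?thesis by (simp add: m_1)
qed

lemma positive_times_negative:
  assumes T: "T \<in> ops" and hyp: "no_imaginary_spectrum T"
  shows "positive_part T o\<^sub>L negative_part T = 0"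
proof -
  define M where "M = 2 * \<kappa> * norm T + 1"
  have M: "2 * \<kappa> * norm T < M" by (simp add: M_def)
  define c where "c = 1 / (2 * pi * \<i>)"
  define R where "R = resolvent m T"
  note pos = encloses_positive[OF hyp M]
  obtain e where e: "e > 0"
      and neg: "encloses T {z \<in> complex_spectrum m T. Re z < 0} (Complex (- M) (- M)) (Complex (- e) M)"
    using encloses_negative_strict[OF hyp M] by blast
  define I where "I = rint R (Complex 0 (- M)) (Complex M M)"
  define J where "J = rint R (Complex (- M) (- M)) (Complex (- e) M)"
  have P: "positive_part T = m c o\<^sub>L I"
    unfolding positive_part_eq[OF T hyp M] c_def I_def R_def ..
  have N: "negative_part T = m c o\<^sub>L J"
    unfolding negative_part_def complex_spectral_projector_eq[OF T neg] c_def J_def R_def ..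
  have "I o\<^sub>L J = 0"
    unfolding I_def J_def R_def
  proof (rule rint_disjoint_product[OF T encloses_path_image[OF pos] _ _ encloses_path_image[OF neg]])
    show "cbox (Complex 0 (- M)) (Complex M M) \<inter> cbox (Complex (- M) (- M)) (Complex (- e) M) = {}"
      using e by (auto simp: in_cbox_complex_iff)
  qed (use pos neg in \<open>auto simp: encloses_def\<close>)
  \<comment> \<open>The integral inherits this from the projector \<open>m c o I\<close>, which is
    complex linear, by cancelling the invertible factor \<open>m c\<close>.\<close>
  moreover have "I o\<^sub>L m c = m c o\<^sub>L I"
  proof -
    have "m c o\<^sub>L (I o\<^sub>L m c) = m c o\<^sub>L (m c o\<^sub>L I)"
      using opsD[OF positive_part_in_ops[OF T hyp], of c] by (simp add: P compose_assoc)
    then have "m (1 / c) o\<^sub>L (m c o\<^sub>L (I o\<^sub>L m c)) = m (1 / c) o\<^sub>L (m c o\<^sub>L (m c o\<^sub>L I))" by simp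
    then show ?thesis
      by (simp add: compose_assoc[symmetric] m_mult[symmetric]) (simp add: c_def m_1 compose_assoc)
  qed
  moreover have "positive_part T o\<^sub>L negative_part T = m c o\<^sub>L ((I o\<^sub>L m c) o\<^sub>L J)"
    by (simp only: P N compose_assoc)
  ultimately show ?thesis by (simp add: compose_assoc compose_simps)
qed

text \<open>Multiply the decomposition of the identity by the positive part; the mixed product
  vanishes.\<close>

lemma positive_part_idempotent:
  assumes "T \<in> ops" "no_imaginary_spectrum T"
  shows "positive_part T o\<^sub>L positive_part T = positive_part T"
proof -
  have "positive_part T o\<^sub>L (positive_part T + negative_part T) = positive_part T"
    by (simp add: positive_plus_negative[OF assms])
  then show ?thesis by (simp add: compose_simps positive_times_negative[OF assms])
qed

text \<open>One rectangle serves all operators near \<open>T\<close>, so the projectors differ by an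
  integral of resolvent differences over a fixed contour. Its left edge contains every imaginary
  number that could be in the spectrum, so invertibility along the contour also yields hyperbolicity
  of \<open>T'\<close>.\<close>

lemma positive_part_continuous:
  assumes T: "T \<in> ops" and hyp: "no_imaginary_spectrum T" and e: "e > 0"
  shows "\<exists>d>0. \<forall>T'\<in>ops. norm (T' - T) < d \<longrightarrow>
    no_imaginary_spectrum T' \<and> norm (positive_part T' - positive_part T) < e"
proof -
  \<comment> \<open>Chosen so that the spectrum of every operator within distance one of
    \<open>T\<close> has modulus below \<open>M\<close>.\<close>
  define M where "M = 2 * \<kappa> * (norm T + 1) + 1"
  have M: "2 * \<kappa> * norm U < M" if "norm (U - T) \<le> 1" for U
  proof -
    have "norm U \<le> norm T + 1" using that norm_triangle_ineq2[of U T] by linarith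
    then have "2 * \<kappa> * norm U \<le> 2 * \<kappa> * (norm T + 1)" using \<kappa>_ge by (intro mult_left_mono) auto
    then show ?thesis by (simp add: M_def)
  qed
  have MT: "2 * \<kappa> * norm T < M" using M[of T] by simp
  have "0 \<le> 2 * \<kappa> * norm T" using \<kappa>_ge by simp
  then have M0: "M > 0" using MT by linarith
  define a where "a = Complex 0 (- M)"
  define b where "b = Complex M M"
  define S where "S = path_image (rectpath a b)"
  have enc: "encloses T {z \<in> complex_spectrum m T. Re z > 0} a b"
    unfolding a_def b_def by (rule encloses_positive[OF hyp MT])
  have spec: "S \<inter> complex_spectrum m T = {}" unfolding S_def by (rule encloses_path_image[OF enc])
  have S_eq: "S = cbox a b - box a b"
    unfolding S_def using M0 by (intro path_image_rectpath_cbox_minus_box) (auto simp: a_def b_def)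
  have imag: "z \<in> S" if "Re z = 0" "\<bar>Im z\<bar> \<le> M" for z
    unfolding S_eq using that M0 by (auto simp: a_def b_def in_box_complex_iff in_cbox_complex_iff)
  have "compact (resolvent m T ` S)"
    by (rule compact_continuous_image[OF continuous_resolvent[OF spec]]) (simp add: S_def compact_path_image)
  then have "bounded (resolvent m T ` S)" by (rule compact_imp_bounded)
  then obtain B where B: "B > 0" "\<And>z. z \<in> S \<Longrightarrow> norm (resolvent m T z) \<le> B"
    unfolding bounded_pos by blast
  \<comment> \<open>A Lipschitz constant: \<open>6 * M\<close> is the perimeter,
    \<open>2 * B\<^sup>2\<close> bounds the resolvent difference per unit of
    \<open>norm (T' - T)\<close>, and the factors \<kappa> come from the differential and from
    \<open>1 / (2 \<pi> i)\<close>.\<close>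
  define C where "C = \<kappa> * (\<kappa> * (6 * M) * (2 * B\<^sup>2))"
  have C: "C \<ge> 0" using \<kappa>_ge M0 by (simp add: C_def)
  define d where "d = min 1 (min (1 / (2 * B)) (e / (C + 1)))"
  have d: "d > 0" "d \<le> 1" "d \<le> 1 / (2 * B)" "d \<le> e / (C + 1)" using B(1) e C by (auto simp: d_def)
  show ?thesis
  proof (intro exI[of _ d] conjI ballI impI d(1))
    fix T' assume T': "T' \<in> ops" and near: "norm (T' - T) < d"
    have M': "2 * \<kappa> * norm T' < M" using M near d by simp
    have diff: "norm (m z - T' - (m z - T)) = norm (T' - T)" for z by (simp add: norm_minus_commute)
    have small: "norm (m z - T' - (m z - T)) * norm (resolvent m T z) \<le> 1 / 2" if "z \<in> S" for z
    proof -
      have "norm (T' - T) * norm (resolvent m T z) \<le> (1 / (2 * B)) * B"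
        using near d B(2)[OF that] B(1) by (intro mult_mono) auto
      then show ?thesis unfolding diff using B(1) by simp
    qed
    note pert = resolvent_perturb[OF _ small]
    have pert1: "z \<notin> complex_spectrum m T'" if "z \<in> S" for z using pert(1)[OF _ that] spec that by blast
    show hyp': "no_imaginary_spectrum T'"
      unfolding no_imaginary_spectrum_def
    proof (rule equals0I)
      fix z assume "z \<in> complex_spectrum m T' \<inter> {z. Re z = 0}"
      then have z: "z \<in> complex_spectrum m T'" "Re z = 0" by auto
      then have "z \<in> S" using spectrum_bounded(3)[OF M' z(1)] by (intro imag) auto
      then show False using pert1 z(1) by blast
    qed
    have c': "continuous_on S (resolvent m T')" using pert1 by (intro continuous_resolvent) blast
    have c: "continuous_on S (resolvent m T)" by (rule continuous_resolvent[OF spec])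
    have "positive_part T' - positive_part T
        = m (1 / (2 * pi * \<i>)) o\<^sub>L rint (\<lambda>z. resolvent m T' z - resolvent m T z) a b"
      unfolding positive_part_eq[OF T' hyp' M'] positive_part_eq[OF T hyp MT] a_def[symmetric] b_def[symmetric]
        rint_diff[OF c'[unfolded S_def] c[unfolded S_def]]
      by (simp add: compose_simps)
    also have "norm \<dots> \<le> norm (m (1 / (2 * pi * \<i>))) * norm (rint (\<lambda>z. resolvent m T' z - resolvent m T z) a b)"
      by (rule norm_blinfun_compose)
    also have "\<dots> \<le> \<kappa> * (\<kappa> * (2 * \<bar>Re b - Re a\<bar> + 2 * \<bar>Im b - Im a\<bar>) * (2 * B\<^sup>2 * norm (T' - T)))"
    proof (intro mult_mono)
      have "cmod (1 / (2 * pi * \<i>)) \<le> 1"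
        using pi_gt3 by (simp add: norm_divide norm_mult)
      then have "\<kappa> * cmod (1 / (2 * pi * \<i>)) \<le> \<kappa> * 1" using \<kappa>_ge by (intro mult_left_mono) auto
      then show "norm (m (1 / (2 * pi * \<i>))) \<le> \<kappa>" using norm_m[of "1 / (2 * pi * \<i>)"] by linarith
      show "norm (rint (\<lambda>z. resolvent m T' z - resolvent m T z) a b)
          \<le> \<kappa> * (2 * \<bar>Re b - Re a\<bar> + 2 * \<bar>Im b - Im a\<bar>) * (2 * B\<^sup>2 * norm (T' - T))"
      proof (rule rint_bound)
        show "continuous_on (path_image (rectpath a b)) (\<lambda>z. resolvent m T' z - resolvent m T z)"
          using c c' unfolding S_def by (intro continuous_on_diff)
        fix z assume "z \<in> path_image (rectpath a b)"
        then have z: "z \<in> S" by (simp add: S_def)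
        then have "norm (resolvent m T' z - resolvent m T z) \<le> 2 * (norm (resolvent m T z))\<^sup>2 * norm (T' - T)"
          using pert(2)[OF _ z] spec unfolding diff by blast
        also have "\<dots> \<le> 2 * B\<^sup>2 * norm (T' - T)"
          using B(2)[OF z] by (intro mult_right_mono mult_left_mono power_mono) auto
        finally show "norm (resolvent m T' z - resolvent m T z) \<le> 2 * B\<^sup>2 * norm (T' - T)" .
      qed simp
    qed (use \<kappa>_ge in auto)
    also have "\<dots> = C * norm (T' - T)"
      using M0 by (simp add: a_def b_def C_def)
    also have "\<dots> \<le> (C + 1) * norm (T' - T)" by (intro mult_right_mono) auto
    also have "\<dots> < (C + 1) * (e / (C + 1))" using near d(4) C by (intro mult_strict_left_mono) auto
    also have "\<dots> = e" using C by simp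
    finally show "norm (positive_part T' - positive_part T) < e" .
  qed
qed

text \<open>\<open>J\<close> is an antilinear involution. Conjugation maps the rectangle to itself
  with reversed orientation, which changes the sign of the integral, and
  \<open>1 / (2 \<pi> i)\<close> changes sign under conjugation as well.\<close>

lemma positive_part_conjugation:
  assumes T: "T \<in> ops" and hyp: "no_imaginary_spectrum T"
    and J: "J o\<^sub>L J = id_blinfun" "\<And>c. J o\<^sub>L m c = m (cnj c) o\<^sub>L J" "J o\<^sub>L T = T o\<^sub>L J"
  shows "J o\<^sub>L positive_part T = positive_part T o\<^sub>L J"
proof -
  define M where "M = 2 * \<kappa> * norm T + 1"
  have M: "2 * \<kappa> * norm T < M" by (simp add: M_def)
  define a where "a = Complex 0 (- M)"
  define b where "b = Complex M M"
  define R where "R = resolvent m T"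
  have enc: "encloses T {z \<in> complex_spectrum m T. Re z > 0} a b"
    unfolding a_def b_def by (rule encloses_positive[OF hyp M])
  note spec = encloses_path_image[OF enc]
  have cancel: "J o\<^sub>L (J o\<^sub>L X) = X" "(X o\<^sub>L J) o\<^sub>L J = X" for X
    using J(1) by (simp_all add: compose_assoc[symmetric]) (simp add: compose_assoc J(1))
  have JR: "R (cnj z) = J o\<^sub>L (R z o\<^sub>L J)" if z: "z \<notin> complex_spectrum m T" for z
    unfolding R_def
  proof (rule resolvent_eqI)
    have JS: "J o\<^sub>L (m z - T) = (m (cnj z) - T) o\<^sub>L J" by (simp add: compose_simps J)
    have ip: "resolvent m T z o\<^sub>L (m z - T) = id_blinfun" "(m z - T) o\<^sub>L resolvent m T z = id_blinfun"
      using resolvent_inverse[OF z] by (auto simp: inverse_pair_def)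
    have S: "m (cnj z) - T = J o\<^sub>L ((m z - T) o\<^sub>L J)"
      unfolding compose_assoc[symmetric] JS using cancel(2) by simp
    show "inverse_pair (m (cnj z) - T) (J o\<^sub>L (resolvent m T z o\<^sub>L J))"
      unfolding inverse_pair_def S
    proof
      have "(J o\<^sub>L (resolvent m T z o\<^sub>L J)) o\<^sub>L (J o\<^sub>L ((m z - T) o\<^sub>L J))
          = J o\<^sub>L ((resolvent m T z o\<^sub>L (m z - T)) o\<^sub>L J)"
        by (simp only: compose_assoc cancel)
      then show "(J o\<^sub>L (resolvent m T z o\<^sub>L J)) o\<^sub>L (J o\<^sub>L ((m z - T) o\<^sub>L J)) = id_blinfun"
        by (simp only: ip blinfun_compose_id J(1))
      have "(J o\<^sub>L ((m z - T) o\<^sub>L J)) o\<^sub>L (J o\<^sub>L (resolvent m T z o\<^sub>L J))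
          = J o\<^sub>L (((m z - T) o\<^sub>L resolvent m T z) o\<^sub>L J)"
        by (simp only: compose_assoc cancel)
      then show "(J o\<^sub>L ((m z - T) o\<^sub>L J)) o\<^sub>L (J o\<^sub>L (resolvent m T z o\<^sub>L J)) = id_blinfun"
        by (simp only: ip blinfun_compose_id J(1))
    qed
  qed
  have edge: "lint R (cnj (corner a b i)) (cnj (corner a b (Suc i))) = J o\<^sub>L (lint R (corner a b i) (corner a b (Suc i)) o\<^sub>L J)"
    if i: "i < 4" for i
  proof (rule lint_linear[where f = cnj and h = "\<lambda>X. J o\<^sub>L (X o\<^sub>L J)"])
    show "continuous_on (closed_segment (corner a b i) (corner a b (Suc i))) R"
      unfolding R_def using spec rectpath_edge[OF i, of a b] by (intro continuous_resolvent) blast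
    show "bounded_linear (\<lambda>X. J o\<^sub>L (X o\<^sub>L J))"
      by (rule bounded_linear_compose[OF bounded_bilinear.bounded_linear_right[OF compose_bilinear]
            bounded_bilinear.bounded_linear_left[OF compose_bilinear]])
    fix z assume "z \<in> closed_segment (corner a b i) (corner a b (Suc i))"
    then have "z \<notin> complex_spectrum m T" using spec rectpath_edge[OF i, of a b] by blast
    from JR[OF this]
    show "J o\<^sub>L ((m (corner a b (Suc i) - corner a b i) o\<^sub>L R z) o\<^sub>L J)
        = m (cnj (corner a b (Suc i)) - cnj (corner a b i)) o\<^sub>L R (cnj z)"
      by (simp add: compose_assoc[symmetric] J(2))
  next
    show "cnj (linepath (corner a b i) (corner a b (Suc i)) t)
        = linepath (cnj (corner a b i)) (cnj (corner a b (Suc i))) t" for t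
      by (simp add: linepath_def)
  qed
  have rev: "lint R (corner a b (Suc i)) (corner a b i) = - lint R (corner a b i) (corner a b (Suc i))" if "i < 4" for i
    unfolding R_def
    by (rule lint_reverse[OF T convex_closed_segment]) (use spec rectpath_edge[OF that, of a b] in auto)
  have "J o\<^sub>L (rint R a b o\<^sub>L J) = (\<Sum>i<4. lint R (cnj (corner a b i)) (cnj (corner a b (Suc i))))"
    unfolding rint_def compose_simps by (intro sum.cong edge[symmetric]) auto
  \<comment> \<open>The rectangle is symmetric about the real axis, so conjugating the corners lists
    them clockwise, starting from the upper left.\<close>
  also have "\<dots> = lint R (corner a b 4) (corner a b 3) + lint R (corner a b 3) (corner a b 2)
      + lint R (corner a b 2) (corner a b 1) + lint R (corner a b 1) (corner a b 0)"
  proof -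
    have cnj: "cnj a = Complex 0 M" "cnj (Complex M (- M)) = b" "cnj b = Complex M (- M)" "cnj (Complex 0 M) = a"
      by (simp_all add: a_def b_def complex_eq_iff)
    have "{..<4::nat} = {0, 1, 2, 3}" by auto
    then show ?thesis using cnj by (simp add: a_def b_def algebra_simps)
  qed
  also have "\<dots> = - rint R a b"
  proof -
    have "{..<4::nat} = {0, 1, 2, 3}" by auto
    then show ?thesis
      unfolding rint_def using rev[of 0] rev[of 1] rev[of 2] rev[of 3] by (simp add: algebra_simps)
  qed
  finally have *: "J o\<^sub>L (rint R a b o\<^sub>L J) = - rint R a b" .
  define c where "c = 1 / (2 * pi * \<i>)"
  have c: "cnj c = - c" by (simp add: c_def)
  have P: "positive_part T = m c o\<^sub>L rint R a b"
    unfolding positive_part_eq[OF T hyp M] c_def R_def a_def b_def ..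
  have "J o\<^sub>L (positive_part T o\<^sub>L J) = (J o\<^sub>L m c) o\<^sub>L (rint R a b o\<^sub>L J)" by (simp add: P compose_assoc)
  also have "\<dots> = m (cnj c) o\<^sub>L (J o\<^sub>L (rint R a b o\<^sub>L J))" by (simp only: J(2) compose_assoc)
  also have "\<dots> = positive_part T" by (simp add: * c m_minus compose_simps P)
  finally have "positive_part T o\<^sub>L J = (J o\<^sub>L (positive_part T o\<^sub>L J)) o\<^sub>L J" by simp
  also have "\<dots> = J o\<^sub>L positive_part T" by (simp only: compose_assoc cancel J(1) blinfun_compose_id)
  finally show ?thesis by simp
qed

end

section \<open>Transfer to real and complex scalars\<close>

lemma complex_multiplication_of_scalars:
  assumes "banach_over (Complex_Scalars m)"
  shows "complex_multiplication m"
proof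
  show "m (c + d) = m c + m d" for c d using assms by (auto intro!: blinfun_eqI simp: blinfun.add_left)
  show "m (c * d) = m c o\<^sub>L m d" for c d using assms by (auto intro!: blinfun_eqI)
  show "m (complex_of_real r) = r *\<^sub>R id_blinfun" for r
    using assms by (auto intro!: blinfun_eqI simp: blinfun.scaleR_left)
qed

interpretation complexification: complex_multiplication "complexified_scale :: complex \<Rightarrow> ('a::banach \<times> 'a) \<Rightarrow>\<^sub>L ('a \<times> 'a)"
proof
  show "complexified_scale (c + d) = complexified_scale c + complexified_scale d" for c d
    by (rule blinfun_eqI)
      (auto simp: complexified_scale.rep_eq blinfun.add_left algebra_simps split: prod.splits)
  show "complexified_scale (c * d) = complexified_scale c o\<^sub>L complexified_scale d" for c d
    by (rule blinfun_eqI, rule prod_eqI)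
      (simp_all add: complexified_scale.rep_eq case_prod_unfold algebra_simps)
  show "complexified_scale (complex_of_real r) = r *\<^sub>R id_blinfun" for r
    by (rule blinfun_eqI)
      (auto simp: complexified_scale.rep_eq blinfun.scaleR_left split: prod.splits)
qed

lemma complexify_in_ops: "complexify T \<in> complexification.ops"
  unfolding complexification.ops_def
  by (auto intro!: blinfun_eqI simp: complexified_scale.rep_eq complexify.rep_eq blinfun.bilinear_simps)

lemma norm_complexify_diff: "norm (complexify S - complexify T) \<le> norm (S - T)"
proof (rule norm_blinfun_bound)
  fix p :: "'a \<times> 'a"
  obtain x y where p: "p = (x, y)" by fastforce
  have "norm ((complexify S - complexify T) p) = sqrt ((norm ((S - T) x))\<^sup>2 + (norm ((S - T) y))\<^sup>2)"
    by (simp add: p complexify.rep_eq blinfun.diff_left norm_Pair)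
  also have "\<dots> \<le> sqrt ((norm (S - T) * norm x)\<^sup>2 + (norm (S - T) * norm y)\<^sup>2)"
    by (intro real_sqrt_le_mono add_mono power_mono norm_blinfun) auto
  also have "\<dots> = norm (S - T) * norm p"
    by (simp add: p norm_Pair power_mult_distrib distrib_left[symmetric] real_sqrt_mult)
  finally show "norm ((complexify S - complexify T) p) \<le> norm (S - T) * norm p" .
qed simp

lift_definition complex_conjugation :: "('a::real_normed_vector \<times> 'a) \<Rightarrow>\<^sub>L ('a \<times> 'a)"
  is "\<lambda>(x, y). (x, - y)"
  unfolding case_prod_unfold
  by (intro bounded_linear_Pair bounded_linear_minus bounded_linear_fst bounded_linear_snd)

lemma real_part_operator_diff: "real_part_operator (S - T) = real_part_operator S - real_part_operator T"
  by (rule blinfun_eqI) (simp add: real_part_operator.rep_eq blinfun.diff_left)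

lemma real_part_operator_add: "real_part_operator (S + T) = real_part_operator S + real_part_operator T"
  by (rule blinfun_eqI) (simp add: real_part_operator.rep_eq blinfun.add_left)

lemma real_part_operator_id: "real_part_operator id_blinfun = id_blinfun"
  by (rule blinfun_eqI) (simp add: real_part_operator.rep_eq)

lemma norm_real_part_operator: "norm (real_part_operator S) \<le> norm S"
proof (rule norm_blinfun_bound)
  fix x
  have "norm (real_part_operator S x) \<le> norm (S (x, 0))"
    using norm_fst_le[of "fst (S (x, 0))" "snd (S (x, 0))"] by (simp add: real_part_operator.rep_eq)
  also have "\<dots> \<le> norm S * norm (x, 0::'a)" by (rule norm_blinfun)
  finally show "norm (real_part_operator S x) \<le> norm S * norm x" by (simp add: norm_Pair)
qed simp

lemma hyperbolic_projectors:
  assumes K: "banach_over K" and T: "T \<in> operators K" and hyp: "hyperbolic K T"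
  shows "projector K (positive_projector K T)"
    and "spectral_projector K T {z \<in> spectrum K T. Re z < 0} = id_blinfun - positive_projector K T"
proof -
  have "projector K (positive_projector K T) \<and>
    spectral_projector K T {z \<in> spectrum K T. Re z < 0} = id_blinfun - positive_projector K T"
  proof (cases K)
    case (Complex_Scalars m)
    interpret complex_multiplication m
      using K Complex_Scalars complex_multiplication_of_scalars by blast
    have T': "T \<in> ops" and hyp': "no_imaginary_spectrum T"
      using T hyp by (auto simp: Complex_Scalars ops_def hyperbolic_def no_imaginary_spectrum_def)
    have P: "positive_projector K T = positive_part T"
      by (simp add: positive_projector_def Complex_Scalars positive_part_def)
    have "projector K (positive_part T)"
      using positive_part_in_ops[OF T' hyp'] positive_part_idempotent[OF T' hyp']
      by (simp add: projector_def Complex_Scalars ops_def)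
    moreover have "negative_part T = id_blinfun - positive_part T"
      using positive_plus_negative[OF T' hyp'] by (simp add: eq_diff_eq add.commute)
    ultimately show ?thesis unfolding P by (simp add: Complex_Scalars negative_part_def)
  next
    case Real_Scalars
    define T' where "T' = complexify T"
    have T': "T' \<in> complexification.ops" unfolding T'_def by (rule complexify_in_ops)
    have hyp': "complexification.no_imaginary_spectrum T'"
      using hyp by (simp add: Real_Scalars T'_def hyperbolic_def complexification.no_imaginary_spectrum_def)
    define P where "P = complexification.positive_part T'"
    have pos: "positive_projector K T = real_part_operator P"
      by (simp add: P_def T'_def Real_Scalars positive_projector_def complexification.positive_part_def)
    have neg: "spectral_projector K T {z \<in> spectrum K T. Re z < 0} = real_part_operator (complexification.negative_part T')"
      by (simp add: T'_def Real_Scalars complexification.negative_part_def)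
    have "real_part_operator P + real_part_operator (complexification.negative_part T') = id_blinfun"
      using complexification.positive_plus_negative[OF T' hyp']
      by (simp add: P_def real_part_operator_add[symmetric] real_part_operator_id)
    \<comment> \<open>Taking real parts is not multiplicative in general. It is here because
      \<open>P\<close> commutes with conjugation and so maps real vectors to real vectors.\<close>
    moreover have "real_part_operator P o\<^sub>L real_part_operator P = real_part_operator P"
    proof (rule blinfun_eqI)
      fix x :: 'a
      have "complex_conjugation o\<^sub>L P = P o\<^sub>L complex_conjugation"
        unfolding P_def
      proof (rule complexification.positive_part_conjugation[OF T' hyp'])
        show "complex_conjugation o\<^sub>L complex_conjugation = (id_blinfun :: ('a \<times> 'a) \<Rightarrow>\<^sub>L ('a \<times> 'a))"
          by (rule blinfun_eqI) (auto simp: complex_conjugation.rep_eq)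
        show "complex_conjugation o\<^sub>L complexified_scale c
            = complexified_scale (cnj c) o\<^sub>L (complex_conjugation :: ('a \<times> 'a) \<Rightarrow>\<^sub>L ('a \<times> 'a))" for c
          by (rule blinfun_eqI) (auto simp: complex_conjugation.rep_eq complexified_scale.rep_eq)
        show "complex_conjugation o\<^sub>L T' = T' o\<^sub>L complex_conjugation"
          by (rule blinfun_eqI)
            (auto simp: T'_def complex_conjugation.rep_eq complexify.rep_eq blinfun.minus_right)
      qed
      then have "(complex_conjugation o\<^sub>L P) (x, 0) = (P o\<^sub>L complex_conjugation) (x, 0)" by simp
      then have "complex_conjugation (P (x, 0)) = P (x, 0)" by (simp add: complex_conjugation.rep_eq)
      then have "snd (P (x, 0)) = - snd (P (x, 0))"
        by (cases "P (x, 0)") (simp add: complex_conjugation.rep_eq)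
      then have "2 *\<^sub>R snd (P (x, 0)) = 0" by (simp add: scaleR_2 eq_neg_iff_add_eq_0)
      then have real: "P (x, 0) = (fst (P (x, 0)), 0)" by (simp add: prod_eq_iff)
      have "P (P (x, 0)) = P (x, 0)"
        using complexification.positive_part_idempotent[OF T' hyp'] unfolding P_def
        by (metis blinfun_apply_blinfun_compose)
      then have "P (fst (P (x, 0)), 0) = P (x, 0)" using real by simp
      then show "(real_part_operator P o\<^sub>L real_part_operator P) x = real_part_operator P x"
        by (simp add: real_part_operator.rep_eq)
    qed
    ultimately show ?thesis unfolding pos neg
      by (simp add: projector_def Real_Scalars eq_diff_eq add.commute)
  qed
  then show "projector K (positive_projector K T)"
    and "spectral_projector K T {z \<in> spectrum K T. Re z < 0} = id_blinfun - positive_projector K T"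
    by auto
qed

lemma hyperbolic_continuous:
  assumes K: "banach_over K" and T: "T \<in> operators K" and hyp: "hyperbolic K T" and e: "e > 0"
  shows "\<exists>d>0. \<forall>T'\<in>operators K. norm (T' - T) < d \<longrightarrow>
    hyperbolic K T' \<and> norm (positive_projector K T' - positive_projector K T) < e"
proof (cases K)
  case (Complex_Scalars m)
  interpret complex_multiplication m
    using K Complex_Scalars complex_multiplication_of_scalars by blast
  have T': "T \<in> ops" and hyp': "no_imaginary_spectrum T"
    using T hyp by (auto simp: Complex_Scalars ops_def hyperbolic_def no_imaginary_spectrum_def)
  have "positive_projector K = positive_part" "hyperbolic K = no_imaginary_spectrum" "operators K = ops"
    by (auto simp: positive_projector_def Complex_Scalars positive_part_def hyperbolic_def
        no_imaginary_spectrum_def ops_def fun_eq_iff)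
  then show ?thesis using positive_part_continuous[OF T' hyp' e] by simp
next
  case Real_Scalars
  have hyp': "complexification.no_imaginary_spectrum (complexify T)"
    using hyp by (simp add: Real_Scalars hyperbolic_def complexification.no_imaginary_spectrum_def)
  obtain d where d: "d > 0" "\<And>S. S \<in> complexification.ops \<Longrightarrow> norm (S - complexify T) < d \<Longrightarrow>
      complexification.no_imaginary_spectrum S \<and>
      norm (complexification.positive_part S - complexification.positive_part (complexify T)) < e"
    using complexification.positive_part_continuous[OF complexify_in_ops hyp' e] by blast
  have pos: "positive_projector K S = real_part_operator (complexification.positive_part (complexify S))" for S
    by (simp add: Real_Scalars positive_projector_def complexification.positive_part_def)
  show ?thesis
  proof (intro exI[of _ d] conjI ballI impI d(1))
    fix T' assume "norm (T' - T) < d"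
    then have "norm (complexify T' - complexify T) < d" using norm_complexify_diff by (rule le_less_trans[rotated])
    note * = d(2)[OF complexify_in_ops this]
    show "hyperbolic K T'"
      using * by (simp add: Real_Scalars hyperbolic_def complexification.no_imaginary_spectrum_def)
    show "norm (positive_projector K T' - positive_projector K T) < e"
      unfolding pos real_part_operator_diff[symmetric]
      using * by (intro le_less_trans[OF norm_real_part_operator]) blast
  qed
qed

section \<open>Spectral flow\<close>

text \<open>The field is a type parameter of the locale, hence a disjunction over the two possible
  fields; the theorem applies the same argument in each case.\<close>

lemma scalar_banach_ex:
  fixes K :: "'a::banach scalars"
  assumes "banach_over K"
  shows "(\<exists>scale :: real \<Rightarrow> 'a \<Rightarrow> 'a. scalar_banach scale K) \<or> (\<exists>scale :: complex \<Rightarrow> 'a \<Rightarrow> 'a. scalar_banach scale K)"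
proof (cases K)
  case Real_Scalars
  then show ?thesis using scalar_banach_real by blast
next
  case (Complex_Scalars m)
  then show ?thesis using scalar_banach_complex[of m] assms by blast
qed

context scalar_banach
begin

text \<open>Stated for an arbitrary filter so as to apply both at infinity, where it yields
  \<delta>, and at a finite time, where it yields continuity of the projectors.\<close>

lemma hyperbolic_path_limit:
  fixes A :: "real \<Rightarrow> 'a \<Rightarrow>\<^sub>L 'a"
  assumes K: "banach_over K" and A: "\<And>t. A t \<in> operators K" and L: "L \<in> operators K" "hyperbolic K L"
    and lim: "(A \<longlongrightarrow> L) F"
  shows "((\<lambda>t. positive_projector K (A t)) \<longlongrightarrow> positive_projector K L) F" "\<forall>\<^sub>F t in F. hyperbolic K (A t)"
proof -
  have ev: "\<forall>\<^sub>F t in F. hyperbolic K (A t) \<and> norm (positive_projector K (A t) - positive_projector K L) < e"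
    if e: "e > 0" for e
  proof -
    obtain d where d: "d > 0" "\<And>T'. T' \<in> operators K \<Longrightarrow> norm (T' - L) < d \<Longrightarrow>
        hyperbolic K T' \<and> norm (positive_projector K T' - positive_projector K L) < e"
      using hyperbolic_continuous[OF K L e] by blast
    have "\<forall>\<^sub>F t in F. dist (A t) L < d" using lim d(1) unfolding tendsto_iff by blast
    then show ?thesis by (rule eventually_mono) (use d(2)[OF A] in \<open>simp add: dist_norm\<close>)
  qed
  show "((\<lambda>t. positive_projector K (A t)) \<longlongrightarrow> positive_projector K L) F"
    unfolding tendsto_iff
  proof (intro allI impI)
    fix e :: real assume "e > 0"
    from ev[OF this] show "\<forall>\<^sub>F t in F. dist (positive_projector K (A t)) (positive_projector K L) < e"
      by (rule eventually_mono) (simp add: dist_norm)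
  qed
  show "\<forall>\<^sub>F t in F. hyperbolic K (A t)"
    using ev[of 1] by (rule eventually_mono) auto
qed

lemma operators_limit:
  assumes A: "\<And>t. A t \<in> operators K" and lim: "(A \<longlongrightarrow> L) F" and F: "F \<noteq> bot"
  shows "L \<in> operators K"
proof -
  have "closed {T :: 'a \<Rightarrow>\<^sub>L 'a. T \<in> operators K}"
  proof (cases K)
    case (Complex_Scalars m)
    have "{T :: 'a \<Rightarrow>\<^sub>L 'a. T \<in> operators K} = (\<Inter>c. {T. T o\<^sub>L m c = m c o\<^sub>L T})"
      by (auto simp: Complex_Scalars)
    moreover have "closed (\<Inter>c. {T. T o\<^sub>L m c = m c o\<^sub>L T})"
      by (intro closed_INT ballI closed_Collect_eq continuous_on_id continuous_on_const
          bounded_bilinear.continuous_on[OF compose_bilinear])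
    ultimately show ?thesis by (simp only:)
  qed simp
  then show ?thesis
    using Lim_in_closed_set[OF _ _ F lim, of "{T. T \<in> operators K}"] A by simp
qed

text \<open>Beyond the point where \<open>A\<close> becomes hyperbolic, its positive projectors form a continuous path,
  so that the limit may be replaced by any \<open>A t\<close>.\<close>

lemma projector_dim_limit:
  fixes A :: "real \<Rightarrow> 'a \<Rightarrow>\<^sub>L 'a"
  assumes K: "banach_over K" and A: "\<And>t. A t \<in> operators K" "continuous_on UNIV A"
    and cpt: "\<And>t s. compact_operator (positive_projector K (A t) - positive_projector K (A s))"
    and L: "hyperbolic K L" and lim: "(A \<longlongrightarrow> L) F" and F: "F \<noteq> bot"
    and S: "connected S" "s \<in> S" "\<forall>\<^sub>F t in F. t \<in> S" and hyp: "\<And>t. t \<in> S \<Longrightarrow> hyperbolic K (A t)"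
  shows "projector K (positive_projector K L)"
    "compact_operator (positive_projector K (A s) - positive_projector K L)"
    "projector_dim K (positive_projector K (A s)) (positive_projector K L) = 0"
proof -
  define P where "P t = positive_projector K (A t)" for t
  define PL where "PL = positive_projector K L"
  have Lop: "L \<in> operators K" by (rule operators_limit[OF A(1) lim F])
  have Plim: "(P \<longlongrightarrow> PL) F"
    unfolding P_def PL_def by (rule hyperbolic_path_limit(1)[OF K A(1) Lop L lim])
  show PL: "projector K (positive_projector K L)" by (rule hyperbolic_projectors(1)[OF K Lop L])
  have P: "projector K (P t)" if "t \<in> S" for t
    unfolding P_def by (rule hyperbolic_projectors(1)[OF K A(1) hyp[OF that]])
  have cL: "compact_operator (P t - PL)" for t
  proof (rule compact_operator_limit[OF _ F])
    show "((\<lambda>u. P t - P u) \<longlongrightarrow> P t - PL) F" by (intro tendsto_intros Plim)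
    show "compact_operator (P t - P u)" for u unfolding P_def by (rule cpt)
  qed
  show "compact_operator (positive_projector K (A s) - positive_projector K L)"
    using cL[of s] by (simp add: P_def PL_def)
  have cont: "continuous_on S P"
    unfolding continuous_on_def
  proof
    fix t assume t: "t \<in> S"
    have "(A \<longlongrightarrow> A t) (at t within S)" using A(2) unfolding continuous_on_def by (meson UNIV_I tendsto_within_subset subset_UNIV)
    then show "(P \<longlongrightarrow> P t) (at t within S)"
      unfolding P_def by (rule hyperbolic_path_limit(1)[OF K A(1) A(1) hyp[OF t]])
  qed
  have "((\<lambda>u. (1 + norm PL) * norm (P u - PL)) \<longlongrightarrow> (1 + norm PL) * norm (PL - PL)) F"
    by (intro tendsto_intros Plim)
  then have "\<forall>\<^sub>F u in F. (1 + norm PL) * norm (P u - PL) < 1" by (rule order_tendstoD) simp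
  \<comment> \<open>A time close enough to the limit: up to \<open>u\<close> the index is constant
    along the path, and from \<open>u\<close> to the limit the projectors are close.\<close>
  then obtain u where u: "u \<in> S" "(1 + norm PL) * norm (P u - PL) < 1"
    using eventually_happens'[OF F eventually_conj[OF S(3)]] by blast
  have "projector_dim K (P u) PL = 0"
    by (rule projector_dim_near[OF P[OF u(1)] PL[folded PL_def] cL u(2)])
  moreover have "projector_dim K (P s) (P u) = 0"
    by (rule projector_dim_path[OF S(1,2) u(1) cont P]) (simp_all add: P_def cpt)
  ultimately show "projector_dim K (positive_projector K (A s)) (positive_projector K L) = 0"
    using projector_dim_trans[OF P[OF S(2)] P[OF u(1)] PL[folded PL_def] _ cL] cpt[of s u]
    by (simp add: P_def PL_def)
qed

lemma spectral_flow_eq: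
  fixes A :: "real \<Rightarrow> 'a \<Rightarrow>\<^sub>L 'a"
  assumes K: "banach_over K" and A: "\<And>t. A t \<in> operators K" and hyp: "asymptotically_hyperbolic K A"
    and cpt: "\<And>t s. compact_operator (positive_projector K (A t) - positive_projector K (A s))"
  shows "compact_perturbation K (negative_space K (Lim at_top A)) (negative_space K (Lim at_bot A))
    \<and> spectral_flow K A
      = - relative_dim K (negative_space K (Lim at_top A)) (negative_space K (Lim at_bot A))"
proof -
  obtain L L' where cont: "continuous_on UNIV A"
      and L: "(A \<longlongrightarrow> L) at_top" "hyperbolic K L" and L': "(A \<longlongrightarrow> L') at_bot" "hyperbolic K L'"
    using hyp unfolding asymptotically_hyperbolic_def by blast
  have Lim: "Lim at_top A = L" "Lim at_bot A = L'"
    using L(1) L'(1) by (auto intro: tendsto_Lim)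
  have Lop: "L \<in> operators K" "L' \<in> operators K"
    using operators_limit[OF A L(1)] operators_limit[OF A L'(1)] by auto
  define P where "P t = positive_projector K (A t)" for t
  define PL where "PL = positive_projector K L"
  define PL' where "PL' = positive_projector K L'"
  define \<delta> where "\<delta> = (SOME \<delta>. \<delta> > 0 \<and> (\<forall>t. \<bar>t\<bar> \<ge> \<delta> \<longrightarrow> hyperbolic K (A t)))"
  have "\<exists>\<delta>. \<delta> > 0 \<and> (\<forall>t. \<bar>t\<bar> \<ge> \<delta> \<longrightarrow> hyperbolic K (A t))"
  proof -
    obtain b c where b: "\<And>t. t \<ge> b \<Longrightarrow> hyperbolic K (A t)" and c: "\<And>t. t \<le> c \<Longrightarrow> hyperbolic K (A t)"
      using hyperbolic_path_limit(2)[OF K A Lop(1) L(2,1)] hyperbolic_path_limit(2)[OF K A Lop(2) L'(2,1)]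
      unfolding eventually_at_top_linorder eventually_at_bot_linorder by blast
    have "hyperbolic K (A t)" if "\<bar>t\<bar> \<ge> max 1 (max b (- c))" for t
    proof (cases "t \<ge> b")
      case False
      then have "t \<le> c" using that by (auto simp: abs_if split: if_splits)
      then show ?thesis by (rule c)
    qed (rule b)
    \<comment> \<open>The one guarantees positivity even when \<open>A\<close> is hyperbolic from
      early on.\<close>
    then show ?thesis by (intro exI[of _ "max 1 (max b (- c))"]) auto
  qed
  then have "\<delta> > 0 \<and> (\<forall>t. \<bar>t\<bar> \<ge> \<delta> \<longrightarrow> hyperbolic K (A t))" unfolding \<delta>_def by (rule someI_ex)
  then have \<delta>: "\<delta> > 0" "\<And>t. \<bar>t\<bar> \<ge> \<delta> \<Longrightarrow> hyperbolic K (A t)" by auto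
  note ends = projector_dim_limit[OF K A cont cpt L(2,1) trivial_limit_at_top_linorder, of "{\<delta>..}" \<delta>]
    projector_dim_limit[OF K A cont cpt L'(2,1) trivial_limit_at_bot_linorder, of "{..- \<delta>}" "- \<delta>"]
  have S: "connected {\<delta>..}" "connected {..- \<delta>}" "\<forall>\<^sub>F t in at_top. t \<in> {\<delta>..}" "\<forall>\<^sub>F t in at_bot. t \<in> {..- \<delta>}"
    "\<And>t. t \<in> {\<delta>..} \<Longrightarrow> hyperbolic K (A t)" "\<And>t. t \<in> {..- \<delta>} \<Longrightarrow> hyperbolic K (A t)"
    using \<delta> by (auto simp: eventually_ge_at_top eventually_le_at_bot)
  have PL: "projector K PL" "compact_operator (P \<delta> - PL)" "projector_dim K (P \<delta>) PL = 0"
    unfolding P_def PL_def using ends(1,2,3)[OF S(1) _ S(3) S(5)] by simp_all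
  have PL': "projector K PL'" "compact_operator (P (- \<delta>) - PL')" "projector_dim K (P (- \<delta>)) PL' = 0"
    unfolding P_def PL'_def using ends(4,5,6)[OF S(2) _ S(4) S(6)] by simp_all
  have P: "projector K (P \<delta>)" "projector K (P (- \<delta>))"
    unfolding P_def using hyperbolic_projectors(1)[OF K A \<delta>(2)] \<delta>(1) by simp_all
  have PP: "compact_operator (P s - P t)" for s t unfolding P_def by (rule cpt)
  have dim_L: "projector_dim K PL PL' = projector_dim K (P \<delta>) (P (- \<delta>))"
  proof -
    have c: "compact_operator (PL - P \<delta>)" by (rule compact_operator_diff_swap[OF PL(2)])
    have "projector_dim K PL (P \<delta>) = 0" using projector_dim_swap[OF P(1) PL(1,2)] PL(3) by simp
    moreover have "projector_dim K PL (P (- \<delta>)) = projector_dim K PL (P \<delta>) + projector_dim K (P \<delta>) (P (- \<delta>))"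
      by (rule projector_dim_trans[OF PL(1) P c PP])
    moreover have "projector_dim K PL PL' = projector_dim K PL (P (- \<delta>)) + projector_dim K (P (- \<delta>)) PL'"
      by (rule projector_dim_trans[OF PL(1) P(2) PL'(1) compact_operator_diff_trans[OF c PP] PL'(2)])
    ultimately show ?thesis using PL'(3) by simp
  qed
  have cLL: "compact_operator (PL - PL')"
    by (rule compact_operator_diff_trans[OF compact_operator_diff_swap[OF PL(2)]
          compact_operator_diff_trans[OF PP PL'(2)]])
  have neg: "negative_space K L = range (id_blinfun - PL)" "negative_space K L' = range (id_blinfun - PL')"
    unfolding negative_space_def PL_def PL'_def
    by (simp_all only: hyperbolic_projectors(2)[OF K Lop(1) L(2)] hyperbolic_projectors(2)[OF K Lop(2) L'(2)])
  have compl: "projector_dim K (id_blinfun - PL) (id_blinfun - PL') = - projector_dim K PL PL'"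
    by (rule projector_dim_compl[OF PL(1) PL'(1) cLL])
  have cp: "compact_perturbation K (negative_space K L) (negative_space K L')"
  proof -
    have "compact_operator ((id_blinfun - PL) - (id_blinfun - PL'))"
      using compact_operator_diff_swap[OF cLL] by simp
    from essentially_equalI[OF projector_compl[OF PL(1)] projector_compl[OF PL'(1)] this]
    show ?thesis unfolding compact_perturbation_def neg essentially_equal_def by blast
  qed
  define good where "good Q \<longleftrightarrow> continuous_on {- \<delta>..\<delta>} Q \<and>
    (\<forall>t\<in>{- \<delta>..\<delta>}. projector K (Q t) \<and> compact_operator (Q t - P t))" for Q
  \<comment> \<open>A constant path suffices as a witness, since all positive projectors differ by
    compact operators. The path actually chosen remains arbitrary.\<close>
  have "good (\<lambda>t. P \<delta>)" unfolding good_def using P(1) PP by simp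
  then have "good (SOME Q. good Q)" by (rule someI[of good])
  moreover define Q where "Q = (SOME Q. good Q)"
  ultimately have Q: "continuous_on {- \<delta>..\<delta>} Q" "\<And>t. t \<in> {- \<delta>..\<delta>} \<Longrightarrow> projector K (Q t)"
    "\<And>t. t \<in> {- \<delta>..\<delta>} \<Longrightarrow> compact_operator (Q t - P t)"
    by (auto simp: good_def)
  have mem: "- \<delta> \<in> {- \<delta>..\<delta>}" "\<delta> \<in> {- \<delta>..\<delta>}" using \<delta>(1) by auto
  have "spectral_flow K A = projector_dim K (Q (- \<delta>)) (P (- \<delta>)) - projector_dim K (Q \<delta>) (P \<delta>)"
    unfolding spectral_flow_def spectral_flow_on_def Let_def \<delta>_def[symmetric] P_def[symmetric]
      good_def[symmetric] Q_def[symmetric] ..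
  moreover have "projector_dim K (Q \<delta>) (Q (- \<delta>)) = 0"
  proof (rule projector_dim_path[OF _ mem(2,1) Q(1,2)])
    fix s t assume st: "s \<in> {- \<delta>..\<delta>}" "t \<in> {- \<delta>..\<delta>}"
    show "compact_operator (Q s - Q t)"
      by (rule compact_operator_diff_trans[OF Q(3)[OF st(1)]
            compact_operator_diff_trans[OF PP compact_operator_diff_swap[OF Q(3)[OF st(2)]]]])
  qed auto
  moreover have "projector_dim K (Q \<delta>) (P (- \<delta>)) = projector_dim K (Q \<delta>) (Q (- \<delta>)) + projector_dim K (Q (- \<delta>)) (P (- \<delta>))"
  proof (rule projector_dim_trans[OF Q(2)[OF mem(2)] Q(2)[OF mem(1)] P(2) _ Q(3)[OF mem(1)]])
    show "compact_operator (Q \<delta> - Q (- \<delta>))"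
      by (rule compact_operator_diff_trans[OF Q(3)[OF mem(2)]
            compact_operator_diff_trans[OF PP compact_operator_diff_swap[OF Q(3)[OF mem(1)]]]])
  qed
  moreover have "projector_dim K (Q \<delta>) (P (- \<delta>)) = projector_dim K (Q \<delta>) (P \<delta>) + projector_dim K (P \<delta>) (P (- \<delta>))"
    by (rule projector_dim_trans[OF Q(2)[OF mem(2)] P Q(3)[OF mem(2)] PP])
  \<comment> \<open>The index from \<open>Q \<delta>\<close> to \<open>P (- \<delta>)\<close> is
    computed in two ways, through \<open>Q (- \<delta>)\<close> and through
    \<open>P \<delta>\<close>. Comparing them leaves the index from \<open>P \<delta>\<close> to
    \<open>P (- \<delta>)\<close>.\<close>
  ultimately have "spectral_flow K A = projector_dim K PL PL'" using dim_L by simp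
  also have "\<dots> = - relative_dim K (negative_space K L) (negative_space K L')"
    using compl unfolding neg projector_dim_def by simp
  finally show ?thesis using cp Lim by simp
qed

end

theorem theorem3p5:
  fixes K :: "'a::banach scalars"
    and A :: "real \<Rightarrow> 'a \<Rightarrow>\<^sub>L 'a"
  assumes "banach_over K"
    and "\<And>t. A t \<in> operators K"
    and "asymptotically_hyperbolic K A"
    and "\<And>t. essentially_hyperbolic K (A t)"
    and "\<And>t s. compact_operator (positive_projector K (A t) - positive_projector K (A s))"
  shows "compact_perturbation K (negative_space K (Lim at_top A)) (negative_space K (Lim at_bot A))
    \<and> spectral_flow K A
      = - relative_dim K (negative_space K (Lim at_top A)) (negative_space K (Lim at_bot A))"
  using scalar_banach_ex[OF assms(1)]
proof (elim disjE exE)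
  fix scale :: "real \<Rightarrow> 'a \<Rightarrow> 'a" assume "scalar_banach scale K"
  then interpret scalar_banach scale K .
  show ?thesis by (rule spectral_flow_eq[OF assms(1,2,3,5)])
next
  fix scale :: "complex \<Rightarrow> 'a \<Rightarrow> 'a" assume "scalar_banach scale K"
  then interpret scalar_banach scale K .
  show ?thesis by (rule spectral_flow_eq[OF assms(1,2,3,5)])
qed

end
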